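(* Consider a system $x^{k+1}Y'=A(x)Y$, $x\in\mathbb C$, $Y\in\mathbb C^n$, where $k\ge 1$, $n\ge 2$, $A$ is an $n\times n$ matrix of germs of holomorphic functions at $0$, and $A(0)=\mathrm{diag}(\lambda_1,\dots,\lambda_n)$ with $\mathfrak R(\lambda_1)>\mathfrak R(\lambda_2)>\dots>\mathfrak R(\lambda_n)$. Let $C(1),\dots,C(2k)$ be Stokes matrices of the system associated to a collection of sectors $S_1,\dots,S_{2k}$ corresponding to the starting ray $\mathbb R^+$ (see context; indices are modulo $2k$). Let $0<\phi_1<\dots<\phi_{2ku}<2\pi$ be the arguments of the separating rays. Let $\theta\in(\phi_1,\phi_2)$ and take $e^{i\theta}\mathbb R^+$ as new starting ray, where $\theta$ is such that the new sectors can be chosen as $\widetilde S_j=e^{i\theta}S_j$, $j=1,\dots,2k$ (i.e. each $\widetilde S_j$ also contains exactly one separating ray for each pair of eigenvalues). Let $\widetilde C(1),\dots,\widetilde C(2k)$ be the Stokes matrices associated to the sectors $\widetilde S_j$. Suppose that the order of eigenvalues on the separating ray $R_1=e^{i\phi_1}\mathbb R^+$ is given by $\overline m=(s_1,r_2,s_3,r_4,\dots,r_{2m},s_{2m+1})$. Write each $C(j)$ in block form $\left(C(j)_{i,\ell}\right)_{i,\ell\in\{1,\dots,2m+1\}}$, with the sizes of the blocks corresponding to the partition of $n$ given by $\overline m$. Then the Stokes matrices $\widetilde C(j)$ can be chosen, simultaneously for $j=1,\dots,2k$, as $$\begin{aligned}\widetilde C(j)=\;&P_{\overline m}\cdot\mathrm{diag}\left(I_{s_1},\,C(j)_{2,2}^{-1},\,I_{s_3},\,\dots,\,C(j)_{2m,2m}^{-1},\,I_{s_{2m+1}}\right)\cdot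 C(j)\\ &\cdot\mathrm{diag}\left(I_{s_1},\,C(j+1)_{2,2},\,I_{s_3},\,\dots,\,C(j+1)_{2m,2m},\,I_{s_{2m+1}}\right)\cdot P_{\overline m}.\end{aligned}$$
   Context: **Formal normal form.** There is a unique formal series $\hat H(x)=\mathrm{id}+O(x)$ such that $Y=\hat H(x)Z$ brings the system to the diagonal form $x^{k+1}Z'=(D_0+D_1x+\dots+D_kx^k)Z$ with all $D_i$ diagonal and $D_0=A(0)$. Let $W(x)=\mathrm{diag}(\omega_1(x),\dots,\omega_n(x))$ be the diagonal fundamental matrix solution of the normal form, $W(x)=\exp\left(-\frac{D_0}{kx^k}-\frac{D_1}{(k-1)x^{k-1}}-\dots-\frac{D_{k-1}}{x}\right)x^{D_k}$ (a branch of it is fixed on each sector considered). **Separating rays.** For a pair $p\ne q$, the separating rays of the pair $(\lambda_p,\lambda_q)$ are the half-lines $e^{i\phi}\mathbb R^+$ in the $x$-plane on which $\mathfrak R\left(\frac{\lambda_p-\lambda_q}{x^k}\right)=0$; there are $2k$ of them for each pair, spaced by $\pi/k$, and different pairs may share the same rays. The total number of distinct separating rays is written $2ku$. Under $\mathfrak R(\lambda_1)>\dots>\mathfrak R(\lambda_n)$ the ray $\mathbb R^+$ is not separating. **Sectors for the starting ray $\mathbb R^+$.** The sectors are $S_j=\left\{x: 0<|x|<r,\ \arg x\in\left(\frac{(j-1)\pi}{k}-\eta,\ \frac{j\pi}{k}+\eta\right)\right\}$, $j=1,\dots,2k$, with $r,\eta>0$ small, $\eta$ being such that each $S_j$ contains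 exactly one separating ray for each pair of eigenvalues. On $S_j$ (for $r$ small) there is a unique holomorphic invertible matrix function $H_j$ which is asymptotic to $\hat H$ on $S_j$ and such that $Y=H_j(x)Z$ conjugates the system to its normal form. **Stokes matrices for the starting ray $\mathbb R^+$.** This gives the fundamental matrix solution $W_j=H_jW$ on $S_j$, which is considered up to right multiplication by an invertible constant diagonal matrix. On the part of $S_j\cap S_{j+1}$ around the ray of argument $j\pi/k$ (indices modulo $2k$; for $j=2k$ this is the ray $\mathbb R^+$), one defines $C(j)\in GL(n,\mathbb C)$ by $W_{j+1}=W_jC(j)$. The collection of Stokes matrices is thus determined up to $C(j)\mapsto K_j^{-1}C(j)K_{j+1}$ with $K_1,\dots,K_{2k}$ invertible constant diagonal matrices, indices modulo $2k$. With the chosen ordering of eigenvalues, $C(j)$ is upper triangular for $j$ even and lower triangular for $j$ odd. **Stokes matrices for the starting ray $e^{i\theta}\mathbb R^+$.** The construction is the same with the sectors $\widetilde S_j=e^{i\theta}S_j$, after permuting the coordinates so that the eigenvalues are in decreasing order of their projections $\mathfrak R(\lambda e^{-ik\theta})$. Explicitly: if $\sigma$ is the permutation with $\mathfrak R(\lambda_{\sigma(1)}e^{-ik\theta})>\dots>\mathfrak R(\lambda_{\sigma(n)}e^{-ik\theta})$, and $\widetilde H_j$ is the unique normalizing holomorphic matrix function on $\widetilde S_j$ asymptotic to $\hat H$ on $\widetilde S_j$, then $\widetilde W_j$ is the fundamental matrix solution whose $\ell$-th column is the $\sigma(\ell)$-th column of $\widetilde H_jW$, up to right multiplication by an invertible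 constant diagonal matrix. The matrix $\widetilde C(j)$ is defined by $\widetilde W_{j+1}=\widetilde W_j\widetilde C(j)$ on the part of $\widetilde S_j\cap\widetilde S_{j+1}$ around the ray of argument $\theta+j\pi/k$. "Can be chosen as" means that for some choice of the $\widetilde W_j$ (within this diagonal freedom) the resulting $\widetilde C(j)$ are given by the formula. **Order of eigenvalues on a ray.** Let $R=e^{i\phi}\mathbb R^+$ and $\mathrm{pr}(\lambda_j)=\mathfrak R(\lambda_je^{-ik\phi})$. Let $n=s_1+r_2+s_3+r_4+\dots+s_{2m-1}+r_{2m}+s_{2m+1}$ with integers $s_{2i+1}\ge 0$ and $r_{2i}\ge 2$, and set $r_0=0$. The order of eigenvalues on $R$ is given by $\overline m=(s_1,r_2,\dots,s_{2m+1})$ if $\mathrm{pr}(\lambda_j)\ge\mathrm{pr}(\lambda_{j+1})$ for all $j$, with equality if and only if, for some $\ell\in\{1,\dots,m\}$, $j\in\sum_{i=1}^{\ell}r_{2(i-1)}+\sum_{i=1}^{\ell}s_{2i-1}+[1,r_{2\ell}-1]$. That is, exactly the eigenvalues within each consecutive block of size $r_{2\ell}$ have equal projections. **Matrices.** $I_\ell$ is the $\ell\times\ell$ identity matrix, $J_\ell$ is the $\ell\times\ell$ matrix with $1$ on the anti-diagonal and $0$ elsewhere, and $P_{\overline m}=\mathrm{diag}(I_{s_1},J_{r_2},I_{s_3},\dots,J_{r_{2m}},I_{s_{2m+1}})$ (block diagonal), so $P_{\overline m}=P_{\overline m}^{-1}$. Blocks of size $0$ are omitted. *)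

theory Defs
  imports
    "HOL-Complex_Analysis.Complex_Analysis"
    "Jordan_Normal_Form.Gauss_Jordan_Elimination"
begin

text \<open>
  Matrices are those of \<open>Jordan_Normal_Form\<close>; their rows and columns, hence also the
  eigenvalues \<open>lam 0, \<dots>, lam (n - 1)\<close>, are numbered from 0. Sectors, Stokes matrices and
  arguments of separating rays are numbered from 1, and indices of sectors are taken
  modulo \<open>2 * k\<close> in \<open>{1..2 * k}\<close>.
\<close>

definition cyc_suc :: "nat \<Rightarrow> nat \<Rightarrow> nat" where
  "cyc_suc k j = (if j = 2 * k then 1 else j + 1)"


section \<open>Formal normal form\<close>

definition nf_mat :: "nat \<Rightarrow> nat \<Rightarrow> (nat \<Rightarrow> complex mat) \<Rightarrow> complex \<Rightarrow> complex mat" where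
  "nf_mat n k D x = Matrix.mat n n (\<lambda>(p, q). \<Sum>i\<le>k. D i $$ (p, q) * x ^ i)"

definition nf_fps :: "nat \<Rightarrow> nat \<Rightarrow> (nat \<Rightarrow> complex mat) \<Rightarrow> complex fps mat" where
  "nf_fps n k D =
     Matrix.mat n n (\<lambda>(p, q). \<Sum>i\<le>k. fps_const (D i $$ (p, q)) * fps_X ^ i)"

definition taylor_mat :: "nat \<Rightarrow> (complex \<Rightarrow> complex mat) \<Rightarrow> complex fps mat" where
  "taylor_mat n A = Matrix.mat n n (\<lambda>(p, q). fps_expansion (\<lambda>x. A x $$ (p, q)) 0)"

text \<open>
  The substitution \<open>Y = H Z\<close> takes \<open>x^(k+1) Y' = A Y\<close> to \<open>x^(k+1) Z' = D Z\<close> if and only if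
  \<open>x^(k+1) H' + H D = A H\<close>.
\<close>

definition formal_normal_form ::
  "nat \<Rightarrow> nat \<Rightarrow> (complex \<Rightarrow> complex mat) \<Rightarrow> (nat \<Rightarrow> complex mat) \<Rightarrow> complex fps mat \<Rightarrow> bool" where
  "formal_normal_form n k A D Hhat \<longleftrightarrow>
     (\<forall>i\<le>k. D i \<in> carrier_mat n n \<and> diagonal_mat (D i)) \<and> D 0 = A 0 \<and>
     Hhat \<in> carrier_mat n n \<and> map_mat (\<lambda>f. fps_nth f 0) Hhat = 1\<^sub>m n \<and>
     fps_X ^ (k + 1) \<cdot>\<^sub>m map_mat fps_deriv Hhat + Hhat * nf_fps n k D = taylor_mat n A * Hhat"

text \<open>
  \<open>L\<close> is a branch of the logarithm on the sector under consideration, so that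
  \<open>x^(D k) = exp (D k * L x)\<close>.
\<close>

definition nf_sol ::
  "nat \<Rightarrow> nat \<Rightarrow> (nat \<Rightarrow> complex mat) \<Rightarrow> (complex \<Rightarrow> complex) \<Rightarrow> complex \<Rightarrow> complex mat" where
  "nf_sol n k D L x = mat_diag n (\<lambda>p.
     exp (- (\<Sum>i<k. D i $$ (p, p) / (of_nat (k - i) * x ^ (k - i)))) * exp (D k $$ (p, p) * L x))"

definition log_branch :: "(complex \<Rightarrow> complex) \<Rightarrow> complex set \<Rightarrow> bool" where
  "log_branch L S \<longleftrightarrow> L holomorphic_on S \<and> (\<forall>x\<in>S. exp (L x) = x)"


section \<open>Separating rays and sectors\<close>

definition ray :: "real \<Rightarrow> complex set" where
  "ray \<phi> = {of_real t * cis \<phi> | t. t > 0}"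

definition separating_rays :: "nat \<Rightarrow> complex \<Rightarrow> complex \<Rightarrow> complex set set" where
  "separating_rays k a b = {ray \<phi> | \<phi>. \<forall>x\<in>ray \<phi>. Re ((a - b) / x ^ k) = 0}"

definition separating_args :: "nat \<Rightarrow> nat \<Rightarrow> (nat \<Rightarrow> complex) \<Rightarrow> real set" where
  "separating_args n k lam =
     {\<phi>\<in>{0..<2 * pi}. \<exists>p<n. \<exists>q<n. p \<noteq> q \<and> ray \<phi> \<in> separating_rays k (lam p) (lam q)}"

text \<open>
  Sectors are subsets of the complex plane, not of the universal cover of the punctured
  plane: \<open>sector r a b\<close> is unchanged if \<open>a\<close> and \<open>b\<close> are both increased by \<open>2 * pi\<close>.
\<close>

definition sector :: "real \<Rightarrow> real \<Rightarrow> real \<Rightarrow> complex set" where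
  "sector r a b = {of_real t * cis \<phi> | t \<phi>. 0 < t \<and> t < r \<and> a < \<phi> \<and> \<phi> < b}"

definition sector_left :: "nat \<Rightarrow> real \<Rightarrow> real \<Rightarrow> nat \<Rightarrow> real" where
  "sector_left k \<eta> \<theta> j = \<theta> + (real j - 1) * pi / real k - \<eta>"

definition sector_right :: "nat \<Rightarrow> real \<Rightarrow> real \<Rightarrow> nat \<Rightarrow> real" where
  "sector_right k \<eta> \<theta> j = \<theta> + real j * pi / real k + \<eta>"

text \<open>The sector with number \<open>j\<close> for the starting ray of argument \<open>\<theta>\<close>.\<close>

definition stokes_sector :: "nat \<Rightarrow> real \<Rightarrow> real \<Rightarrow> real \<Rightarrow> nat \<Rightarrow> complex set" where
  "stokes_sector k r \<eta> \<theta> j = sector r (sector_left k \<eta> \<theta> j) (sector_right k \<eta> \<theta> j)"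

lemma stokes_sector_rotate:
  "stokes_sector k r \<eta> \<theta> j = (\<lambda>x. cis \<theta> * x) ` stokes_sector k r \<eta> 0 j"
proof -
  have *: "sector r (\<theta> + a) (\<theta> + b) = (\<lambda>x. cis \<theta> * x) ` sector r a b" for a b
  proof (intro equalityI subsetI)
    fix x assume "x \<in> sector r (\<theta> + a) (\<theta> + b)"
    then obtain t \<phi> where x: "x = of_real t * cis \<phi>" "0 < t" "t < r" "\<theta> + a < \<phi>" "\<phi> < \<theta> + b"
      by (auto simp: sector_def)
    have "x = cis \<theta> * (of_real t * cis (\<phi> - \<theta>))"
      unfolding x(1) by (simp add: mult.left_commute cis_mult)
    moreover have "of_real t * cis (\<phi> - \<theta>) \<in> sector r a b"
      unfolding sector_def using x by (intro CollectI exI[of _ t] exI[of _ "\<phi> - \<theta>"]) auto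
    ultimately show "x \<in> (\<lambda>x. cis \<theta> * x) ` sector r a b" by blast
  next
    fix x assume "x \<in> (\<lambda>x. cis \<theta> * x) ` sector r a b"
    then obtain t \<phi> where x: "x = cis \<theta> * (of_real t * cis \<phi>)" "0 < t" "t < r" "a < \<phi>" "\<phi> < b"
      by (auto simp: sector_def)
    have "x = of_real t * cis (\<theta> + \<phi>)"
      unfolding x(1) by (simp add: mult.left_commute cis_mult)
    then show "x \<in> sector r (\<theta> + a) (\<theta> + b)"
      unfolding sector_def using x by (intro CollectI exI[of _ t] exI[of _ "\<theta> + \<phi>"]) auto
  qed
  show ?thesis
    using *[of "sector_left k \<eta> 0 j" "sector_right k \<eta> 0 j"]
    by (simp add: stokes_sector_def sector_left_def sector_right_def algebra_simps)
qed

definition good_sectors ::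
  "nat \<Rightarrow> nat \<Rightarrow> (nat \<Rightarrow> complex) \<Rightarrow> real \<Rightarrow> real \<Rightarrow> real \<Rightarrow> bool" where
  "good_sectors n k lam r \<eta> \<theta> \<longleftrightarrow>
     (\<forall>j\<in>{1..2 * k}. \<forall>p<n. \<forall>q<n. p \<noteq> q \<longrightarrow>
        (\<exists>!R. R \<in> separating_rays k (lam p) (lam q) \<and> R \<inter> ball 0 r \<subseteq> stokes_sector k r \<eta> \<theta> j))"


section \<open>Sectorial normalization\<close>

text \<open>Poincare asymptotics, locally uniform in the argument.\<close>

definition asymptotic_on_sector :: "(complex \<Rightarrow> complex) \<Rightarrow> complex fps \<Rightarrow> real \<Rightarrow> real \<Rightarrow> real \<Rightarrow> bool" where
  "asymptotic_on_sector f F r a b \<longleftrightarrow>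
     (\<forall>a' b' N. a < a' \<and> a' < b' \<and> b' < b \<longrightarrow>
        (\<lambda>x. f x - (\<Sum>i<N. fps_nth F i * x ^ i)) \<in> O[at 0 within sector r a' b'](\<lambda>x. x ^ N))"

definition normalizing_on ::
  "nat \<Rightarrow> nat \<Rightarrow> (complex \<Rightarrow> complex mat) \<Rightarrow> (nat \<Rightarrow> complex mat) \<Rightarrow> complex fps mat \<Rightarrow>
   real \<Rightarrow> real \<Rightarrow> real \<Rightarrow> (complex \<Rightarrow> complex mat) \<Rightarrow> bool" where
  "normalizing_on n k A D Hhat r a b H \<longleftrightarrow>
     (\<forall>x\<in>sector r a b. H x \<in> carrier_mat n n \<and> invertible_mat (H x)) \<and>
     (\<forall>p<n. \<forall>q<n. (\<lambda>x. H x $$ (p, q)) holomorphic_on sector r a b) \<and>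
     (\<forall>p<n. \<forall>q<n. asymptotic_on_sector (\<lambda>x. H x $$ (p, q)) (Hhat $$ (p, q)) r a b) \<and>
     (\<forall>x\<in>sector r a b.
        x ^ (k + 1) \<cdot>\<^sub>m Matrix.mat n n (\<lambda>(p, q). deriv (\<lambda>z. H z $$ (p, q)) x) + H x * nf_mat n k D x
          = A x * H x)"

definition sectorial_normalization ::
  "nat \<Rightarrow> nat \<Rightarrow> (complex \<Rightarrow> complex mat) \<Rightarrow> (nat \<Rightarrow> complex mat) \<Rightarrow> complex fps mat \<Rightarrow>
   real \<Rightarrow> real \<Rightarrow> real \<Rightarrow> (nat \<Rightarrow> complex \<Rightarrow> complex mat) \<Rightarrow> bool" where
  "sectorial_normalization n k A D Hhat r \<eta> \<theta> H \<longleftrightarrow>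
     (\<forall>j\<in>{1..2 * k}.
        normalizing_on n k A D Hhat r (sector_left k \<eta> \<theta> j) (sector_right k \<eta> \<theta> j) (H j))"


section \<open>Stokes matrices\<close>

text \<open>
  \<open>W j\<close> is a choice of the fundamental solution on the sector with number \<open>j\<close>; the diagonal
  matrix \<open>K\<close> is its freedom of choice. The permutation \<open>\<sigma>\<close> is the identity for the starting ray
  of argument 0.
\<close>

definition sectorial_solutions ::
  "nat \<Rightarrow> nat \<Rightarrow> (nat \<Rightarrow> complex mat) \<Rightarrow> real \<Rightarrow> real \<Rightarrow> real \<Rightarrow> (nat \<Rightarrow> nat) \<Rightarrow>
   (nat \<Rightarrow> complex \<Rightarrow> complex mat) \<Rightarrow> (nat \<Rightarrow> complex \<Rightarrow> complex mat) \<Rightarrow> bool" where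
  "sectorial_solutions n k D r \<eta> \<theta> \<sigma> H W \<longleftrightarrow>
     (\<forall>j\<in>{1..2 * k}. \<exists>L K.
        log_branch L (stokes_sector k r \<eta> \<theta> j) \<and>
        K \<in> carrier_mat n n \<and> diagonal_mat K \<and> invertible_mat K \<and>
        (\<forall>x\<in>stokes_sector k r \<eta> \<theta> j.
           W j x = Matrix.mat n n (\<lambda>(i, l). (H j x * nf_sol n k D L x) $$ (i, \<sigma> l)) * K))"

text \<open>
  For \<open>k = 1\<close> the two sectors meet in two components. The relation defining \<open>C j\<close> is required
  only on the part of the intersection around the ray of argument \<open>\<theta> + j * pi / k\<close>.
\<close>

definition stokes_matrices ::
  "nat \<Rightarrow> nat \<Rightarrow> real \<Rightarrow> real \<Rightarrow> real \<Rightarrow> (nat \<Rightarrow> complex \<Rightarrow> complex mat) \<Rightarrow> (nat \<Rightarrow> complex mat) \<Rightarrow> bool" where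
  "stokes_matrices n k r \<eta> \<theta> W C \<longleftrightarrow>
     (\<forall>j\<in>{1..2 * k}.
        C j \<in> carrier_mat n n \<and> invertible_mat (C j) \<and>
        (\<forall>x\<in>sector r (\<theta> + real j * pi / real k - \<eta>) (\<theta> + real j * pi / real k + \<eta>).
           W (cyc_suc k j) x = W j x * C j))"


section \<open>Order of eigenvalues and block matrices\<close>

definition ray_pr :: "nat \<Rightarrow> real \<Rightarrow> complex \<Rightarrow> real" where
  "ray_pr k \<phi> z = Re (z * cis (- (real k * \<phi>)))"

text \<open>
  The partition \<open>(s\<^sub>1, r\<^sub>2, \<dots>, r\<^sub>2\<^sub>m, s\<^sub>2\<^sub>m\<^sub>+\<^sub>1)\<close> is a list \<open>ms\<close>. Its positions start at 0, so the
  entries \<open>s\<close> have even positions and \<open>r\<^sub>2\<^sub>l = ms ! (2 * l - 1)\<close>.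
\<close>

definition order_partition :: "nat \<Rightarrow> nat \<Rightarrow> nat list \<Rightarrow> bool" where
  "order_partition n m ms \<longleftrightarrow>
     length ms = 2 * m + 1 \<and> sum_list ms = n \<and> (\<forall>l\<in>{1..m}. ms ! (2 * l - 1) \<ge> 2)"

text \<open>Here \<open>j\<close> is numbered from 1, so that the \<open>j\<close>-th eigenvalue is \<open>lam (j - 1)\<close>.\<close>

definition eigenvalue_order ::
  "nat \<Rightarrow> nat \<Rightarrow> (nat \<Rightarrow> complex) \<Rightarrow> real \<Rightarrow> nat \<Rightarrow> nat list \<Rightarrow> bool" where
  "eigenvalue_order n k lam \<phi> m ms \<longleftrightarrow>
     order_partition n m ms \<and>
     (\<forall>j\<in>{1..<n}.
        ray_pr k \<phi> (lam (j - 1)) \<ge> ray_pr k \<phi> (lam j) \<and>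
        (ray_pr k \<phi> (lam (j - 1)) = ray_pr k \<phi> (lam j) \<longleftrightarrow>
           (\<exists>l\<in>{1..m}. \<exists>t\<in>{1..ms ! (2 * l - 1) - 1}. j = sum_list (take (2 * l - 1) ms) + t)))"

definition block :: "nat list \<Rightarrow> complex mat \<Rightarrow> nat \<Rightarrow> nat \<Rightarrow> complex mat" where
  "block ms M i l = Matrix.mat (ms ! i) (ms ! l)
     (\<lambda>(a, b). M $$ (sum_list (take i ms) + a, sum_list (take l ms) + b))"

text \<open>Identity blocks of the sizes \<open>s\<close>, and the matrices \<open>F i\<close> in the blocks of the sizes \<open>r\<close>.\<close>

definition block_diag :: "nat list \<Rightarrow> (nat \<Rightarrow> complex mat) \<Rightarrow> complex mat" where
  "block_diag ms F =
     diag_block_mat (map (\<lambda>i. if even i then 1\<^sub>m (ms ! i) else F i) [0..<length ms])"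

definition anti_id :: "nat \<Rightarrow> complex mat" where
  "anti_id d = Matrix.mat d d (\<lambda>(a, b). if a + b + 1 = d then 1 else 0)"

definition P_mat :: "nat list \<Rightarrow> complex mat" where
  "P_mat ms = block_diag ms (\<lambda>i. anti_id (ms ! i))"

end

theory Submission
  imports Defs "Jordan_Normal_Form.Determinant" "HOL-Real_Asymp.Real_Asymp"
begin

text \<open>
  If \<open>H\<close> and \<open>H'\<close> normalize the system on a common sector, the entries of \<open>G = H\<inverse> H'\<close> satisfy
  \<open>x^(k+1) G\<^sub>p\<^sub>q' = (d\<^sub>p - d\<^sub>q) G\<^sub>p\<^sub>q\<close>, so that \<open>G\<^sub>p\<^sub>q\<close> is a constant multiple of \<open>\<omega>\<^sub>p / \<omega>\<^sub>q\<close>. Since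
  \<open>G\<close> tends to the identity at 0, the constant vanishes as soon as \<open>\<omega>\<^sub>p / \<omega>\<^sub>q\<close> is unbounded on some
  ray of the sector, and it vanishes for both orders of the pair if the sector contains a
  separating ray of the pair.

  Let \<open>Y\<^sub>j\<close> be the solution on the rotated sector with number \<open>j\<close>, with \<open>Y\<^sub>j = W\<^sub>j T\<^sub>j\<close> and
  \<open>Y\<^sub>j = W\<^sub>j\<^sub>+\<^sub>1 T'\<^sub>j\<close>, so that \<open>T\<^sub>j = C(j) T'\<^sub>j\<close>. The rotated sector and the old sector \<open>j\<close> share the
  separating rays of all pairs in different blocks, hence \<open>T\<^sub>j\<close> is block diagonal; the rotated sector
  and the old sector \<open>j + 1\<close> share those of the pairs within a block, hence the diagonal blocks of
  \<open>T'\<^sub>j\<close> are diagonal. As \<open>C(j)\<close> and \<open>T'\<^sub>j\<close> are triangular in the same sense, \<open>T\<^sub>j\<close> is, up to a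
  diagonal matrix, the block diagonal part of \<open>C(j)\<close>. Crossing the first separating ray reverses
  the order within the blocks, which gives \<open>P\<close>.

  If \<open>\<theta> \<ge> \<pi> / k\<close>, the old and the rotated sectors with number \<open>j\<close> need not meet. Then all eigenvalues
  form a single block and one compares with the old sector \<open>j + 1\<close> instead.
\<close>

section \<open>Matrices\<close>

text \<open>Two transitions per sector are needed because the old solution \<open>j\<close> need not
  be defined where the rotated sectors \<open>j\<close> and \<open>j + 1\<close> meet: near the ray
  of argument \<theta> + j pi / k only the old solution \<open>j + 1\<close> is certain to be
  available. There Y_(j+1) is expressed by T_(j+1) and Y_j by T'_j, so the new multiplier is the
  inverse of T'_j times T_(j+1). Since T_j = C(j) T'_j, it equals the inverse of T_j times C(j)
  T_(j+1). Scaling each Y_j so that T_j is exactly the block diagonal part of C(j) uses the diagonal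
  freedom on each sector separately, hence works for all j at once. If \<theta> \<ge> pi / k, the
  comparison yields P C(j+1) P. This is still the stated formula: with a single block its diagonal
  factors are the inverse of C(j) and C(j+1), and C(j) cancels. Triangularity in the same sense
  matters because an index s with C(j)_ps and T'_sq both nonzero lies between p and q, and blocks
  are intervals.\<close>

lemma mult_mat_index:
  assumes "A \<in> carrier_mat n m" "B \<in> carrier_mat m l" "i < n" "j < l"
  shows "(A * B) $$ (i, j) = (\<Sum>s<m. A $$ (i, s) * B $$ (s, j))"
  using assms by (auto simp: scalar_prod_def atLeast0LessThan intro!: sum.cong)

lemma mat_of_entries: "M \<in> carrier_mat n m \<Longrightarrow> Matrix.mat n m (\<lambda>(i, j). M $$ (i, j)) = M"
  by (intro eq_matI) auto

text \<open>\<open>inverts_mat\<close> leaves the size of the inverse open; both of its dimensions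
  are read off from the two products.\<close>

lemma invertible_matE:
  assumes "invertible_mat A" "A \<in> carrier_mat n n"
  obtains B where "B \<in> carrier_mat n n" "A * B = 1\<^sub>m n" "B * A = 1\<^sub>m n"
proof -
  obtain B where B: "A * B = 1\<^sub>m (dim_row A)" "B * A = 1\<^sub>m (dim_row B)"
    using assms(1) unfolding invertible_mat_def inverts_mat_def by blast
  have dimA: "dim_row A = n" "dim_col A = n" using assms(2) by auto
  have "dim_col B = dim_col (A * B)" by simp
  also have "\<dots> = n" using B(1) dimA by simp
  finally have c: "dim_col B = n" .
  have "dim_row B = dim_col (1\<^sub>m (dim_row B) :: 'a mat)" by simp
  also have "\<dots> = n" unfolding B(2)[symmetric] by (simp add: dimA)
  finally have r: "dim_row B = n" .
  show thesis by (rule that[of B]) (use B c r dimA in auto)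
qed

lemma invertible_matI:
  assumes "A \<in> carrier_mat n n" "B \<in> carrier_mat n n" "A * B = 1\<^sub>m n" "B * A = 1\<^sub>m n"
  shows "invertible_mat A"
  using assms unfolding invertible_mat_def inverts_mat_def by (auto intro!: exI[of _ B])

lemma invertible_mat_mult:
  assumes "A \<in> carrier_mat n n" "B \<in> carrier_mat n n" "invertible_mat A" "invertible_mat B"
  shows "invertible_mat (A * B)"
proof -
  obtain A' where A': "A' \<in> carrier_mat n n" "A * A' = 1\<^sub>m n" "A' * A = 1\<^sub>m n"
    using invertible_matE[OF assms(3,1)] .
  obtain B' where B': "B' \<in> carrier_mat n n" "B * B' = 1\<^sub>m n" "B' * B = 1\<^sub>m n"
    using invertible_matE[OF assms(4,2)] .
  note [simp] = assms(1,2) A'(1) B'(1) mult_carrier_mat[of _ n n _ n]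
  have "A * B * (B' * A') = A * (B * (B' * A'))"
    by (rule assoc_mult_mat[of _ n n _ n _ n]) auto
  also have "B * (B' * A') = B * B' * A'"
    by (rule assoc_mult_mat[of _ n n _ n _ n, symmetric]) auto
  finally have "A * B * (B' * A') = A * (B * B' * A')" .
  moreover have "B' * A' * (A * B) = B' * (A' * (A * B))"
    by (rule assoc_mult_mat[of _ n n _ n _ n]) auto
  moreover have "A' * (A * B) = A' * A * B"
    by (rule assoc_mult_mat[of _ n n _ n _ n, symmetric]) auto
  ultimately show ?thesis
    using assms A' B' by (intro invertible_matI[of _ n "B' * A'"]) auto
qed

lemma mat_diag_eq_diagonal:
  assumes "K \<in> carrier_mat n n" "diagonal_mat K"
  shows "K = mat_diag n (\<lambda>p. K $$ (p, p))"
  using assms unfolding mat_diag_def diagonal_mat_def by (intro eq_matI) auto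

lemma invertible_mat_diag:
  fixes f :: "nat \<Rightarrow> 'a :: field"
  assumes "\<And>p. p < n \<Longrightarrow> f p \<noteq> 0"
  shows "invertible_mat (mat_diag n f)"
proof (rule invertible_matI[of _ n "mat_diag n (\<lambda>p. 1 / f p)"])
  show "mat_diag n f * mat_diag n (\<lambda>p. 1 / f p) = 1\<^sub>m n"
    unfolding mat_diag_mult_right[OF mat_diag_dim] using assms
    by (intro eq_matI) (auto simp: mat_diag_def)
  show "mat_diag n (\<lambda>p. 1 / f p) * mat_diag n f = 1\<^sub>m n"
    unfolding mat_diag_mult_right[OF mat_diag_dim] using assms
    by (intro eq_matI) (auto simp: mat_diag_def)
qed auto

lemma diagonal_mat_diag: "diagonal_mat (mat_diag n f)"
  by (auto simp: diagonal_mat_def mat_diag_def)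

lemma invertible_diagonal_nz:
  fixes K :: "'a :: field mat"
  assumes "K \<in> carrier_mat n n" "diagonal_mat K" "invertible_mat K" "p < n"
  shows "K $$ (p, p) \<noteq> 0"
proof
  assume 0: "K $$ (p, p) = 0"
  obtain B where B: "B \<in> carrier_mat n n" "K * B = 1\<^sub>m n" "B * K = 1\<^sub>m n"
    using invertible_matE[OF assms(3,1)] .
  have "K $$ (p, s) = 0" if "s < n" for s
    using assms that 0 by (cases "s = p") (auto simp: diagonal_mat_def)
  then have "(K * B) $$ (p, p) = 0"
    using assms(4) by (subst mult_mat_index[OF assms(1) B(1)]) (auto intro!: sum.neutral)
  then show False using B(2) assms(4) by simp
qed

section \<open>Holomorphic matrix functions\<close>

text \<open>By the Leibniz formula the determinant is a polynomial in the entries.\<close>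

lemma det_holomorphic:
  assumes "\<And>x. x \<in> S \<Longrightarrow> M x \<in> carrier_mat n n"
    and "\<And>p q. p < n \<Longrightarrow> q < n \<Longrightarrow> (\<lambda>x. M x $$ (p, q)) holomorphic_on S"
  shows "(\<lambda>x. Determinant.det (M x) :: complex) holomorphic_on S"
proof -
  have "(\<lambda>x. \<Sum>p\<in>{p. p permutes {0..<n}}. signof p * (\<Prod>i = 0..<n. M x $$ (i, p i))) holomorphic_on S"
  proof (intro holomorphic_intros assms(2))
    fix p i assume "p \<in> {p. p permutes {0..<n}}" "i \<in> {0..<n}"
    then show "i < n" "p i < n" using permutes_in_image[of p "{0..<n}" i] by auto
  qed
  then show ?thesis
    using holomorphic_transform[OF _ det_def'[OF assms(1), symmetric]] by simp
qed

lemma det_tendsto: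
  assumes "eventually (\<lambda>x. M x \<in> carrier_mat n n) F" "M0 \<in> carrier_mat n n"
    and "\<And>p q. p < n \<Longrightarrow> q < n \<Longrightarrow> ((\<lambda>x. M x $$ (p, q) :: complex) \<longlongrightarrow> M0 $$ (p, q)) F"
  shows "((\<lambda>x. Determinant.det (M x)) \<longlongrightarrow> Determinant.det M0) F"
proof -
  have "((\<lambda>x. \<Sum>p\<in>{p. p permutes {0..<n}}. signof p * (\<Prod>i = 0..<n. M x $$ (i, p i))) \<longlongrightarrow>
      (\<Sum>p\<in>{p. p permutes {0..<n}}. signof p * (\<Prod>i = 0..<n. M0 $$ (i, p i)))) F"
  proof (intro tendsto_intros assms(3))
    fix p i assume "p \<in> {p. p permutes {0..<n}}" "i \<in> {0..<n}"
    then show "i < n" "p i < n" using permutes_in_image[of p "{0..<n}" i] by auto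
  qed
  moreover have "\<forall>\<^sub>F x in F. Determinant.det (M x) =
      (\<Sum>p\<in>{p. p permutes {0..<n}}. signof p * (\<Prod>i = 0..<n. M x $$ (i, p i)))"
    using assms(1) by eventually_elim (rule det_def')
  ultimately show ?thesis
    unfolding det_def'[OF assms(2)] by (subst tendsto_cong)
qed

text \<open>Cramer's formula instead of a chosen inverse: its entries are quotients of determinants,
  so holomorphy and limits pass from a matrix function to its inverse.\<close>

definition inv_mat :: "complex mat \<Rightarrow> complex mat" where
  "inv_mat M = (1 / Determinant.det M) \<cdot>\<^sub>m adj_mat M"

lemma inv_mat:
  assumes "M \<in> carrier_mat n n" "Determinant.det M \<noteq> 0"
  shows "inv_mat M \<in> carrier_mat n n" "M * inv_mat M = 1\<^sub>m n" "inv_mat M * M = 1\<^sub>m n"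
  using adj_mat[OF assms(1)] assms
  by (auto simp: inv_mat_def mult_smult_distrib[of _ n n _ n] mult_smult_assoc_mat[of _ n n _ n])

lemma invertible_mat_det_nz:
  fixes M :: "complex mat"
  assumes "M \<in> carrier_mat n n" "invertible_mat M"
  shows "Determinant.det M \<noteq> 0"
proof -
  obtain B where B: "B \<in> carrier_mat n n" "M * B = 1\<^sub>m n" using invertible_matE[OF assms(2,1)] .
  have "Determinant.det M * Determinant.det B = 1"
    using det_mult[OF assms(1) B(1)] B(2) by simp
  then show ?thesis by auto
qed

lemma inv_mat_index:
  assumes "M \<in> carrier_mat n n" "p < n" "q < n"
  shows "inv_mat M $$ (p, q) = 1 / Determinant.det M * ((- 1) ^ (q + p) * Determinant.det (mat_delete M q p))"
  using assms by (auto simp: inv_mat_def adj_mat_def cofactor_def)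

lemma mat_delete_index':
  assumes "M \<in> carrier_mat n n" "i < n - 1" "j < n - 1"
  shows "mat_delete M p q $$ (i, j) = M $$ (insert_index p i, insert_index q j)"
  using assms by (auto simp: mat_delete_def insert_index_def)

lemma inv_mat_holomorphic:
  assumes "\<And>x. x \<in> S \<Longrightarrow> M x \<in> carrier_mat n n"
    and "\<And>p q. p < n \<Longrightarrow> q < n \<Longrightarrow> (\<lambda>x. M x $$ (p, q)) holomorphic_on S"
    and "\<And>x. x \<in> S \<Longrightarrow> Determinant.det (M x) \<noteq> 0" and "p < n" "q < n"
  shows "(\<lambda>x. inv_mat (M x) $$ (p, q)) holomorphic_on S"
proof -
  have del: "(\<lambda>x. Determinant.det (mat_delete (M x) q p)) holomorphic_on S"
  proof (rule det_holomorphic)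
    show "mat_delete (M x) q p \<in> carrier_mat (n - 1) (n - 1)" if "x \<in> S" for x
      using mat_delete_carrier[of "M x" n n] assms(1) that by auto
    fix i j assume ij: "i < n - 1" "j < n - 1"
    have "(\<lambda>x. M x $$ (insert_index q i, insert_index p j)) holomorphic_on S"
      using ij by (intro assms(2)) (auto simp: insert_index_def)
    then show "(\<lambda>x. mat_delete (M x) q p $$ (i, j)) holomorphic_on S"
      by (rule holomorphic_transform) (use mat_delete_index'[OF assms(1) ij] in auto)
  qed
  have "(\<lambda>x. 1 / Determinant.det (M x) *
      ((- 1) ^ (q + p) * Determinant.det (mat_delete (M x) q p))) holomorphic_on S"
    by (intro holomorphic_intros del det_holomorphic[of _ _ n] assms(1-3))
  then show ?thesis
    by (rule holomorphic_transform) (simp add: inv_mat_index[OF assms(1,4,5)])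
qed

lemma inv_mat_tendsto:
  assumes ev: "eventually (\<lambda>x. M x \<in> carrier_mat n n) F"
    and lim: "\<And>p q. p < n \<Longrightarrow> q < n \<Longrightarrow> ((\<lambda>x. M x $$ (p, q)) \<longlongrightarrow> M0 $$ (p, q)) F"
    and M0: "M0 \<in> carrier_mat n n" "Determinant.det M0 \<noteq> 0" and pq: "p < n" "q < n"
  shows "((\<lambda>x. inv_mat (M x) $$ (p, q)) \<longlongrightarrow> inv_mat M0 $$ (p, q)) F"
proof -
  have del: "((\<lambda>x. Determinant.det (mat_delete (M x) q p)) \<longlongrightarrow> Determinant.det (mat_delete M0 q p)) F"
  proof (rule det_tendsto)
    show "\<forall>\<^sub>F x in F. mat_delete (M x) q p \<in> carrier_mat (n - 1) (n - 1)"
      using ev by eventually_elim (auto intro: mat_delete_carrier)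
    show "mat_delete M0 q p \<in> carrier_mat (n - 1) (n - 1)"
      using M0 by (auto intro: mat_delete_carrier)
    fix i j assume ij: "i < n - 1" "j < n - 1"
    have "((\<lambda>x. M x $$ (insert_index q i, insert_index p j)) \<longlongrightarrow>
        M0 $$ (insert_index q i, insert_index p j)) F"
      using ij by (intro lim) (auto simp: insert_index_def)
    moreover have "\<forall>\<^sub>F x in F. mat_delete (M x) q p $$ (i, j) = M x $$ (insert_index q i, insert_index p j)"
      using ev by eventually_elim (use mat_delete_index'[OF _ ij] in auto)
    ultimately show "((\<lambda>x. mat_delete (M x) q p $$ (i, j)) \<longlongrightarrow> mat_delete M0 q p $$ (i, j)) F"
      using mat_delete_index'[OF M0(1) ij] by (subst tendsto_cong) auto
  qed
  have "((\<lambda>x. 1 / Determinant.det (M x) *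
      ((- 1) ^ (q + p) * Determinant.det (mat_delete (M x) q p))) \<longlongrightarrow>
      1 / Determinant.det M0 * ((- 1) ^ (q + p) * Determinant.det (mat_delete M0 q p))) F"
    by (intro tendsto_intros del det_tendsto[of _ n] ev lim M0)
  moreover have "\<forall>\<^sub>F x in F. inv_mat (M x) $$ (p, q) = 1 / Determinant.det (M x) *
      ((- 1) ^ (q + p) * Determinant.det (mat_delete (M x) q p))"
    using ev by eventually_elim (use inv_mat_index pq in blast)
  ultimately show ?thesis
    using inv_mat_index[OF M0(1) pq] by (subst tendsto_cong) auto
qed

section \<open>Sectors\<close>

text \<open>The half-strip is convex and \<open>exp\<close> is an open map, so connectedness and
  openness of sectors follow without any restriction on the opening angle.\<close>

lemma sector_exp_image:
  assumes "r > 0"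
  shows "sector r a b = exp ` {z. Re z < ln r \<and> a < Im z \<and> Im z < b}"
proof (intro equalityI subsetI)
  fix x assume "x \<in> sector r a b"
  then obtain t \<phi> where x: "x = of_real t * cis \<phi>" "0 < t" "t < r" "a < \<phi>" "\<phi> < b"
    by (auto simp: sector_def)
  have "x = exp (Complex (ln t) \<phi>)"
    using x by (simp add: exp_eq_polar)
  then show "x \<in> exp ` {z. Re z < ln r \<and> a < Im z \<and> Im z < b}"
    using x assms by (intro image_eqI) auto
next
  fix x assume "x \<in> exp ` {z. Re z < ln r \<and> a < Im z \<and> Im z < b}"
  then obtain z where z: "x = exp z" "Re z < ln r" "a < Im z" "Im z < b" by auto
  have "exp (Re z) < r" using z(2) assms by (metis exp_less_cancel_iff exp_ln)
  then show "x \<in> sector r a b"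
    unfolding sector_def using z
    by (intro CollectI exI[of _ "exp (Re z)"] exI[of _ "Im z"]) (auto simp: exp_eq_polar exp_of_real)
qed

lemma convex_strip: "convex {z. Re z < c \<and> a < Im z \<and> Im z < b}"
proof -
  have "{z. Re z < c \<and> a < Im z \<and> Im z < b} = {z. Re z < c} \<inter> ({z. Im z > a} \<inter> {z. Im z < b})"
    by auto
  then show ?thesis
    by (simp add: convex_Int convex_halfspace_Re_lt convex_halfspace_Im_gt convex_halfspace_Im_lt)
qed

lemma connected_sector: "r > 0 \<Longrightarrow> connected (sector r a b)"
  unfolding sector_exp_image
  by (intro connected_continuous_image continuous_intros convex_connected convex_strip)

lemma open_sector:
  assumes "r > 0" shows "open (sector r a b)"
  unfolding sector_exp_image[OF assms]
proof (rule open_mapping_thm[of exp UNIV])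
  show "open {z. Re z < ln r \<and> a < Im z \<and> Im z < b}"
    by (intro open_Collect_conj open_Collect_less continuous_intros)
  show "\<not> (exp :: complex \<Rightarrow> complex) constant_on UNIV"
  proof
    assume "(exp :: complex \<Rightarrow> complex) constant_on UNIV"
    then have "exp (0 :: complex) = exp (Complex 0 pi)" unfolding constant_on_def by (metis UNIV_I)
    then show False by (simp add: exp_eq_polar)
  qed
qed (auto intro: holomorphic_intros)

lemma sector_nz: "x \<in> sector r a b \<Longrightarrow> x \<noteq> 0"
  by (auto simp: sector_def)

lemma sector_mono: "a' \<le> a \<Longrightarrow> b \<le> b' \<Longrightarrow> sector r a b \<subseteq> sector r a' b'"
  unfolding sector_def by fastforce

lemma ray_in_sector: "0 < t \<Longrightarrow> t < r \<Longrightarrow> a < \<psi> \<Longrightarrow> \<psi> < b \<Longrightarrow> of_real t * cis \<psi> \<in> sector r a b"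
  unfolding sector_def by blast

lemma sector_nonempty: "0 < r \<Longrightarrow> a < b \<Longrightarrow> sector r a b \<noteq> {}"
  using ray_in_sector[of "r / 2" r a "(a + b) / 2" b] by auto

lemma cis_add_2pi: "cis (\<phi> + 2 * pi) = cis \<phi>"
  by (simp add: cis_mult[symmetric])

lemma sector_periodic: "sector r (a + 2 * pi) (b + 2 * pi) = sector r a b"
proof (intro equalityI subsetI)
  fix x assume "x \<in> sector r (a + 2 * pi) (b + 2 * pi)"
  then obtain t \<phi> where x: "x = of_real t * cis \<phi>" "0 < t" "t < r" "a + 2 * pi < \<phi>" "\<phi> < b + 2 * pi"
    by (auto simp: sector_def)
  then show "x \<in> sector r a b"
    using cis_add_2pi[of "\<phi> - 2 * pi"] ray_in_sector[of t r a "\<phi> - 2 * pi" b] by simp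
next
  fix x assume "x \<in> sector r a b"
  then obtain t \<phi> where x: "x = of_real t * cis \<phi>" "0 < t" "t < r" "a < \<phi>" "\<phi> < b"
    by (auto simp: sector_def)
  then show "x \<in> sector r (a + 2 * pi) (b + 2 * pi)"
    using cis_add_2pi[of \<phi>] ray_in_sector[of t r "a + 2 * pi" "\<phi> + 2 * pi" "b + 2 * pi"] by simp
qed

section \<open>The normal form\<close>

lemma log_branch_mono: "log_branch L S \<Longrightarrow> T \<subseteq> S \<Longrightarrow> log_branch L T"
  unfolding log_branch_def using holomorphic_on_subset by blast

lemma log_branch_deriv:
  assumes "log_branch L S" "open S" "x \<in> S"
  shows "(L has_field_derivative 1 / x) (at x)"
proof -
  have hol: "L holomorphic_on S" and ex: "\<And>x. x \<in> S \<Longrightarrow> exp (L x) = x"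
    using assms(1) by (auto simp: log_branch_def)
  have L: "(L has_field_derivative deriv L x) (at x)"
    using holomorphic_derivI[OF hol assms(2,3)] .
  then have "((\<lambda>x. exp (L x)) has_field_derivative exp (L x) * deriv L x) (at x)"
    by (auto intro!: derivative_eq_intros)
  moreover have "((\<lambda>x. exp (L x)) has_field_derivative 1) (at x)"
    by (rule has_field_derivative_transform_within_open[OF DERIV_ident assms(2,3)]) (simp add: ex)
  ultimately have "exp (L x) * deriv L x = 1" using DERIV_unique by blast
  then have "x * deriv L x = 1" using ex[OF assms(3)] by simp
  then have "deriv L x = 1 / x" by (metis mult_eq_0_iff nonzero_eq_divide_eq mult.commute zero_neq_one)
  then show ?thesis using L by simp
qed

lemma log_branch_nz: "log_branch L S \<Longrightarrow> x \<in> S \<Longrightarrow> x \<noteq> 0"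
  by (metis log_branch_def exp_not_eq_zero)

text \<open>The difference of the branch and the real logarithm has derivative 0 along the ray. Thus
  the choice of the branch affects \<open>x^(D k)\<close> on a ray only by constant factors.\<close>

lemma log_branch_ray:
  assumes "log_branch L (sector r a b)" "a < \<psi>" "\<psi> < b" "0 < r"
  obtains l where "\<And>t. 0 < t \<Longrightarrow> t < r \<Longrightarrow> L (of_real t * cis \<psi>) = of_real (ln t) + l"
proof -
  have "((\<lambda>t. L (of_real t * cis \<psi>) - of_real (ln t)) has_vector_derivative 0) (at t within {0<..<r})"
    if "t \<in> {0<..<r}" for t
  proof -
    have mem: "of_real t * cis \<psi> \<in> sector r a b" using that assms by (intro ray_in_sector) auto
    have "((\<lambda>t. of_real t * cis \<psi>) has_vector_derivative cis \<psi>) (at t)"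
      by (auto intro!: derivative_eq_intros simp: has_vector_derivative_mult_left)
    from field_vector_diff_chain_at[OF this log_branch_deriv[OF assms(1) open_sector[OF assms(4)] mem]]
    have "((\<lambda>t. L (of_real t * cis \<psi>)) has_vector_derivative (1 / of_real t)) (at t)"
      by (simp add: o_def)
    moreover have "((\<lambda>t. of_real (ln t) :: complex) has_vector_derivative of_real (1 / t)) (at t)"
      using that by (intro has_vector_derivative_of_real) (auto intro!: derivative_eq_intros)
    ultimately have "((\<lambda>t. L (of_real t * cis \<psi>) - of_real (ln t)) has_vector_derivative
        (1 / of_real t - of_real (1 / t))) (at t)"
      by (rule has_vector_derivative_diff)
    then show ?thesis by (simp add: has_vector_derivative_at_within)
  qed
  from has_vector_derivative_zero_constant[OF _ this] obtain l where
    "\<And>t. t \<in> {0<..<r} \<Longrightarrow> L (of_real t * cis \<psi>) - of_real (ln t) = l" by auto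
  then show thesis by (intro that[of l]) (auto simp: algebra_simps)
qed

text \<open>A logarithm of the diagonal entry with index \<open>p\<close> of the normal form
  solution. Growth is decided by its real part, and its derivative is the coefficient of the normal
  form divided by \<open>x^(k+1)\<close>.\<close>

definition nf_exp :: "nat \<Rightarrow> (nat \<Rightarrow> complex mat) \<Rightarrow> (complex \<Rightarrow> complex) \<Rightarrow> nat \<Rightarrow> complex \<Rightarrow> complex" where
  "nf_exp k D L p x =
     - (\<Sum>i<k. D i $$ (p, p) / (of_nat (k - i) * x ^ (k - i))) + D k $$ (p, p) * L x"

lemma nf_sol_eq: "nf_sol n k D L x = mat_diag n (\<lambda>p. exp (nf_exp k D L p x))"
  unfolding nf_sol_def nf_exp_def exp_add ..

lemma nf_exp_deriv:
  assumes "log_branch L S" "open S" "x \<in> S"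
  shows "(nf_exp k D L p has_field_derivative (\<Sum>i\<le>k. D i $$ (p, p) * x ^ i) / x ^ (k + 1)) (at x)"
proof -
  have nz: "x \<noteq> 0" using log_branch_nz assms by blast
  have term_deriv: "((\<lambda>x. D i $$ (p, p) / (of_nat (k - i) * x ^ (k - i))) has_field_derivative
      - (D i $$ (p, p) * x ^ i / x ^ (k + 1))) (at x)" if ik: "i < k" for i
  proof -
    \<comment> \<open>The exponent \<open>k - i\<close> is positive; writing it as a successor makes
      the power rule applicable without truncated subtraction.\<close>
    obtain m where m: "k - i = Suc m" using ik by (cases "k - i") auto
    have k: "k = i + Suc m" using m ik by simp
    define e where "e = (1 + of_nat m :: complex)"
    have e: "e \<noteq> 0" "of_nat (Suc m) = e"
      using of_nat_neq_0[of m, where ?'a = complex] by (auto simp: e_def)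
    have "((\<lambda>x. inverse (x ^ Suc m)) has_field_derivative
        - (inverse (x ^ Suc m) * (e * (1 * x ^ m)) * inverse (x ^ Suc m))) (at x)"
      unfolding e_def using nz by (intro DERIV_inverse' DERIV_power_Suc DERIV_ident) auto
    from DERIV_cmult[OF this, of "D i $$ (p, p) / e"]
    have "((\<lambda>x. D i $$ (p, p) / e * inverse (x ^ Suc m)) has_field_derivative
        D i $$ (p, p) / e * - (inverse (x ^ Suc m) * (e * (1 * x ^ m)) * inverse (x ^ Suc m))) (at x)" .
    also have "(\<lambda>x. D i $$ (p, p) / e * inverse (x ^ Suc m)) =
        (\<lambda>x. D i $$ (p, p) / (of_nat (Suc m) * x ^ Suc m))"
      unfolding e(2) by (simp add: field_simps)
    also have "D i $$ (p, p) / e * - (inverse (x ^ Suc m) * (e * (1 * x ^ m)) * inverse (x ^ Suc m))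
        = - (D i $$ (p, p) * x ^ i / x ^ (k + 1))"
    proof -
      have "x ^ (k + 1) = x ^ i * (x ^ m * x * x)" unfolding k by (simp add: power_add mult_ac)
      moreover have "x ^ i \<noteq> 0" "x ^ m \<noteq> 0" using nz by auto
      ultimately show ?thesis using nz e(1) by (simp add: field_simps)
    qed
    finally show ?thesis unfolding m .
  qed
  have "(nf_exp k D L p has_field_derivative
      - (\<Sum>i<k. - (D i $$ (p, p) * x ^ i / x ^ (k + 1))) + D k $$ (p, p) * (1 / x)) (at x)"
    unfolding nf_exp_def
    by (intro DERIV_add DERIV_minus DERIV_sum term_deriv DERIV_cmult log_branch_deriv[OF assms]) auto
  also have "- (\<Sum>i<k. - (D i $$ (p, p) * x ^ i / x ^ (k + 1))) + D k $$ (p, p) * (1 / x)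
      = (\<Sum>i\<le>k. D i $$ (p, p) * x ^ i) / x ^ (k + 1)"
    using nz by (simp add: sum_negf sum_divide_distrib[symmetric] lessThan_Suc_atMost[symmetric]
        add_divide_distrib del: power_Suc) (simp add: field_simps)
  finally show ?thesis .
qed

text \<open>After multiplication by \<open>t^k\<close> the difference of the real parts is
  \<open>B t\<close>: a polynomial in \<open>t\<close> plus a multiple of \<open>t^k * ln t\<close>.
  Its limit at 0 comes from \<open>D 0\<close> alone and is the negative of the difference of
  projections divided by \<open>k\<close>. So the leading pole beats the lower poles and the
  logarithm, and the solution of larger projection is the recessive one.\<close>

lemma nf_exp_ray_at_bot:
  assumes "k \<ge> 1" "0 < r" "a < \<psi>" "\<psi> < b"
    and L: "log_branch L (sector r a b)" "log_branch L' (sector r a b)"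
    and lt: "ray_pr k \<psi> (D 0 $$ (p, p)) < ray_pr k \<psi> (D 0 $$ (q, q))"
  shows "filterlim (\<lambda>t. Re (nf_exp k D L' q (of_real t * cis \<psi>) - nf_exp k D L p (of_real t * cis \<psi>)))
           at_bot (at_right 0)"
proof -
  obtain l where l: "\<And>t. 0 < t \<Longrightarrow> t < r \<Longrightarrow> L (of_real t * cis \<psi>) = of_real (ln t) + l"
    using log_branch_ray[OF L(1) assms(3,4,2)] by blast
  obtain l' where l': "\<And>t. 0 < t \<Longrightarrow> t < r \<Longrightarrow> L' (of_real t * cis \<psi>) = of_real (ln t) + l'"
    using log_branch_ray[OF L(2) assms(3,4,2)] by blast
  define c where "c i = Re ((D i $$ (q, q) - D i $$ (p, p)) / cis (real (k - i) * \<psi>)) / real (k - i)" for i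
  define e where "e = Re (D k $$ (q, q) - D k $$ (p, p))"
  define f where "f = Re (D k $$ (q, q) * l' - D k $$ (p, p) * l)"
  define B where "B t = - (\<Sum>i<k. c i * t ^ i) + e * (t ^ (k - 1) * (t * ln t)) + f * t ^ k" for t :: real
  have eq: "Re (nf_exp k D L' q (of_real t * cis \<psi>) - nf_exp k D L p (of_real t * cis \<psi>)) = B t * (1 / t) ^ k"
    if t: "0 < t" "t < r" for t
  proof -
    define R where "R i = Re (D i $$ (q, q) / (of_nat (k - i) * (of_real t * cis \<psi>) ^ (k - i))
        - D i $$ (p, p) / (of_nat (k - i) * (of_real t * cis \<psi>) ^ (k - i)))" for i
    have s: "R i = c i * t ^ i * (1 / t) ^ k"
      if "i < k" for i
    proof -
      have "D i $$ (q, q) / (of_nat (k - i) * (of_real t * cis \<psi>) ^ (k - i))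
        - D i $$ (p, p) / (of_nat (k - i) * (of_real t * cis \<psi>) ^ (k - i))
        = of_real (1 / (real (k - i) * t ^ (k - i))) * ((D i $$ (q, q) - D i $$ (p, p)) / cis (real (k - i) * \<psi>))"
        by (simp add: power_mult_distrib Complex.DeMoivre diff_divide_distrib[symmetric])
      then have "Re (D i $$ (q, q) / (of_nat (k - i) * (of_real t * cis \<psi>) ^ (k - i))
        - D i $$ (p, p) / (of_nat (k - i) * (of_real t * cis \<psi>) ^ (k - i)))
        = 1 / (real (k - i) * t ^ (k - i)) * Re ((D i $$ (q, q) - D i $$ (p, p)) / cis (real (k - i) * \<psi>))"
        by (simp only: Re_complex_of_real Im_complex_of_real times_complex.sel) simp
      also have "\<dots> = c i * (1 / t ^ (k - i))" by (simp add: c_def)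
      also have "1 / t ^ (k - i) = t ^ i * (1 / t) ^ k"
        using t that by (simp add: power_diff power_one_over field_simps)
      finally show ?thesis by (simp add: R_def)
    qed
    have "Re (nf_exp k D L' q (of_real t * cis \<psi>) - nf_exp k D L p (of_real t * cis \<psi>)) =
        - (\<Sum>i<k. R i) + (e * ln t + f)"
      unfolding nf_exp_def l[OF t] l'[OF t] e_def f_def R_def
      by (simp add: sum_subtractf algebra_simps)
    also have "\<dots> = - (\<Sum>i<k. c i * t ^ i * (1 / t) ^ k) + (e * ln t + f)"
      by (simp add: s)
    also have "\<dots> = - (\<Sum>i<k. c i * t ^ i) * (1 / t) ^ k + (e * ln t + f)"
      by (simp add: sum_distrib_right)
    also have "e * ln t + f = (e * (t ^ (k - 1) * (t * ln t)) + f * t ^ k) * (1 / t) ^ k"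
      using t assms(1) by (cases k) (auto simp: power_one_over field_simps)
    finally show ?thesis by (simp add: B_def algebra_simps)
  qed
  have tln: "((\<lambda>t::real. t * ln t) \<longlongrightarrow> 0) (at_right 0)" by real_asymp
  have pw: "((\<lambda>t::real. t ^ i) \<longlongrightarrow> 0 ^ i) (at_right 0)" for i
    by (intro tendsto_intros)
  have "(B \<longlongrightarrow> - (\<Sum>i<k. c i * 0 ^ i) + e * (0 ^ (k - 1) * 0) + f * 0 ^ k) (at_right 0)"
    unfolding B_def by (intro tendsto_intros pw tln)
  \<comment> \<open>Here \<open>0 ^ 0 = 1\<close> keeps the term with \<open>D 0\<close>, the only
    one that remains in the limit.\<close>
  moreover have "(\<Sum>i<k. c i * 0 ^ i) = c 0"
    using assms(1) by (simp add: sum.remove[of _ 0] power_0_left if_distrib cong: if_cong)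
  ultimately have "(B \<longlongrightarrow> - c 0) (at_right 0)" using assms(1) by (simp add: power_0_left)
  moreover have "- c 0 < 0"
    using lt assms(1) by (simp add: c_def ray_pr_def divide_inverse cis_inverse left_diff_distrib
        zero_less_mult_iff)
  moreover have "filterlim (\<lambda>t::real. (1 / t) ^ k) at_top (at_right 0)"
    using assms(1) by (intro filterlim_pow_at_top) (auto, real_asymp)
  ultimately have "filterlim (\<lambda>t. B t * (1 / t) ^ k) at_bot (at_right 0)"
    by (rule filterlim_tendsto_neg_mult_at_bot)
  moreover have "\<forall>\<^sub>F t in at_right 0. Re (nf_exp k D L' q (of_real t * cis \<psi>)
      - nf_exp k D L p (of_real t * cis \<psi>)) = B t * (1 / t) ^ k"
    using eventually_at_right_real[OF assms(2)] by eventually_elim (use eq in \<open>simp only: greaterThanLessThan_iff\<close>)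
  ultimately show ?thesis by (subst filterlim_cong[OF refl refl]) auto
qed

section \<open>Comparison of normalizations on a common sector\<close>

lemma normalizing_on_mono:
  assumes "normalizing_on n k A D Hhat r a b H" "a \<le> c" "d \<le> b"
  shows "normalizing_on n k A D Hhat r c d H"
proof -
  have sub: "sector r c d \<subseteq> sector r a b" using assms by (intro sector_mono)
  have "asymptotic_on_sector f F r c d" if "asymptotic_on_sector f F r a b" for f F
    using that assms(2,3) unfolding asymptotic_on_sector_def
    by (meson le_less_trans less_le_trans)
  then show ?thesis
    using assms(1) sub unfolding normalizing_on_def
    by (meson holomorphic_on_subset subsetD)
qed

lemma normalizing_on_periodic:
  assumes "normalizing_on n k A D Hhat r a b H"
  shows "normalizing_on n k A D Hhat r (a + 2 * pi) (b + 2 * pi) H"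
proof -
  have "asymptotic_on_sector f F r (a + 2 * pi) (b + 2 * pi)" if "asymptotic_on_sector f F r a b" for f F
    unfolding asymptotic_on_sector_def
  proof (intro allI impI)
    fix a' b' N assume "a + 2 * pi < a' \<and> a' < b' \<and> b' < b + 2 * pi"
    then have "a < a' - 2 * pi \<and> a' - 2 * pi < b' - 2 * pi \<and> b' - 2 * pi < b" by auto
    with that have "(\<lambda>x. f x - (\<Sum>i<N. fps_nth F i * x ^ i))
        \<in> O[at 0 within sector r (a' - 2 * pi) (b' - 2 * pi)](\<lambda>x. x ^ N)"
      unfolding asymptotic_on_sector_def by blast
    then show "(\<lambda>x. f x - (\<Sum>i<N. fps_nth F i * x ^ i)) \<in> O[at 0 within sector r a' b'](\<lambda>x. x ^ N)"
      using sector_periodic[of r "a' - 2 * pi" "b' - 2 * pi"] by simp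
  qed
  then show ?thesis
    using assms unfolding normalizing_on_def sector_periodic by blast
qed

lemma asymptotic_ray_limit:
  assumes "asymptotic_on_sector f F r c d" "c < \<psi>" "\<psi> < d" "0 < r"
  shows "((\<lambda>t. f (of_real t * cis \<psi>)) \<longlongrightarrow> fps_nth F 0) (at_right 0)"
proof -
  \<comment> \<open>The expansion is only locally uniform in the argument, so it is used on a
    strictly smaller sector around the ray; the order \<open>N = 1\<close> suffices for the
    limit.\<close>
  define a where "a = (c + \<psi>) / 2"
  define b where "b = (\<psi> + d) / 2"
  have ab: "c < a" "a < \<psi>" "\<psi> < b" "b < d" using assms by (auto simp: a_def b_def)
  have "(\<lambda>x. f x - (\<Sum>i<1. fps_nth F i * x ^ i)) \<in> O[at 0 within sector r a b](\<lambda>x. x ^ 1)"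
    using assms(1) ab unfolding asymptotic_on_sector_def by (meson less_trans)
  then obtain C where C: "C > 0" "\<forall>\<^sub>F x in at 0 within sector r a b. norm (f x - fps_nth F 0) \<le> C * norm x"
    by (auto elim!: landau_o.bigE)
  have fl: "filterlim (\<lambda>t. of_real t * cis \<psi>) (at 0 within sector r a b) (at_right (0 :: real))"
    unfolding filterlim_at
  proof
    show "\<forall>\<^sub>F t in at_right (0 :: real). of_real t * cis \<psi> \<in> sector r a b \<and> of_real t * cis \<psi> \<noteq> 0"
      using eventually_at_right_real[OF assms(4)] by eventually_elim (use ab in \<open>auto intro: ray_in_sector\<close>)
    have "((\<lambda>t. of_real t * cis \<psi>) \<longlongrightarrow> of_real 0 * cis \<psi>) (at_right (0 :: real))"
      by (intro tendsto_intros)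
    then show "((\<lambda>t. of_real t * cis \<psi>) \<longlongrightarrow> 0) (at_right (0 :: real))" by simp
  qed
  have "\<forall>\<^sub>F t in at_right 0. norm (f (of_real t * cis \<psi>) - fps_nth F 0) \<le> C * norm t"
    using filterlim_cong[THEN iffD1, OF refl refl _ fl] C(2) fl
    unfolding filterlim_iff by (fastforce simp: norm_mult)
  moreover have "((\<lambda>t::real. C * norm t) \<longlongrightarrow> 0) (at_right 0)"
    by (auto intro!: tendsto_eq_intros)
  ultimately have "((\<lambda>t. f (of_real t * cis \<psi>) - fps_nth F 0) \<longlongrightarrow> 0) (at_right 0)"
    by (rule Lim_null_comparison)
  then show ?thesis using Lim_null by blast
qed

lemma normalizing_ray_limit:
  assumes "formal_normal_form n k A D Hhat" "normalizing_on n k A D Hhat r c d H"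
    "c < \<psi>" "\<psi> < d" "0 < r" "p < n" "q < n"
  shows "((\<lambda>t. H (of_real t * cis \<psi>) $$ (p, q)) \<longlongrightarrow> 1\<^sub>m n $$ (p, q)) (at_right 0)"
proof -
  have 1: "((\<lambda>t. H (of_real t * cis \<psi>) $$ (p, q)) \<longlongrightarrow> fps_nth (Hhat $$ (p, q)) 0) (at_right 0)"
    using assms unfolding normalizing_on_def by (intro asymptotic_ray_limit) auto
  have Hhat: "Hhat \<in> carrier_mat n n" "map_mat (\<lambda>f. fps_nth f 0) Hhat = 1\<^sub>m n"
    using assms(1) unfolding formal_normal_form_def by blast+
  have "fps_nth (Hhat $$ (p, q)) 0 = map_mat (\<lambda>f. fps_nth f 0) Hhat $$ (p, q)"
    using assms(6,7) Hhat(1) by auto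
  then show ?thesis using 1 unfolding Hhat(2) by (simp only:)
qed

text \<open>Pure algebra, with \<open>Hd\<close>, \<open>Gd\<close>, \<open>Hd'\<close> in the role
  of the derivatives multiplied by \<open>x^(k+1)\<close>. The product rule
  \<open>Hd * G + H * Gd = Hd'\<close> is inserted into the equation of \<open>H'\<close>, the
  equation of \<open>H\<close> removes \<open>A\<close>, and \<open>H\<close> is cancelled from the
  left by means of \<open>Hi\<close>.\<close>

lemma gauge_quotient_equation:
  fixes H G N A Hd Gd H' Hd' :: "complex mat"
  assumes c: "H \<in> carrier_mat n n" "G \<in> carrier_mat n n" "N \<in> carrier_mat n n" "A \<in> carrier_mat n n"
    "Hd \<in> carrier_mat n n" "Gd \<in> carrier_mat n n" "H' \<in> carrier_mat n n" "Hd' \<in> carrier_mat n n"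
    "Hi \<in> carrier_mat n n"
    and eqs: "Hd + H * N = A * H" "Hd' + H' * N = A * H'" "H * G = H'" "Hd * G + H * Gd = Hd'"
    "Hi * H = 1\<^sub>m n"
  shows "Gd + G * N = N * G"
proof -
  note [simp] = c mult_carrier_mat[of _ n n _ n]
  note as = assoc_mult_mat[of _ n n _ n _ n]
  have "H * (Gd + G * N) = H * Gd + H * (G * N)"
    by (rule mult_add_distrib_mat[of _ n n _ n]) auto
  also have "H * (G * N) = H' * N" using as[of H G N] eqs(3) by simp
  finally have 1: "H * (Gd + G * N) = H * Gd + H' * N" .
  have "Hd * G + H * (N * G) = Hd * G + H * N * G"
    using as[of H N G] by simp
  also have "\<dots> = (Hd + H * N) * G"
    by (rule add_mult_distrib_mat[of _ n n _ _ n, symmetric]) auto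
  also have "\<dots> = A * H'" unfolding eqs(1) using as[of A H G] eqs(3) by simp
  also have "\<dots> = Hd * G + H * Gd + H' * N" unfolding eqs(2)[symmetric] eqs(4)[symmetric] ..
  also have "\<dots> = Hd * G + (H * Gd + H' * N)" by (rule assoc_add_mat[of _ n n]) auto
  also have "\<dots> = Hd * G + H * (Gd + G * N)" unfolding 1 ..
  finally have 2: "Hd * G + H * (N * G) = Hd * G + H * (Gd + G * N)" .
  \<comment> \<open>The summand \<open>Hd * G\<close> is cancelled entrywise, addition being a group
    operation only among matrices of one fixed size.\<close>
  have "H * (N * G) = H * (Gd + G * N)"
  proof (rule eq_matI)
    have dims: "Hd * G \<in> carrier_mat n n" "H * (N * G) \<in> carrier_mat n n"
      "H * (Gd + G * N) \<in> carrier_mat n n" by auto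
    show "dim_row (H * (N * G)) = dim_row (H * (Gd + G * N))"
      "dim_col (H * (N * G)) = dim_col (H * (Gd + G * N))" using dims by (metis carrier_matD)+
    fix i j assume "i < dim_row (H * (Gd + G * N))" "j < dim_col (H * (Gd + G * N))"
    then have ij: "i < n" "j < n" using dims(3) by (metis carrier_matD)+
    have "(Hd * G + H * (N * G)) $$ (i, j) = (Hd * G + H * (Gd + G * N)) $$ (i, j)" using 2 by simp
    then have "(Hd * G) $$ (i, j) + (H * (N * G)) $$ (i, j) = (Hd * G) $$ (i, j) + (H * (Gd + G * N)) $$ (i, j)"
      using ij dims by (metis carrier_matD index_add_mat(1))
    then show "(H * (N * G)) $$ (i, j) = (H * (Gd + G * N)) $$ (i, j)" by simp
  qed
  then have "Hi * (H * (N * G)) = Hi * (H * (Gd + G * N))" by simp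
  then have "Hi * H * (N * G) = Hi * H * (Gd + G * N)"
    using as[of Hi H "N * G"] as[of Hi H "Gd + G * N"] by simp
  then show ?thesis unfolding eqs(5) using c by simp
qed

text \<open>The quotient of two normalizations is a gauge transformation from the normal form to
  itself. As the normal form is diagonal, its matrix equation decouples into one scalar equation for
  each entry.\<close>

lemma normalization_quotient_equation:
  assumes "r > 0" "formal_normal_form n k A D Hhat"
    and "normalizing_on n k A D Hhat r c d H" "normalizing_on n k A D Hhat r c d H'"
    and A: "\<And>x. x \<in> sector r c d \<Longrightarrow> A x \<in> carrier_mat n n"
    and pq: "p < n" "q < n"
  shows "(\<lambda>x. (inv_mat (H x) * H' x) $$ (p, q)) holomorphic_on sector r c d" (is ?hol)
    and "x \<in> sector r c d \<Longrightarrow>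
      x ^ (k + 1) * deriv (\<lambda>x. (inv_mat (H x) * H' x) $$ (p, q)) x
        + (inv_mat (H x) * H' x) $$ (p, q) * (\<Sum>i\<le>k. D i $$ (q, q) * x ^ i)
      = (\<Sum>i\<le>k. D i $$ (p, p) * x ^ i) * (inv_mat (H x) * H' x) $$ (p, q)" (is "_ \<Longrightarrow> ?eq")
proof -
  let ?S = "sector r c d"
  define G where "G x = inv_mat (H x) * H' x" for x
  note S = open_sector[OF assms(1), of c d]
  have H: "\<And>x. x \<in> ?S \<Longrightarrow> H x \<in> carrier_mat n n" "\<And>x. x \<in> ?S \<Longrightarrow> Determinant.det (H x) \<noteq> 0"
    "\<And>p q. p < n \<Longrightarrow> q < n \<Longrightarrow> (\<lambda>x. H x $$ (p, q)) holomorphic_on ?S"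
    using assms(3) unfolding normalizing_on_def by (auto dest: invertible_mat_det_nz)
  have H': "\<And>x. x \<in> ?S \<Longrightarrow> H' x \<in> carrier_mat n n"
    "\<And>p q. p < n \<Longrightarrow> q < n \<Longrightarrow> (\<lambda>x. H' x $$ (p, q)) holomorphic_on ?S"
    using assms(4) unfolding normalizing_on_def by auto
  have Gc: "G x \<in> carrier_mat n n" if "x \<in> ?S" for x
    using inv_mat(1)[OF H(1,2)] H'(1) that unfolding G_def by (intro mult_carrier_mat[of _ n n _ n]) auto
  have HG: "H x * G x = H' x" if "x \<in> ?S" for x
    using inv_mat(1,2)[OF H(1,2)[OF that]] H(1)[OF that] H'(1)[OF that]
    unfolding G_def by (subst assoc_mult_mat[of _ n n _ n _ n, symmetric]) auto
  have holG: "(\<lambda>x. G x $$ (p, q)) holomorphic_on ?S" if "p < n" "q < n" for p q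
  proof -
    have "(\<lambda>x. \<Sum>s<n. inv_mat (H x) $$ (p, s) * H' x $$ (s, q)) holomorphic_on ?S"
      using that by (intro holomorphic_intros inv_mat_holomorphic[of _ _ n] H H'(2)) auto
    then show ?thesis
      by (rule holomorphic_transform)
        (simp add: G_def mult_mat_index[OF inv_mat(1)[OF H(1,2)] H'(1)] that)
  qed
  show ?hol using holG[OF pq] by (simp add: G_def)
  assume x: "x \<in> ?S"
  define e where "e = x ^ (k + 1)"
  define dM where "dM M = Matrix.mat n n (\<lambda>(p, q). deriv (\<lambda>z. M z $$ (p, q)) x)" for M :: "complex \<Rightarrow> complex mat"
  have dMc: "dM M \<in> carrier_mat n n" "e \<cdot>\<^sub>m dM M \<in> carrier_mat n n" for M by (auto simp: dM_def)
  have N: "nf_mat n k D x \<in> carrier_mat n n" by (auto simp: nf_mat_def)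
  \<comment> \<open>The product rule for \<open>H * G = H'\<close>, computed entrywise because
    derivatives of matrix functions are taken entry by entry.\<close>
  have prod: "e \<cdot>\<^sub>m dM H * G x + H x * (e \<cdot>\<^sub>m dM G) = e \<cdot>\<^sub>m dM H'"
  proof (rule eq_matI)
    fix i j assume "i < dim_row (e \<cdot>\<^sub>m dM H')" "j < dim_col (e \<cdot>\<^sub>m dM H')"
    then have ij: "i < n" "j < n" by (auto simp: dM_def)
    have eqs: "H' z $$ (i, j) = (\<Sum>s<n. H z $$ (i, s) * G z $$ (s, j))" if "z \<in> ?S" for z
      using mult_mat_index[OF H(1)[OF that] Gc[OF that] ij] unfolding HG[OF that] .
    have dH: "((\<lambda>z. H z $$ (i, s)) has_field_derivative deriv (\<lambda>z. H z $$ (i, s)) x) (at x)" if "s < n" for s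
      using holomorphic_derivI[OF H(3)[OF ij(1) that] S x] .
    have dG: "((\<lambda>z. G z $$ (s, j)) has_field_derivative deriv (\<lambda>z. G z $$ (s, j)) x) (at x)" if "s < n" for s
      using holomorphic_derivI[OF holG[OF that ij(2)] S x] .
    have "((\<lambda>z. \<Sum>s<n. H z $$ (i, s) * G z $$ (s, j)) has_field_derivative
        (\<Sum>s<n. deriv (\<lambda>z. H z $$ (i, s)) x * G x $$ (s, j) + deriv (\<lambda>z. G z $$ (s, j)) x * H x $$ (i, s))) (at x)"
      by (intro DERIV_sum DERIV_mult dH dG) auto
    then have "((\<lambda>z. H' z $$ (i, j)) has_field_derivative
        (\<Sum>s<n. deriv (\<lambda>z. H z $$ (i, s)) x * G x $$ (s, j) + deriv (\<lambda>z. G z $$ (s, j)) x * H x $$ (i, s))) (at x)"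
      by (rule has_field_derivative_transform_within_open[OF _ S x]) (simp add: eqs)
    then have *: "deriv (\<lambda>z. H' z $$ (i, j)) x =
        (\<Sum>s<n. deriv (\<lambda>z. H z $$ (i, s)) x * G x $$ (s, j) + deriv (\<lambda>z. G z $$ (s, j)) x * H x $$ (i, s))"
      by (rule DERIV_imp_deriv)
    have "(e \<cdot>\<^sub>m dM H * G x + H x * (e \<cdot>\<^sub>m dM G)) $$ (i, j)
        = (e \<cdot>\<^sub>m dM H * G x) $$ (i, j) + (H x * (e \<cdot>\<^sub>m dM G)) $$ (i, j)"
      using ij H(1)[OF x] by (intro index_add_mat(1)) (auto simp: dM_def)
    also have "\<dots> = (\<Sum>s<n. e * deriv (\<lambda>z. H z $$ (i, s)) x * G x $$ (s, j))
        + (\<Sum>s<n. H x $$ (i, s) * (e * deriv (\<lambda>z. G z $$ (s, j)) x))"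
      unfolding mult_mat_index[OF dMc(2) Gc[OF x] ij] mult_mat_index[OF H(1)[OF x] dMc(2) ij]
      using ij by (simp add: dM_def)
    also have "\<dots> = e * deriv (\<lambda>z. H' z $$ (i, j)) x"
      unfolding * by (simp add: sum.distrib sum_distrib_left algebra_simps)
    also have "\<dots> = (e \<cdot>\<^sub>m dM H') $$ (i, j)" using ij by (simp add: dM_def)
    finally show "(e \<cdot>\<^sub>m dM H * G x + H x * (e \<cdot>\<^sub>m dM G)) $$ (i, j) = (e \<cdot>\<^sub>m dM H') $$ (i, j)" .
  qed (use H(1)[OF x] Gc[OF x] in \<open>auto simp: dM_def\<close>)
  have "e \<cdot>\<^sub>m dM G + G x * nf_mat n k D x = nf_mat n k D x * G x"
  proof (rule gauge_quotient_equation[OF H(1)[OF x] Gc[OF x] N A[OF x] dMc(2) dMc(2) H'(1)[OF x] dMc(2)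
        inv_mat(1)[OF H(1,2)[OF x]] _ _ HG[OF x] prod inv_mat(3)[OF H(1,2)[OF x]]])
    show "e \<cdot>\<^sub>m dM H + H x * nf_mat n k D x = A x * H x"
      "e \<cdot>\<^sub>m dM H' + H' x * nf_mat n k D x = A x * H' x"
      using assms(3,4) x unfolding normalizing_on_def e_def dM_def by blast+
  qed
  then have *: "(e \<cdot>\<^sub>m dM G + G x * nf_mat n k D x) $$ (p, q) = (nf_mat n k D x * G x) $$ (p, q)" by simp
  have D: "D i $$ (a, b) = 0" if "i \<le> k" "a \<noteq> b" "a < n" "b < n" for i a b
    using assms(2) that unfolding formal_normal_form_def diagonal_mat_def by (metis carrier_matD)
  have Ni: "nf_mat n k D x $$ (a, b) = (if a = b then \<Sum>i\<le>k. D i $$ (a, a) * x ^ i else 0)"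
    if "a < n" "b < n" for a b
    using that D by (auto simp: nf_mat_def intro!: sum.neutral)
  have "(e \<cdot>\<^sub>m dM G + G x * nf_mat n k D x) $$ (p, q)
      = e * deriv (\<lambda>z. G z $$ (p, q)) x + (\<Sum>s<n. G x $$ (p, s) * nf_mat n k D x $$ (s, q))"
    using pq Gc[OF x] N mult_mat_index[OF Gc[OF x] N pq]
    by (subst index_add_mat(1)) (auto simp: dM_def simp del: index_mult_mat(1))
  also have "(\<Sum>s<n. G x $$ (p, s) * nf_mat n k D x $$ (s, q)) = G x $$ (p, q) * (\<Sum>i\<le>k. D i $$ (q, q) * x ^ i)"
    using pq by (subst sum.remove[of _ q]) (auto simp: Ni intro!: sum.neutral)
  finally have lhs: "(e \<cdot>\<^sub>m dM G + G x * nf_mat n k D x) $$ (p, q)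
      = e * deriv (\<lambda>z. G z $$ (p, q)) x + G x $$ (p, q) * (\<Sum>i\<le>k. D i $$ (q, q) * x ^ i)" .
  have rhs: "(nf_mat n k D x * G x) $$ (p, q) = (\<Sum>i\<le>k. D i $$ (p, p) * x ^ i) * G x $$ (p, q)"
    unfolding mult_mat_index[OF N Gc[OF x] pq]
    using pq by (subst sum.remove[of _ p]) (auto simp: Ni intro!: sum.neutral)
  show ?eq using * unfolding lhs rhs unfolding e_def G_def .
qed

lemma nf_sol_carrier: "nf_sol n k D L x \<in> carrier_mat n n"
  by (simp add: nf_sol_eq)

lemma nf_sol_mult_index:
  assumes "M \<in> carrier_mat n n" "p < n" "q < n"
  shows "(M * nf_sol n k D L x) $$ (p, q) = M $$ (p, q) * exp (nf_exp k D L q x)"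
    "(nf_sol n k D L x * M) $$ (p, q) = exp (nf_exp k D L p x) * M $$ (p, q)"
  unfolding nf_sol_eq mat_diag_mult_right[OF assms(1)] mat_diag_mult_left[OF assms(1)]
  using assms by auto

lemma invertible_nf_sol: "invertible_mat (nf_sol n k D L x)"
  unfolding nf_sol_eq by (intro invertible_mat_diag) auto

text \<open>\<open>T\<close> is the quotient \<open>G\<close> conjugated by the two normal form
  solutions. Its entries are constant by the scalar equations; different branches \<open>L\<close>
  and \<open>L'\<close> merely contribute constants. The value of an entry is then tested on a
  single ray: \<open>G\<close> tends to the identity there, so a diagonal entry cannot vanish, while
  a recessive exponential factor forces an off-diagonal one to be 0.\<close>

lemma normalization_transition:
  assumes k: "k \<ge> 1" and r: "r > 0" and fnf: "formal_normal_form n k A D Hhat"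
    and nH: "normalizing_on n k A D Hhat r c d H" and nH': "normalizing_on n k A D Hhat r c d H'"
    and A: "\<And>x. x \<in> sector r c d \<Longrightarrow> A x \<in> carrier_mat n n"
    and L: "log_branch L (sector r c d)" and L': "log_branch L' (sector r c d)" and cd: "c < d"
  obtains T where "T \<in> carrier_mat n n"
    "\<And>x. x \<in> sector r c d \<Longrightarrow> H' x * nf_sol n k D L' x = H x * nf_sol n k D L x * T"
    "\<And>p. p < n \<Longrightarrow> T $$ (p, p) \<noteq> 0"
    "\<And>p q \<psi>. p < n \<Longrightarrow> q < n \<Longrightarrow> c < \<psi> \<Longrightarrow> \<psi> < d \<Longrightarrow>
       ray_pr k \<psi> (D 0 $$ (p, p)) < ray_pr k \<psi> (D 0 $$ (q, q)) \<Longrightarrow> T $$ (p, q) = 0"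
proof -
  let ?S = "sector r c d"
  define G where "G x = inv_mat (H x) * H' x" for x
  note S = open_sector[OF r, of c d]
  have H: "\<And>x. x \<in> ?S \<Longrightarrow> H x \<in> carrier_mat n n" "\<And>x. x \<in> ?S \<Longrightarrow> Determinant.det (H x) \<noteq> 0"
    using nH unfolding normalizing_on_def by (auto dest: invertible_mat_det_nz)
  have H': "\<And>x. x \<in> ?S \<Longrightarrow> H' x \<in> carrier_mat n n"
    using nH' unfolding normalizing_on_def by auto
  have Gc: "G x \<in> carrier_mat n n" if "x \<in> ?S" for x
    using inv_mat(1)[OF H(1,2)] H'(1) that unfolding G_def by (intro mult_carrier_mat[of _ n n _ n]) auto
  have HG: "H x * G x = H' x" if "x \<in> ?S" for x
    using inv_mat(1,2)[OF H(1,2)[OF that]] H(1)[OF that] H'(1)[OF that]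
    unfolding G_def by (subst assoc_mult_mat[of _ n n _ n _ n, symmetric]) auto
  \<comment> \<open>The candidate for the constant entry: the logarithmic derivative of the
    exponential is opposite to that of \<open>G x $$ (p, q)\<close>.\<close>
  define t where "t p q x = G x $$ (p, q) * exp (nf_exp k D L' q x - nf_exp k D L p x)" for p q x
  have "\<exists>c. \<forall>x\<in>?S. t p q x = c" if pq: "p < n" "q < n" for p q
  proof -
    have der: "(t p q has_field_derivative 0) (at x)" if x: "x \<in> ?S" for x
    proof -
      note eq = normalization_quotient_equation[OF r fnf nH nH' A pq, folded G_def]
      define g' where "g' = deriv (\<lambda>z. G z $$ (p, q)) x"
      define a where "a = (\<Sum>i\<le>k. D i $$ (p, p) * x ^ i)"
      define b where "b = (\<Sum>i\<le>k. D i $$ (q, q) * x ^ i)"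
      have nz: "x ^ (k + 1) \<noteq> 0" using sector_nz[OF x] by simp
      have "x ^ (k + 1) * g' + G x $$ (p, q) * b = a * G x $$ (p, q)"
        unfolding g'_def a_def b_def by (rule eq(2)[OF _ x])
      then have "x ^ (k + 1) * g' = G x $$ (p, q) * (a - b)" by (simp add: algebra_simps)
      then have z: "g' = G x $$ (p, q) * (a / x ^ (k + 1) - b / x ^ (k + 1))"
        using nz by (metis diff_divide_distrib nonzero_mult_div_cancel_left times_divide_eq_right)
      have "((\<lambda>z. G z $$ (p, q)) has_field_derivative g') (at x)"
        unfolding g'_def by (rule holomorphic_derivI[OF eq(1) S x])
      moreover have "((\<lambda>x. exp (nf_exp k D L' q x - nf_exp k D L p x)) has_field_derivative
          exp (nf_exp k D L' q x - nf_exp k D L p x) * (b / x ^ (k + 1) - a / x ^ (k + 1))) (at x)"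
        unfolding a_def b_def
        by (intro DERIV_fun_exp DERIV_diff nf_exp_deriv[OF L S x] nf_exp_deriv[OF L' S x])
      ultimately have "(t p q has_field_derivative g' * exp (nf_exp k D L' q x - nf_exp k D L p x)
         + exp (nf_exp k D L' q x - nf_exp k D L p x) * (b / x ^ (k + 1) - a / x ^ (k + 1)) * G x $$ (p, q)) (at x)"
        unfolding t_def[abs_def] by (rule DERIV_mult)
      then show ?thesis unfolding z by (simp add: algebra_simps)
    qed
    have "continuous_on ?S (t p q)"
      by (rule DERIV_continuous_on[OF has_field_derivative_at_within[OF der]])
    then obtain e where "\<And>x. x \<in> ?S \<Longrightarrow> t p q x = e"
      by (rule DERIV_zero_connected_constant[OF connected_sector[OF r] S finite.emptyI]) (simp_all add: der)
    then show ?thesis by blast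
  qed
  then obtain T0 where T0: "\<And>p q x. p < n \<Longrightarrow> q < n \<Longrightarrow> x \<in> ?S \<Longrightarrow> t p q x = T0 p q" by metis
  define T where "T = Matrix.mat n n (\<lambda>(p, q). T0 p q)"
  have Tc: "T \<in> carrier_mat n n" by (simp add: T_def)
  have rel: "G x * nf_sol n k D L' x = nf_sol n k D L x * T" if x: "x \<in> ?S" for x
  proof (rule eq_matI)
    fix p q assume "p < dim_row (nf_sol n k D L x * T)" "q < dim_col (nf_sol n k D L x * T)"
    then have pq: "p < n" "q < n" using nf_sol_carrier[of n k D L x] Tc by auto
    have "exp (nf_exp k D L p x) * T0 p q = exp (nf_exp k D L p x) * t p q x"
      using T0[OF pq x] by simp
    also have "\<dots> = G x $$ (p, q) * exp (nf_exp k D L' q x)"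
      by (simp add: t_def exp_diff)
    finally show "(G x * nf_sol n k D L' x) $$ (p, q) = (nf_sol n k D L x * T) $$ (p, q)"
      unfolding nf_sol_mult_index(1)[OF Gc[OF x] pq] nf_sol_mult_index(2)[OF Tc pq] using pq by (simp add: T_def)
  qed (use Gc[OF x] Tc nf_sol_carrier[of n k D L x] nf_sol_carrier[of n k D L' x] in auto)
  show thesis
  proof (rule that[OF Tc])
    fix x assume x: "x \<in> ?S"
    have "H' x * nf_sol n k D L' x = H x * (G x * nf_sol n k D L' x)"
      unfolding HG[OF x, symmetric]
      by (rule assoc_mult_mat[OF H(1)[OF x] Gc[OF x] nf_sol_carrier])
    also have "\<dots> = H x * nf_sol n k D L x * T"
      unfolding rel[OF x] by (rule assoc_mult_mat[OF H(1)[OF x] nf_sol_carrier Tc, symmetric])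
    finally show "H' x * nf_sol n k D L' x = H x * nf_sol n k D L x * T" .
  next
    have Glim: "((\<lambda>t. G (of_real t * cis \<psi>) $$ (p, q)) \<longlongrightarrow> 1\<^sub>m n $$ (p, q)) (at_right 0)"
      if pq: "p < n" "q < n" and \<psi>: "c < \<psi>" "\<psi> < d" for p q \<psi>
    proof -
      have ev: "\<forall>\<^sub>F t in at_right 0. of_real t * cis \<psi> \<in> ?S"
        using eventually_at_right_real[OF r] by eventually_elim (use \<psi> in \<open>auto intro: ray_in_sector\<close>)
      note nl = normalizing_ray_limit[OF fnf _ \<psi> r]
      have "inv_mat (1\<^sub>m n) = inv_mat (1\<^sub>m n) * 1\<^sub>m n"
        by (rule right_mult_one_mat[symmetric]) (rule inv_mat, auto)
      also have "\<dots> = 1\<^sub>m n" by (rule inv_mat) auto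
      finally have i1: "inv_mat (1\<^sub>m n) = 1\<^sub>m n" .
      have il: "((\<lambda>t. inv_mat (H (of_real t * cis \<psi>)) $$ (p, s)) \<longlongrightarrow> inv_mat (1\<^sub>m n) $$ (p, s)) (at_right 0)"
        if "s < n" for s
        using ev pq that
        by (intro inv_mat_tendsto[of _ n] nl[OF nH]) (auto elim!: eventually_mono simp: H)
      have "((\<lambda>t. \<Sum>s<n. inv_mat (H (of_real t * cis \<psi>)) $$ (p, s) * H' (of_real t * cis \<psi>) $$ (s, q)) \<longlongrightarrow>
          (\<Sum>s<n. inv_mat (1\<^sub>m n) $$ (p, s) * 1\<^sub>m n $$ (s, q))) (at_right 0)"
        using pq by (intro tendsto_sum tendsto_mult il nl[OF nH']) auto
      also have "(\<Sum>s<n. inv_mat (1\<^sub>m n) $$ (p, s) * 1\<^sub>m n $$ (s, q)) = (1\<^sub>m n * 1\<^sub>m n :: complex mat) $$ (p, q)"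
        unfolding i1 using pq by (subst mult_mat_index[of _ n n]) auto
      also have "\<dots> = (1\<^sub>m n :: complex mat) $$ (p, q)" by simp
      finally show ?thesis
        by (rule Lim_transform_eventually)
          (use ev in eventually_elim, simp add: G_def mult_mat_index[OF inv_mat(1)[OF H(1,2)] H'(1)] pq)
    qed
    have tT: "\<forall>\<^sub>F u in at_right 0. t p q (of_real u * cis \<psi>) = T0 p q"
      if pq: "p < n" "q < n" and \<psi>: "c < \<psi>" "\<psi> < d" for p q \<psi>
      using eventually_at_right_real[OF r]
      by eventually_elim (use \<psi> in \<open>auto intro!: T0 pq ray_in_sector\<close>)
    show "T $$ (p, p) \<noteq> 0" if p: "p < n" for p
    proof -
      \<comment> \<open>Any ray inside the sector serves: \<open>G\<close> has diagonal limit 1 on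
        it and the exponential factor never vanishes.\<close>
      define \<psi> where "\<psi> = (c + d) / 2"
      have \<psi>: "c < \<psi>" "\<psi> < d" using cd by (auto simp: \<psi>_def)
      have "\<forall>\<^sub>F u in at_right 0. G (of_real u * cis \<psi>) $$ (p, p) \<noteq> 0"
        using tendsto_imp_eventually_ne[OF Glim[OF p p \<psi>], of 0] p by simp
      then have "\<forall>\<^sub>F u in at_right (0 :: real). T0 p p \<noteq> 0"
        using tT[OF p p \<psi>] by eventually_elim (auto simp: t_def)
      then have "T0 p p \<noteq> 0" by simp
      then show ?thesis using p by (simp add: T_def)
    qed
    fix p q \<psi> assume pq: "p < n" "q < n" and \<psi>: "c < \<psi>" "\<psi> < d"
      and lt: "ray_pr k \<psi> (D 0 $$ (p, p)) < ray_pr k \<psi> (D 0 $$ (q, q))"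
    \<comment> \<open>The factor by which the bounded entry of \<open>G\<close> is multiplied decays
      on this ray, although the product is constant.\<close>
    have "((\<lambda>u. exp (Re (nf_exp k D L' q (of_real u * cis \<psi>) - nf_exp k D L p (of_real u * cis \<psi>)))) \<longlongrightarrow> 0) (at_right 0)"
      by (rule filterlim_compose[OF exp_at_bot nf_exp_ray_at_bot[where D = D, OF k r \<psi> L L' lt]])
    then have "((\<lambda>u. norm (exp (nf_exp k D L' q (of_real u * cis \<psi>) - nf_exp k D L p (of_real u * cis \<psi>)))) \<longlongrightarrow> 0) (at_right 0)"
      by (simp add: norm_exp_eq_Re)
    then have "((\<lambda>u. exp (nf_exp k D L' q (of_real u * cis \<psi>) - nf_exp k D L p (of_real u * cis \<psi>))) \<longlongrightarrow> 0) (at_right 0)"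
      by (rule tendsto_norm_zero_cancel)
    from tendsto_mult[OF Glim[OF pq \<psi>] this]
    have "((\<lambda>u. t p q (of_real u * cis \<psi>)) \<longlongrightarrow> 0) (at_right 0)" by (simp add: t_def)
    moreover have "((\<lambda>u. t p q (of_real u * cis \<psi>)) \<longlongrightarrow> T0 p q) (at_right 0)"
      using tendsto_cong[OF tT[OF pq \<psi>]] by simp
    ultimately have "T0 p q = 0" using tendsto_unique trivial_limit_at_right_real by blast
    then show "T $$ (p, q) = 0" using pq by (simp add: T_def)
  qed
qed

section \<open>Fundamental solutions on sectors\<close>

text \<open>The condition on a sectorial solution with trivial permutation, stated for one arbitrary
  set so that it can be restricted to overlaps of old and rotated sectors.\<close>

definition fundamental_on ::
  "nat \<Rightarrow> nat \<Rightarrow> (nat \<Rightarrow> complex mat) \<Rightarrow> complex set \<Rightarrow> (complex \<Rightarrow> complex mat) \<Rightarrow>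
   (complex \<Rightarrow> complex mat) \<Rightarrow> bool" where
  "fundamental_on n k D S H W \<longleftrightarrow> (\<exists>L K.
     log_branch L S \<and> K \<in> carrier_mat n n \<and> diagonal_mat K \<and> invertible_mat K \<and>
     (\<forall>x\<in>S. W x = H x * nf_sol n k D L x * K))"

lemma fundamental_on_mono: "fundamental_on n k D S H W \<Longrightarrow> S' \<subseteq> S \<Longrightarrow> fundamental_on n k D S' H W"
  unfolding fundamental_on_def by (meson log_branch_mono subsetD)

lemma fundamental_on_invertible:
  assumes "fundamental_on n k D (sector r c d) H W" "normalizing_on n k A D Hhat r c d H" "x \<in> sector r c d"
  shows "W x \<in> carrier_mat n n" "invertible_mat (W x)"
proof -
  obtain L K where K: "K \<in> carrier_mat n n" "invertible_mat K" "W x = H x * nf_sol n k D L x * K"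
    using assms(1,3) unfolding fundamental_on_def by blast
  have H: "H x \<in> carrier_mat n n" "invertible_mat (H x)"
    using assms(2,3) unfolding normalizing_on_def by auto
  have c: "H x * nf_sol n k D L x \<in> carrier_mat n n"
    using H(1) nf_sol_carrier by (rule mult_carrier_mat)
  show "W x \<in> carrier_mat n n" unfolding K(3) using c K(1) by (rule mult_carrier_mat)
  show "invertible_mat (W x)"
    unfolding K(3) by (intro invertible_mat_mult[of _ n] c H K nf_sol_carrier invertible_nf_sol)
qed

text \<open>The diagonal freedoms \<open>K\<close> and \<open>K'\<close> multiply each entry of the
  transition matrix by a nonzero constant, so nonzero diagonal entries and forced zeros
  survive.\<close>

lemma fundamental_transition:
  assumes k: "k \<ge> 1" and r: "r > 0" and fnf: "formal_normal_form n k A D Hhat"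
    and nH: "normalizing_on n k A D Hhat r c d H" and nH': "normalizing_on n k A D Hhat r c d H'"
    and A: "\<And>x. x \<in> sector r c d \<Longrightarrow> A x \<in> carrier_mat n n"
    and W: "fundamental_on n k D (sector r c d) H W" and W': "fundamental_on n k D (sector r c d) H' W'"
    and cd: "c < d"
  obtains T where "T \<in> carrier_mat n n"
    "\<And>x. x \<in> sector r c d \<Longrightarrow> W' x = W x * T"
    "\<And>p. p < n \<Longrightarrow> T $$ (p, p) \<noteq> 0"
    "\<And>p q \<psi>. p < n \<Longrightarrow> q < n \<Longrightarrow> c < \<psi> \<Longrightarrow> \<psi> < d \<Longrightarrow>
       ray_pr k \<psi> (D 0 $$ (p, p)) < ray_pr k \<psi> (D 0 $$ (q, q)) \<Longrightarrow> T $$ (p, q) = 0"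
proof -
  obtain L K where L: "log_branch L (sector r c d)"
    and K: "K \<in> carrier_mat n n" "diagonal_mat K" "invertible_mat K"
    and WK: "\<And>x. x \<in> sector r c d \<Longrightarrow> W x = H x * nf_sol n k D L x * K"
    using W unfolding fundamental_on_def by blast
  obtain L' K' where L': "log_branch L' (sector r c d)"
    and K': "K' \<in> carrier_mat n n" "diagonal_mat K'" "invertible_mat K'"
    and WK': "\<And>x. x \<in> sector r c d \<Longrightarrow> W' x = H' x * nf_sol n k D L' x * K'"
    using W' unfolding fundamental_on_def by blast
  obtain T where T: "T \<in> carrier_mat n n"
    "\<And>x. x \<in> sector r c d \<Longrightarrow> H' x * nf_sol n k D L' x = H x * nf_sol n k D L x * T"
    "\<And>p. p < n \<Longrightarrow> T $$ (p, p) \<noteq> 0"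
    "\<And>p q \<psi>. p < n \<Longrightarrow> q < n \<Longrightarrow> c < \<psi> \<Longrightarrow> \<psi> < d \<Longrightarrow>
       ray_pr k \<psi> (D 0 $$ (p, p)) < ray_pr k \<psi> (D 0 $$ (q, q)) \<Longrightarrow> T $$ (p, q) = 0"
    using normalization_transition[OF k r fnf nH nH' A L L' cd] by blast
  define Ki where "Ki = mat_diag n (\<lambda>p. 1 / K $$ (p, p))"
  have Ki: "Ki \<in> carrier_mat n n" by (simp add: Ki_def)
  have KKi: "K * Ki = 1\<^sub>m n"
  proof -
    have "K * Ki = mat_diag n (\<lambda>p. K $$ (p, p)) * Ki"
      using mat_diag_eq_diagonal[OF K(1,2)] by simp
    also have "\<dots> = 1\<^sub>m n"
      unfolding Ki_def mat_diag_mult_right[OF mat_diag_dim]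
      using invertible_diagonal_nz[OF K] by (intro eq_matI) (auto simp: mat_diag_def)
    finally show ?thesis .
  qed
  have TK: "T * K' \<in> carrier_mat n n" using T(1) K'(1) by (rule mult_carrier_mat)
  have idx: "(Ki * (T * K')) $$ (p, q) = T $$ (p, q) * K' $$ (q, q) / K $$ (p, p)" if "p < n" "q < n" for p q
  proof -
    have "K' = mat_diag n (\<lambda>p. K' $$ (p, p))" by (rule mat_diag_eq_diagonal[OF K'(1,2)])
    then have "T * K' = Matrix.mat n n (\<lambda>(i, j). T $$ (i, j) * K' $$ (j, j))"
      using mat_diag_mult_right[OF T(1)] by metis
    then show ?thesis
      unfolding Ki_def mat_diag_mult_left[OF TK] using that by simp
  qed
  show thesis
  proof (rule that[of "Ki * (T * K')"])
    show "Ki * (T * K') \<in> carrier_mat n n" using Ki TK by (rule mult_carrier_mat)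
    fix x assume x: "x \<in> sector r c d"
    have "H x \<in> carrier_mat n n" using nH x unfolding normalizing_on_def by auto
    then have Y: "H x * nf_sol n k D L x \<in> carrier_mat n n" using nf_sol_carrier by (rule mult_carrier_mat)
    have "W x * (Ki * (T * K')) = H x * nf_sol n k D L x * (K * (Ki * (T * K')))"
      unfolding WK[OF x] by (rule assoc_mult_mat[OF Y K(1) mult_carrier_mat[OF Ki TK]])
    also have "K * (Ki * (T * K')) = K * Ki * (T * K')" by (rule assoc_mult_mat[OF K(1) Ki TK, symmetric])
    also have "\<dots> = T * K'" unfolding KKi by (rule left_mult_one_mat[OF TK])
    also have "H x * nf_sol n k D L x * (T * K') = H x * nf_sol n k D L x * T * K'"
      by (rule assoc_mult_mat[OF Y T(1) K'(1), symmetric])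
    also have "\<dots> = W' x" unfolding WK'[OF x] T(2)[OF x] ..
    finally show "W' x = W x * (Ki * (T * K'))" ..
  next
    fix p assume "p < n"
    then show "(Ki * (T * K')) $$ (p, p) \<noteq> 0"
      using idx T(3) invertible_diagonal_nz[OF K] invertible_diagonal_nz[OF K'] by simp
  next
    fix p q \<psi> assume "p < n" "q < n" "c < \<psi>" "\<psi> < d"
      "ray_pr k \<psi> (D 0 $$ (p, p)) < ray_pr k \<psi> (D 0 $$ (q, q))"
    then show "(Ki * (T * K')) $$ (p, q) = 0" using idx T(4) by simp
  qed
qed

lemma mult_left_cancel_invertible:
  assumes "W \<in> carrier_mat n n" "invertible_mat W" "X \<in> carrier_mat n n" "Y \<in> carrier_mat n n" "W * X = W * Y"
  shows "X = Y"
proof -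
  obtain B where B: "B \<in> carrier_mat n n" "B * W = 1\<^sub>m n" using invertible_matE[OF assms(2,1)] .
  have "X = B * W * X" unfolding B(2) by (rule left_mult_one_mat[OF assms(3), symmetric])
  also have "\<dots> = B * (W * Y)" unfolding assms(5)[symmetric] by (rule assoc_mult_mat[OF B(1) assms(1,3)])
  also have "\<dots> = B * W * Y" by (rule assoc_mult_mat[OF B(1) assms(1,4), symmetric])
  also have "\<dots> = Y" unfolding B(2) by (rule left_mult_one_mat[OF assms(4)])
  finally show ?thesis .
qed

text \<open>
  Here \<open>\<alpha>\<close> and \<open>\<beta>\<close> are the arguments of the rays at which the first sector and the rotated sector
  end; \<open>T = G * T'\<close> because all three sectors contain a neighbourhood of the ray of argument \<open>\<alpha>\<close>.
\<close>

lemma rotated_transitions: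
  assumes k: "k \<ge> 1" and r: "r > 0" and \<eta>: "\<eta> > 0" and fnf: "formal_normal_form n k A D Hhat"
    and A: "\<And>x. x \<in> ball 0 r \<Longrightarrow> A x \<in> carrier_mat n n"
    and \<beta>: "\<alpha> \<le> \<beta>" "\<beta> \<le> \<alpha> + pi / real k"
    and H1: "normalizing_on n k A D Hhat r (\<alpha> - pi / real k - \<eta>) (\<alpha> + \<eta>) H1"
      "fundamental_on n k D (sector r (\<alpha> - pi / real k - \<eta>) (\<alpha> + \<eta>)) H1 W1"
    and H2: "normalizing_on n k A D Hhat r (\<alpha> - \<eta>) (\<alpha> + pi / real k + \<eta>) H2"
      "fundamental_on n k D (sector r (\<alpha> - \<eta>) (\<alpha> + pi / real k + \<eta>)) H2 W2"
    and H3: "normalizing_on n k A D Hhat r (\<beta> - pi / real k - \<eta>) (\<beta> + \<eta>) H3"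
      "fundamental_on n k D (sector r (\<beta> - pi / real k - \<eta>) (\<beta> + \<eta>)) H3 W3"
    and G: "G \<in> carrier_mat n n" "\<And>x. x \<in> sector r (\<alpha> - \<eta>) (\<alpha> + \<eta>) \<Longrightarrow> W2 x = W1 x * G"
  obtains T T' where "T \<in> carrier_mat n n" "T' \<in> carrier_mat n n" "T = G * T'"
    "\<And>x. x \<in> sector r (\<beta> - pi / real k - \<eta>) (\<alpha> + \<eta>) \<Longrightarrow> W3 x = W1 x * T"
    "\<And>x. x \<in> sector r (\<alpha> - \<eta>) (\<beta> + \<eta>) \<Longrightarrow> W3 x = W2 x * T'"
    "\<And>p. p < n \<Longrightarrow> T $$ (p, p) \<noteq> 0" "\<And>p. p < n \<Longrightarrow> T' $$ (p, p) \<noteq> 0"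
    "\<And>p q \<psi>. p < n \<Longrightarrow> q < n \<Longrightarrow> \<beta> - pi / real k - \<eta> < \<psi> \<Longrightarrow> \<psi> < \<alpha> + \<eta> \<Longrightarrow>
       ray_pr k \<psi> (D 0 $$ (p, p)) < ray_pr k \<psi> (D 0 $$ (q, q)) \<Longrightarrow> T $$ (p, q) = 0"
    "\<And>p q \<psi>. p < n \<Longrightarrow> q < n \<Longrightarrow> \<alpha> - \<eta> < \<psi> \<Longrightarrow> \<psi> < \<beta> + \<eta> \<Longrightarrow>
       ray_pr k \<psi> (D 0 $$ (p, p)) < ray_pr k \<psi> (D 0 $$ (q, q)) \<Longrightarrow> T' $$ (p, q) = 0"
proof -
  have ball: "sector r a b \<subseteq> ball 0 r" for a b by (auto simp: sector_def norm_mult)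
  have A': "\<And>x. x \<in> sector r a b \<Longrightarrow> A x \<in> carrier_mat n n" for a b using A ball by blast
  have pk: "pi / real k > 0" using k by simp
  note mono = normalizing_on_mono fundamental_on_mono[OF _ sector_mono]
  have n1: "normalizing_on n k A D Hhat r (\<beta> - pi / real k - \<eta>) (\<alpha> + \<eta>) H1"
    "normalizing_on n k A D Hhat r (\<beta> - pi / real k - \<eta>) (\<alpha> + \<eta>) H3"
    "fundamental_on n k D (sector r (\<beta> - pi / real k - \<eta>) (\<alpha> + \<eta>)) H1 W1"
    "fundamental_on n k D (sector r (\<beta> - pi / real k - \<eta>) (\<alpha> + \<eta>)) H3 W3"
    using mono(1)[OF H1(1)] mono(1)[OF H3(1)] mono(2)[OF H1(2)] mono(2)[OF H3(2)] \<beta> by auto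
  have n2: "normalizing_on n k A D Hhat r (\<alpha> - \<eta>) (\<beta> + \<eta>) H2"
    "normalizing_on n k A D Hhat r (\<alpha> - \<eta>) (\<beta> + \<eta>) H3"
    "fundamental_on n k D (sector r (\<alpha> - \<eta>) (\<beta> + \<eta>)) H2 W2"
    "fundamental_on n k D (sector r (\<alpha> - \<eta>) (\<beta> + \<eta>)) H3 W3"
    using mono(1)[OF H2(1)] mono(1)[OF H3(1)] mono(2)[OF H2(2)] mono(2)[OF H3(2)] \<beta> by auto
  have lt1: "\<beta> - pi / real k - \<eta> < \<alpha> + \<eta>" and lt2: "\<alpha> - \<eta> < \<beta> + \<eta>" using \<beta> \<eta> by auto
  obtain T where T: "T \<in> carrier_mat n n"
    "\<And>x. x \<in> sector r (\<beta> - pi / real k - \<eta>) (\<alpha> + \<eta>) \<Longrightarrow> W3 x = W1 x * T"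
    "\<And>p. p < n \<Longrightarrow> T $$ (p, p) \<noteq> 0"
    "\<And>p q \<psi>. p < n \<Longrightarrow> q < n \<Longrightarrow> \<beta> - pi / real k - \<eta> < \<psi> \<Longrightarrow> \<psi> < \<alpha> + \<eta> \<Longrightarrow>
       ray_pr k \<psi> (D 0 $$ (p, p)) < ray_pr k \<psi> (D 0 $$ (q, q)) \<Longrightarrow> T $$ (p, q) = 0"
    using fundamental_transition[OF k r fnf n1(1,2) A'[of _ "\<beta> - pi / real k - \<eta>" "\<alpha> + \<eta>"] n1(3,4) lt1] by blast
  obtain T' where T': "T' \<in> carrier_mat n n"
    "\<And>x. x \<in> sector r (\<alpha> - \<eta>) (\<beta> + \<eta>) \<Longrightarrow> W3 x = W2 x * T'"
    "\<And>p. p < n \<Longrightarrow> T' $$ (p, p) \<noteq> 0"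
    "\<And>p q \<psi>. p < n \<Longrightarrow> q < n \<Longrightarrow> \<alpha> - \<eta> < \<psi> \<Longrightarrow> \<psi> < \<beta> + \<eta> \<Longrightarrow>
       ray_pr k \<psi> (D 0 $$ (p, p)) < ray_pr k \<psi> (D 0 $$ (q, q)) \<Longrightarrow> T' $$ (p, q) = 0"
    using fundamental_transition[OF k r fnf n2(1,2) A'[of _ "\<alpha> - \<eta>" "\<beta> + \<eta>"] n2(3,4) lt2] by blast
  have "T = G * T'"
  proof -
    obtain x where x: "x \<in> sector r (\<alpha> - \<eta>) (\<alpha> + \<eta>)"
      using sector_nonempty[OF r, of "\<alpha> - \<eta>" "\<alpha> + \<eta>"] \<eta> by auto
    have x1: "x \<in> sector r (\<beta> - pi / real k - \<eta>) (\<alpha> + \<eta>)" and x2: "x \<in> sector r (\<alpha> - \<eta>) (\<beta> + \<eta>)"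
      using x sector_mono[of "\<beta> - pi / real k - \<eta>" "\<alpha> - \<eta>" "\<alpha> + \<eta>" "\<alpha> + \<eta>" r]
        sector_mono[of "\<alpha> - \<eta>" "\<alpha> - \<eta>" "\<alpha> + \<eta>" "\<beta> + \<eta>" r] \<beta> by auto
    note W1 = fundamental_on_invertible[OF n1(3,1) x1]
    have "W1 x * T = W2 x * T'" using T(2)[OF x1] T'(2)[OF x2] by simp
    also have "\<dots> = W1 x * (G * T')"
      unfolding G(2)[OF x] by (rule assoc_mult_mat[OF W1(1) G(1) T'(1)])
    finally show ?thesis
      by (rule mult_left_cancel_invertible[OF W1 T(1) mult_carrier_mat[OF G(1) T'(1)]])
  qed
  from that[OF T(1) T'(1) this T(2) T'(2) T(3) T'(3) T(4) T'(4)] show thesis .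
qed

text \<open>Solutions are invertible, so a single point of the sector identifies \<open>G\<close>
  with the transition matrix, whose zero pattern is known.\<close>

lemma stokes_multiplier_pattern:
  assumes k: "k \<ge> 1" and r: "r > 0" and fnf: "formal_normal_form n k A D Hhat"
    and n1: "normalizing_on n k A D Hhat r c d H1" and n2: "normalizing_on n k A D Hhat r c d H2"
    and A: "\<And>x. x \<in> ball 0 r \<Longrightarrow> A x \<in> carrier_mat n n"
    and W: "fundamental_on n k D (sector r c d) H1 W1" "fundamental_on n k D (sector r c d) H2 W2"
    and cd: "c < d"
    and G: "G \<in> carrier_mat n n" "\<And>x. x \<in> sector r c d \<Longrightarrow> W2 x = W1 x * G"
  shows "p < n \<Longrightarrow> G $$ (p, p) \<noteq> 0"
    "p < n \<Longrightarrow> q < n \<Longrightarrow> c < \<psi> \<Longrightarrow> \<psi> < d \<Longrightarrow>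
       ray_pr k \<psi> (D 0 $$ (p, p)) < ray_pr k \<psi> (D 0 $$ (q, q)) \<Longrightarrow> G $$ (p, q) = 0"
proof -
  have A': "\<And>x. x \<in> sector r c d \<Longrightarrow> A x \<in> carrier_mat n n"
    using A by (auto simp: sector_def norm_mult)
  obtain T where T: "T \<in> carrier_mat n n"
    "\<And>x. x \<in> sector r c d \<Longrightarrow> W2 x = W1 x * T"
    "\<And>p. p < n \<Longrightarrow> T $$ (p, p) \<noteq> 0"
    "\<And>p q \<psi>. p < n \<Longrightarrow> q < n \<Longrightarrow> c < \<psi> \<Longrightarrow> \<psi> < d \<Longrightarrow>
       ray_pr k \<psi> (D 0 $$ (p, p)) < ray_pr k \<psi> (D 0 $$ (q, q)) \<Longrightarrow> T $$ (p, q) = 0"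
    using fundamental_transition[OF k r fnf n1 n2 A' W cd] by blast
  obtain x where x: "x \<in> sector r c d" using sector_nonempty[OF r cd] by auto
  have "W1 x * G = W1 x * T" using G(2)[OF x] T(2)[OF x] by simp
  then have "G = T"
    by (rule mult_left_cancel_invertible[OF fundamental_on_invertible[OF W(1) n1 x] G(1) T(1)])
  then show "p < n \<Longrightarrow> G $$ (p, p) \<noteq> 0"
    "p < n \<Longrightarrow> q < n \<Longrightarrow> c < \<psi> \<Longrightarrow> \<psi> < d \<Longrightarrow>
       ray_pr k \<psi> (D 0 $$ (p, p)) < ray_pr k \<psi> (D 0 $$ (q, q)) \<Longrightarrow> G $$ (p, q) = 0"
    using T(3,4) by auto
qed

section \<open>Projections of the eigenvalues and separating arguments\<close>

lemma ray_pr_diff: "ray_pr k \<psi> (a - b) = ray_pr k \<psi> a - ray_pr k \<psi> b"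
  by (simp add: ray_pr_def left_diff_distrib)

text \<open>The complex number \<open>z * cis (- (k * \<psi>))\<close> is turned by the angle
  \<open>- k * \<epsilon>\<close>. At an argument where its real part vanishes, only the sine term
  is left and the sign on both sides can be read off.\<close>

lemma ray_pr_add_arg:
  "ray_pr k (\<psi> + \<epsilon>) z =
     ray_pr k \<psi> z * cos (real k * \<epsilon>) + Im (z * cis (- (real k * \<psi>))) * sin (real k * \<epsilon>)"
proof -
  have "cis (- (real k * (\<psi> + \<epsilon>))) = cis (- (real k * \<psi>)) * cis (- (real k * \<epsilon>))"
    by (simp add: cis_mult algebra_simps)
  then have "z * cis (- (real k * (\<psi> + \<epsilon>))) = z * cis (- (real k * \<psi>)) * cis (- (real k * \<epsilon>))"
    by simp
  then show ?thesis unfolding ray_pr_def by (simp only: times_complex.sel cis.sel) simp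
qed

lemma ray_pr_shift:
  assumes "k \<ge> 1"
  shows "ray_pr k (\<psi> + real j * pi / real k) z = (- 1) ^ j * ray_pr k \<psi> z"
proof -
  have "real k * (real j * pi / real k) = real j * pi" using assms by simp
  then show ?thesis
    unfolding ray_pr_add_arg by (simp only:) (simp add: mult.commute)
qed

lemma continuous_ray_pr: "continuous_on S (\<lambda>\<psi>. ray_pr k \<psi> z)"
  unfolding ray_pr_def by (intro continuous_intros)

text \<open>On a separating ray the rotated difference \<open>w\<close> is purely imaginary and
  nonzero, so the difference of projections changes sign there and \<open>a\<close> falls below
  \<open>b\<close> on one side. As \<open>a\<close> and \<open>b\<close> may be exchanged, one
  common separating ray makes both off-diagonal entries of the pair vanish.\<close>

lemma ray_pr_eq_imp_less_near:
  assumes k: "k \<ge> 1" and "a \<noteq> b" and eq: "ray_pr k \<psi> a = ray_pr k \<psi> b" and \<psi>: "c < \<psi>" "\<psi> < d"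
  obtains \<psi>' where "c < \<psi>'" "\<psi>' < d" "ray_pr k \<psi>' a < ray_pr k \<psi>' b"
proof -
  define w where "w = (a - b) * cis (- (real k * \<psi>))"
  have re: "ray_pr k \<psi> (a - b) = 0" using eq by (simp add: ray_pr_diff)
  have "w \<noteq> 0" using assms(2) by (simp add: w_def)
  moreover have "Re w = 0" using re by (simp add: ray_pr_def w_def)
  ultimately have im: "Im w \<noteq> 0" by (metis complex_eqI zero_complex.sel)
  define h where "h = pi / real k"
  \<comment> \<open>Small enough to stay in the given interval on either side and to have
    \<open>k * \<epsilon> < pi\<close>, where the sine is positive.\<close>
  define \<epsilon> where "\<epsilon> = min (min (\<psi> - c) (d - \<psi>)) h / 2"
  have h: "h > 0" using k by (simp add: h_def)
  have \<epsilon>: "0 < \<epsilon>" "\<epsilon> < \<psi> - c" "\<epsilon> < d - \<psi>" "\<epsilon> < h"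
    using \<psi> h unfolding \<epsilon>_def min_def by (auto split: if_splits)
  have "real k * \<epsilon> < pi" using \<epsilon>(4) k by (simp add: h_def field_simps)
  then have s: "sin (real k * \<epsilon>) > 0" using \<epsilon>(1) k by (intro sin_gt_zero) auto
  have near: "ray_pr k (\<psi> + e) a - ray_pr k (\<psi> + e) b = Im w * sin (real k * e)" for e
    using ray_pr_add_arg[of k \<psi> e "a - b"] re by (simp add: ray_pr_diff w_def)
  show thesis
  proof (cases "Im w < 0")
    case True
    then have "Im w * sin (real k * \<epsilon>) < 0" using s by (simp add: mult_neg_pos)
    then have "ray_pr k (\<psi> + \<epsilon>) a < ray_pr k (\<psi> + \<epsilon>) b" using near[of \<epsilon>] by linarith
    moreover have "c < \<psi> + \<epsilon>" "\<psi> + \<epsilon> < d" using \<epsilon> \<psi> by linarith+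
    ultimately show thesis by (rule that[rotated 2])
  next
    case False
    then have "Im w * sin (real k * - \<epsilon>) < 0" using s im by simp
    then have "ray_pr k (\<psi> + - \<epsilon>) a < ray_pr k (\<psi> + - \<epsilon>) b" using near[of "- \<epsilon>"] by linarith
    moreover have "c < \<psi> + - \<epsilon>" "\<psi> + - \<epsilon> < d" using \<epsilon> \<psi> by linarith+
    ultimately show thesis by (rule that[rotated 2])
  qed
qed

text \<open>Along the ray the real part in question is the difference of projections divided by
  \<open>t^k\<close>. The condition refers to the ray as a set, so it does not matter by which
  argument the ray is described.\<close>

lemma separating_ray_iff:
  "ray \<psi> \<in> separating_rays k a b \<longleftrightarrow> ray_pr k \<psi> a = ray_pr k \<psi> b"
proof -
  have *: "Re ((a - b) / (of_real t * cis \<psi>) ^ k) = (ray_pr k \<psi> a - ray_pr k \<psi> b) / t ^ k" for t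
  proof -
    have "(a - b) / (of_real t * cis \<psi>) ^ k = of_real (1 / t ^ k) * ((a - b) * cis (- (real k * \<psi>)))"
      by (simp add: power_mult_distrib Complex.DeMoivre divide_inverse cis_inverse mult_ac)
    then have "Re ((a - b) / (of_real t * cis \<psi>) ^ k) = 1 / t ^ k * Re ((a - b) * cis (- (real k * \<psi>)))"
      by (simp only: times_complex.sel Re_complex_of_real Im_complex_of_real)
    then show ?thesis unfolding ray_pr_diff[symmetric] by (simp add: ray_pr_def)
  qed
  have "(\<forall>x\<in>ray \<psi>. Re ((a - b) / x ^ k) = 0) \<longleftrightarrow> ray_pr k \<psi> a = ray_pr k \<psi> b"
  proof
    assume "\<forall>x\<in>ray \<psi>. Re ((a - b) / x ^ k) = 0"
    moreover have "of_real 1 * cis \<psi> \<in> ray \<psi>" unfolding ray_def by fastforce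
    ultimately show "ray_pr k \<psi> a = ray_pr k \<psi> b" using *[of 1] by simp
  next
    assume "ray_pr k \<psi> a = ray_pr k \<psi> b"
    then show "\<forall>x\<in>ray \<psi>. Re ((a - b) / x ^ k) = 0" unfolding ray_def using * by auto
  qed
  then show ?thesis unfolding separating_rays_def by auto
qed

lemma separating_args_iff:
  "\<psi> \<in> separating_args n k lam \<longleftrightarrow> 0 \<le> \<psi> \<and> \<psi> < 2 * pi \<and>
     (\<exists>p<n. \<exists>q<n. p \<noteq> q \<and> ray_pr k \<psi> (lam p) = ray_pr k \<psi> (lam q))"
  unfolding separating_args_def separating_ray_iff by auto

lemma ray_pr_zero: "ray_pr k 0 z = Re z"
  by (simp add: ray_pr_def)

text \<open>Intermediate value theorem; the left end is excluded because the order is strict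
  there.\<close>

lemma ray_pr_crossing:
  assumes "ray_pr k a x > ray_pr k a y" "ray_pr k b x \<le> ray_pr k b y" "a \<le> b"
  obtains \<psi> where "a < \<psi>" "\<psi> \<le> b" "ray_pr k \<psi> x = ray_pr k \<psi> y"
proof -
  have "\<exists>\<psi>\<ge>a. \<psi> \<le> b \<and> ray_pr k \<psi> x - ray_pr k \<psi> y = 0"
    using assms by (intro IVT2') (auto intro!: continuous_intros continuous_ray_pr)
  then obtain \<psi> where "a \<le> \<psi>" "\<psi> \<le> b" "ray_pr k \<psi> x = ray_pr k \<psi> y" by auto
  moreover from this have "a \<noteq> \<psi>" using assms(1) by auto
  ultimately show thesis by (intro that[of \<psi>]) auto
qed

text \<open>From 0 to \<open>pi / k\<close> every projection changes its sign, so each pair meets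
  strictly in between. A meeting argument is \<phi> 1 or at least \<phi> 2, hence lies beyond
  \<theta> for the pairs that do not meet at \<phi> 1. Such pairs keep their order up to \<theta>,
  while those that meet at \<phi> 1 are interchanged.\<close>

lemma first_separating_args:
  assumes k: "k \<ge> 1" and n: "n \<ge> 2"
    and decr: "\<forall>p q. p < q \<and> q < n \<longrightarrow> Re (lam p) > Re (lam q)"
    and \<phi>: "strict_mono_on {1..2 * k * u} \<phi>" "\<phi> ` {1..2 * k * u} = separating_args n k lam"
    and \<theta>: "\<phi> 1 < \<theta>" "\<theta> < \<phi> 2"
  shows "0 < \<phi> 1" "\<phi> 1 < pi / real k" "\<theta> < \<phi> 1 + pi / real k"
    and "p < q \<Longrightarrow> q < n \<Longrightarrow> ray_pr k (\<phi> 1) (lam p) \<noteq> ray_pr k (\<phi> 1) (lam q) \<Longrightarrow>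
      \<exists>\<psi>. \<theta> < \<psi> \<and> \<psi> < pi / real k \<and> ray_pr k \<psi> (lam p) = ray_pr k \<psi> (lam q)"
    and "p < q \<Longrightarrow> q < n \<Longrightarrow> ray_pr k (\<phi> 1) (lam p) \<noteq> ray_pr k (\<phi> 1) (lam q) \<Longrightarrow>
      ray_pr k \<theta> (lam p) > ray_pr k \<theta> (lam q)"
    and "p < q \<Longrightarrow> q < n \<Longrightarrow> ray_pr k (\<phi> 1) (lam p) = ray_pr k (\<phi> 1) (lam q) \<Longrightarrow>
      ray_pr k \<theta> (lam p) < ray_pr k \<theta> (lam q)"
proof -
  have lam: "\<And>p q. p < q \<Longrightarrow> q < n \<Longrightarrow> Re (lam p) > Re (lam q)" using decr by blast
  have pk: "pi / real k > 0" using k by simp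
  have pk2: "2 * (pi / real k) \<le> 2 * pi" using k by (simp add: field_simps)
  have ex: "\<exists>\<psi>. 0 < \<psi> \<and> \<psi> < pi / real k \<and> ray_pr k \<psi> (lam p) = ray_pr k \<psi> (lam q)"
    if pq: "p < q" "q < n" for p q
  proof -
    have half: "ray_pr k (pi / real k) z = - Re z" for z
      using ray_pr_shift[OF k, of 0 1 z] by (simp add: ray_pr_zero)
    obtain \<psi> where \<psi>: "0 < \<psi>" "\<psi> \<le> pi / real k" "ray_pr k \<psi> (lam p) = ray_pr k \<psi> (lam q)"
      by (rule ray_pr_crossing[of k 0 "lam q" "lam p" "pi / real k"])
        (use lam[OF pq] pk in \<open>auto simp: ray_pr_zero half\<close>)
    moreover from this have "\<psi> \<noteq> pi / real k" using lam[OF pq] half by auto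
    ultimately show ?thesis by auto
  qed
  have mem: "\<psi> \<in> separating_args n k lam"
    if "0 \<le> \<psi>" "\<psi> < 2 * pi" "p < q" "q < n" "ray_pr k \<psi> (lam p) = ray_pr k \<psi> (lam q)" for \<psi> p q
    unfolding separating_args_iff using that by (intro conjI exI[of _ p] exI[of _ q]) auto
  have "separating_args n k lam \<noteq> {}"
  proof -
    obtain \<psi> where "0 < \<psi>" "\<psi> < pi / real k" "ray_pr k \<psi> (lam 0) = ray_pr k \<psi> (lam 1)"
      using ex[of 0 1] n by auto
    then have "\<psi> \<in> separating_args n k lam"
      using pk pk2 n by (intro mem[of _ 0 1]) auto
    then show ?thesis by auto
  qed
  \<comment> \<open>The number of separating arguments is positive and even, hence at least 2, and
    \<phi> 2 is a genuine member of the enumeration.\<close>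
  then have "{1..2 * k * u} \<noteq> {}" using \<phi>(2) by (metis image_empty)
  then have "1 \<le> 2 * k * u" by (simp only: atLeastatMost_empty_iff not_not)
  moreover define N where "N = k * u"
  moreover have eq: "2 * k * u = 2 * N" by (simp add: N_def)
  ultimately have 12: "1 \<in> {1..2 * k * u}" "2 \<in> {1..2 * k * u}" unfolding eq by auto
  have gap: "\<psi> = \<phi> 1 \<or> \<phi> 2 \<le> \<psi>" if \<psi>: "\<psi> \<in> separating_args n k lam" for \<psi>
  proof -
    obtain i where i: "i \<in> {1..2 * k * u}" "\<psi> = \<phi> i" using \<psi> \<phi>(2) by (metis imageE)
    show ?thesis
    proof (cases "i = 1")
      case False
      then have "2 \<le> i" using i by auto
      then show ?thesis using strict_mono_onD[OF \<phi>(1) 12(2) i(1)] i(2) by (cases "i = 2") auto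
    qed (use i in auto)
  qed
  have m1: "\<phi> 1 \<in> separating_args n k lam" using 12 \<phi>(2) by blast
  have ne0: "ray_pr k 0 (lam p) \<noteq> ray_pr k 0 (lam q)" if "p < n" "q < n" "p \<noteq> q" for p q
    using lam[of p q] lam[of q p] that by (cases "p < q") (auto simp: ray_pr_zero)
  show pos: "0 < \<phi> 1"
    proof -
    obtain p q where "p < n" "q < n" "p \<noteq> q" "ray_pr k (\<phi> 1) (lam p) = ray_pr k (\<phi> 1) (lam q)"
      using m1 unfolding separating_args_iff by blast
    then have "\<phi> 1 \<noteq> 0" using ne0 by metis
    moreover have "0 \<le> \<phi> 1" using m1 unfolding separating_args_iff by blast
    ultimately show ?thesis by linarith
  qed
  show lt: "\<phi> 1 < pi / real k"
  proof -
    obtain \<psi> where \<psi>: "0 < \<psi>" "\<psi> < pi / real k" "ray_pr k \<psi> (lam 0) = ray_pr k \<psi> (lam 1)"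
      using ex[of 0 1] n by auto
    then have "\<psi> \<in> separating_args n k lam"
      using pk pk2 n by (intro mem[of _ 0 1]) auto
    then show ?thesis using gap[of \<psi>] \<theta> \<psi> by linarith
  qed
  \<comment> \<open>The argument \<open>\<phi> 1 + pi / k\<close> is again separating and, being
    below \<open>2 * pi / k\<close>, still in the range of the enumeration. It differs from \<phi>
    1, so it is at least \<phi> 2.\<close>
  show \<theta>u: "\<theta> < \<phi> 1 + pi / real k"
  proof -
    obtain p q where pq: "p < n" "q < n" "p \<noteq> q" "ray_pr k (\<phi> 1) (lam p) = ray_pr k (\<phi> 1) (lam q)"
      using m1 unfolding separating_args_iff by blast
    have "ray_pr k (\<phi> 1 + pi / real k) (lam p) = ray_pr k (\<phi> 1 + pi / real k) (lam q)"
      using ray_pr_shift[OF k, of "\<phi> 1" 1] pq(4) by simp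
    moreover have "0 \<le> \<phi> 1 + pi / real k" "\<phi> 1 + pi / real k < 2 * pi"
      using pos lt pk2 pk by linarith+
    ultimately have "\<phi> 1 + pi / real k \<in> separating_args n k lam"
      unfolding separating_args_iff using pq(1-3) by blast
    from gap[OF this] show ?thesis using \<theta> pk by linarith
  qed
  show *: "\<exists>\<psi>. \<theta> < \<psi> \<and> \<psi> < pi / real k \<and> ray_pr k \<psi> (lam p) = ray_pr k \<psi> (lam q)"
    if pq: "p < q" "q < n" "ray_pr k (\<phi> 1) (lam p) \<noteq> ray_pr k (\<phi> 1) (lam q)" for p q
  proof -
    obtain \<psi> where \<psi>: "0 < \<psi>" "\<psi> < pi / real k" "ray_pr k \<psi> (lam p) = ray_pr k \<psi> (lam q)"
      using ex[OF pq(1,2)] by blast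
    then have "\<psi> \<in> separating_args n k lam"
      using pk pk2 pq by (intro mem[of _ p q]) auto
    moreover have "\<psi> \<noteq> \<phi> 1" using \<psi>(3) pq(3) by blast
    ultimately have "\<theta> < \<psi>" using gap[of \<psi>] \<theta> by linarith
    then show ?thesis using \<psi> by blast
  qed
  show "ray_pr k \<theta> (lam p) > ray_pr k \<theta> (lam q)"
    if pq: "p < q" "q < n" "ray_pr k (\<phi> 1) (lam p) \<noteq> ray_pr k (\<phi> 1) (lam q)" for p q
  proof (rule ccontr)
    assume "\<not> ?thesis"
    then have le: "ray_pr k \<theta> (lam p) \<le> ray_pr k \<theta> (lam q)" by simp
    have gt: "ray_pr k 0 (lam q) < ray_pr k 0 (lam p)" using lam[OF pq(1,2)] by (simp add: ray_pr_zero)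
    have "0 \<le> \<theta>" using pos \<theta> by linarith
    from ray_pr_crossing[OF gt le this] obtain \<psi> where
      \<psi>: "0 < \<psi>" "\<psi> \<le> \<theta>" "ray_pr k \<psi> (lam p) = ray_pr k \<psi> (lam q)" .
    moreover have "\<psi> < 2 * pi" using \<psi>(2) \<theta>u lt pk2 by linarith
    ultimately have "\<psi> \<in> separating_args n k lam" using pq by (intro mem[of _ p q]) auto
    moreover have "\<psi> \<noteq> \<phi> 1" using \<psi>(3) pq(3) by blast
    ultimately show False using gap[of \<psi>] \<psi>(2) \<theta> by linarith
  qed
  show "ray_pr k \<theta> (lam p) < ray_pr k \<theta> (lam q)"
    if pq: "p < q" "q < n" "ray_pr k (\<phi> 1) (lam p) = ray_pr k (\<phi> 1) (lam q)" for p q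
  proof -
    \<comment> \<open>The sign of this coefficient is found at the argument 0, where the order of
      the two eigenvalues is known, and then used at \<theta>. Both arguments lie within
      \<open>pi / k\<close> of \<phi> 1, on opposite sides of it.\<close>
    define y where "y = Im ((lam p - lam q) * cis (- (real k * \<phi> 1)))"
    have near: "ray_pr k (\<phi> 1 + e) (lam p) - ray_pr k (\<phi> 1 + e) (lam q) = y * sin (real k * e)" for e
      using ray_pr_add_arg[of k "\<phi> 1" e "lam p - lam q"] pq(3) by (simp add: ray_pr_diff y_def)
    have "real k * \<phi> 1 < pi" using lt k by (simp add: field_simps)
    then have "sin (real k * \<phi> 1) > 0" using pos k by (intro sin_gt_zero) auto
    moreover have "y * sin (real k * - \<phi> 1) > 0"
      using near[of "- \<phi> 1"] lam[OF pq(1,2)] by (simp add: ray_pr_zero)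
    ultimately have y: "y < 0" by (simp add: mult_less_0_iff)
    have "real k * (\<theta> - \<phi> 1) < pi" using \<theta>u k by (simp add: field_simps)
    then have "sin (real k * (\<theta> - \<phi> 1)) > 0" using \<theta> k by (intro sin_gt_zero) auto
    then have "y * sin (real k * (\<theta> - \<phi> 1)) < 0" by (rule mult_neg_pos[OF y])
    then show ?thesis using near[of "\<theta> - \<phi> 1"] by simp
  qed
qed

section \<open>Block diagonal matrices\<close>

lemma diag_block_mat_carrier:
  assumes "list_all2 (\<lambda>A d. A \<in> carrier_mat d d) As ds"
  shows "diag_block_mat As \<in> carrier_mat (sum_list ds) (sum_list ds)"
  using assms by (induction rule: list_all2_induct) (auto simp: Let_def)

text \<open>Induction splits off the first block; \<open>bound\<close> ensures that the remaining
  positions are in the range of the remaining block diagonal matrix.\<close>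

lemma diag_block_mat_index:
  assumes "list_all2 (\<lambda>A d. A \<in> carrier_mat d d) As ds"
    and "i < length ds" "i' < length ds" "a < ds ! i" "b < ds ! i'"
  shows "diag_block_mat As $$ (sum_list (take i ds) + a, sum_list (take i' ds) + b) =
    (if i = i' then As ! i $$ (a, b) else 0)"
  using assms
proof (induction arbitrary: i i' rule: list_all2_induct)
  case Nil
  then show ?case by simp
next
  case (Cons A As d ds)
  note B = diag_block_mat_carrier[OF Cons(2)]
  have bound: "sum_list (take j ds) + c < sum_list ds" if "j < length ds" "c < ds ! j" for j c
  proof -
    have "sum_list ds = sum_list (take j ds) + sum_list (drop j ds)"
      by (metis append_take_drop_id sum_list_append)
    moreover have "drop j ds = ds ! j # drop (Suc j) ds" using that by (simp add: Cons_nth_drop_Suc)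
    ultimately show ?thesis using that by simp
  qed
  show ?case
  proof (cases i)
    case 0
    then show ?thesis using Cons(1,4-7) B bound by (cases i') (auto simp: Let_def)
  next
    case (Suc j)
    then show ?thesis using Cons(1,3-7) B bound
      by (cases i') (auto simp: Let_def add.assoc)
  qed
qed

lemma diag_block_mat_inverse:
  assumes "list_all2 (\<lambda>A d. A \<in> carrier_mat d d) As ds" "list_all2 (\<lambda>A d. A \<in> carrier_mat d d) Bs ds"
    and "\<And>i. i < length ds \<Longrightarrow> As ! i * Bs ! i = 1\<^sub>m (ds ! i)"
  shows "diag_block_mat As * diag_block_mat Bs = (1\<^sub>m (sum_list ds) :: 'a :: comm_ring_1 mat)"
  using assms
proof (induction arbitrary: Bs rule: list_all2_induct)
  case Nil
  show ?case using Nil by (intro eq_matI) auto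
next
  case (Cons A As d ds)
  obtain B Bs' where Bs: "Bs = B # Bs'" using Cons(4) by (cases Bs) auto
  have c: "list_all2 (\<lambda>A d. A \<in> carrier_mat d d) Bs' ds" "B \<in> carrier_mat d d"
    using Cons(4) Bs by auto
  have AB: "A * B = 1\<^sub>m d" using Cons(5)[of 0] Bs by simp
  have IH: "diag_block_mat As * diag_block_mat Bs' = 1\<^sub>m (sum_list ds)"
  proof (rule Cons(3)[OF c(1)])
    fix i assume "i < length ds"
    then show "As ! i * Bs' ! i = 1\<^sub>m (ds ! i)" using Cons(5)[of "Suc i"] Bs by simp
  qed
  note dA = diag_block_mat_carrier[OF Cons(2)]
  note dB = diag_block_mat_carrier[OF c(1)]
  let ?N = "sum_list ds"
  have "diag_block_mat (A # As) * diag_block_mat Bs =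
      four_block_mat A (0\<^sub>m d ?N) (0\<^sub>m ?N d) (diag_block_mat As) *
      four_block_mat B (0\<^sub>m d ?N) (0\<^sub>m ?N d) (diag_block_mat Bs')"
    using Cons(1) c(2) dA dB unfolding Bs by (simp add: Let_def)
  also have "\<dots> = four_block_mat (1\<^sub>m d) (0\<^sub>m d ?N) (0\<^sub>m ?N d) (1\<^sub>m ?N)"
    using Cons(1) c(2) dA dB AB IH by (subst mult_four_block_mat[of _ d d _ ?N _ ?N _ _ d _ ?N]) auto
  also have "\<dots> = 1\<^sub>m (d + ?N)" by simp
  finally show ?case by simp
qed

text \<open>A nonzero determinant makes the matrix a unit, which rules out the result
  \<open>None\<close>.\<close>

lemma the_mat_inverse:
  fixes M :: "complex mat"
  assumes M: "M \<in> carrier_mat d d" and det: "Determinant.det M \<noteq> 0"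
  shows "the (mat_inverse M) \<in> carrier_mat d d" "the (mat_inverse M) * M = 1\<^sub>m d"
proof -
  have "mat_inverse M \<noteq> None"
    using mat_inverse(1)[OF M, of "()"] det_non_zero_imp_unit[OF M det, of "()"] by auto
  then obtain B where "mat_inverse M = Some B" by auto
  with mat_inverse(2)[OF M this]
  show "the (mat_inverse M) \<in> carrier_mat d d" "the (mat_inverse M) * M = 1\<^sub>m d" by auto
qed

section \<open>Positions in a partition\<close>

definition block_start :: "nat list \<Rightarrow> nat \<Rightarrow> nat" where
  "block_start ms i = sum_list (take i ms)"

text \<open>Blocks of size 0 may occur; the least index passes over them, since an empty block ends
  where its predecessor ends.\<close>

definition block_of :: "nat list \<Rightarrow> nat \<Rightarrow> nat" where
  "block_of ms p = (LEAST i. p < block_start ms (Suc i))"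

lemma block_start_Suc: "i < length ms \<Longrightarrow> block_start ms (Suc i) = block_start ms i + ms ! i"
  by (simp add: block_start_def take_Suc_conv_app_nth)

lemma block_start_mono: "i \<le> j \<Longrightarrow> block_start ms i \<le> block_start ms j"
proof -
  assume "i \<le> j"
  then have "take j ms = take i ms @ take (j - i) (drop i ms)"
    by (metis le_add_diff_inverse take_add)
  then show ?thesis by (simp add: block_start_def)
qed

lemma block_of_bounds:
  assumes "p < sum_list ms"
  shows "block_of ms p < length ms" "block_start ms (block_of ms p) \<le> p"
    "p < block_start ms (Suc (block_of ms p))"
proof -
  have ne: "length ms \<noteq> 0" using assms by auto
  then have ex: "p < block_start ms (Suc (length ms - 1))" using assms by (simp add: block_start_def)
  show "p < block_start ms (Suc (block_of ms p))" unfolding block_of_def by (rule LeastI[where P = "\<lambda>i. p < block_start ms (Suc i)", OF ex])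
  have "block_of ms p \<le> length ms - 1" unfolding block_of_def by (rule Least_le[where P = "\<lambda>i. p < block_start ms (Suc i)", OF ex])
  then show "block_of ms p < length ms" using ne by linarith
  show "block_start ms (block_of ms p) \<le> p"
  proof (cases "block_of ms p")
    case (Suc i)
    then have "\<not> p < block_start ms (Suc i)"
      unfolding block_of_def by (metis lessI not_less_Least)
    then show ?thesis using Suc by simp
  qed (simp add: block_start_def)
qed

lemma block_of_eqI:
  assumes "block_start ms i \<le> p" "p < block_start ms (Suc i)"
  shows "block_of ms p = i"
  unfolding block_of_def
proof (rule Least_equality)
  show "p < block_start ms (Suc i)" by fact
  fix j assume "p < block_start ms (Suc j)"
  then show "i \<le> j" using assms(1) block_start_mono[of "Suc j" i ms] by (cases "i \<le> j") auto
qed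

lemma block_of_less:
  assumes "p < q" "q < sum_list ms"
  shows "block_of ms p \<le> block_of ms q"
proof -
  have "p < block_start ms (Suc (block_of ms q))" using block_of_bounds(3)[OF assms(2)] assms(1) by simp
  then show ?thesis unfolding block_of_def[of ms p] by (rule Least_le)
qed

text \<open>Only blocks at odd positions, those of the sizes r, count. An index in a block of size s
  is therefore not related even to itself, which matches the identity blocks in the formula.\<close>

definition same_block :: "nat list \<Rightarrow> nat \<Rightarrow> nat \<Rightarrow> bool" where
  "same_block ms p q \<longleftrightarrow> block_of ms p = block_of ms q \<and> odd (block_of ms p)"

text \<open>The permutation behind \<open>P_mat\<close>. The sum of an index and its reflection is
  the first plus the last index of the block; the last one is
  \<open>block_start ms (Suc i) - 1\<close>.\<close>

definition block_rev :: "nat list \<Rightarrow> nat \<Rightarrow> nat" where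
  "block_rev ms p = (let i = block_of ms p in
     if odd i then block_start ms i + block_start ms (Suc i) - 1 - p else p)"

lemma block_rev:
  assumes "p < sum_list ms"
  shows "block_of ms (block_rev ms p) = block_of ms p" "block_rev ms p < sum_list ms"
    "block_rev ms (block_rev ms p) = p"
proof -
  note b = block_of_bounds[OF assms]
  have le: "block_start ms (Suc (block_of ms p)) \<le> sum_list ms"
    using block_start_mono[of "Suc (block_of ms p)" "length ms" ms] b(1) by (simp add: block_start_def)
  show *: "block_of ms (block_rev ms p) = block_of ms p"
    by (rule block_of_eqI) (use b in \<open>auto simp: block_rev_def Let_def\<close>)
  show "block_rev ms p < sum_list ms" using b le assms by (auto simp: block_rev_def Let_def)
  show "block_rev ms (block_rev ms p) = p"
    using b by (auto simp: block_rev_def[of ms "block_rev ms p"] * Let_def) (auto simp: block_rev_def Let_def)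
qed

lemma block_rev_less:
  assumes "p < q" "q < sum_list ms"
  shows "same_block ms p q \<Longrightarrow> block_rev ms q < block_rev ms p"
    "\<not> same_block ms p q \<Longrightarrow> block_rev ms p < block_rev ms q"
proof -
  have p: "p < sum_list ms" using assms by simp
  note bp = block_of_bounds[OF p] and bq = block_of_bounds[OF assms(2)]
  show "same_block ms p q \<Longrightarrow> block_rev ms q < block_rev ms p"
    using bp bq assms(1) by (auto simp: same_block_def block_rev_def Let_def)
  assume *: "\<not> same_block ms p q"
  show "block_rev ms p < block_rev ms q"
  proof (cases "block_of ms p = block_of ms q")
    case True
    then show ?thesis using * assms(1) by (auto simp: same_block_def block_rev_def Let_def)
  next
    case False
    then have "Suc (block_of ms p) \<le> block_of ms q" using block_of_less[OF assms] by simp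
    then have "block_start ms (Suc (block_of ms p)) \<le> block_start ms (block_of ms q)"
      by (rule block_start_mono)
    moreover have "block_rev ms p < block_start ms (Suc (block_of ms p))"
      using block_of_bounds(3)[OF block_rev(2)[OF p]] block_rev(1)[OF p] by simp
    moreover have "block_start ms (block_of ms q) \<le> block_rev ms q"
      using block_of_bounds(2)[OF block_rev(2)[OF assms(2)]] block_rev(1)[OF assms(2)] by simp
    ultimately show ?thesis by simp
  qed
qed

lemma block_list:
  assumes "\<And>i. i < length ms \<Longrightarrow> odd i \<Longrightarrow> F i \<in> carrier_mat (ms ! i) (ms ! i)"
  shows "list_all2 (\<lambda>A d. A \<in> carrier_mat d d)
    (map (\<lambda>i. if even i then 1\<^sub>m (ms ! i) else F i) [0..<length ms]) ms"
  using assms by (auto simp: list_all2_conv_all_nth)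

lemma block_diag_carrier:
  assumes "\<And>i. i < length ms \<Longrightarrow> odd i \<Longrightarrow> F i \<in> carrier_mat (ms ! i) (ms ! i)"
  shows "block_diag ms F \<in> carrier_mat (sum_list ms) (sum_list ms)"
  unfolding block_diag_def by (rule diag_block_mat_carrier) (rule block_list, rule assms)

lemma block_diag_index:
  assumes F: "\<And>i. i < length ms \<Longrightarrow> odd i \<Longrightarrow> F i \<in> carrier_mat (ms ! i) (ms ! i)"
    and pq: "p < sum_list ms" "q < sum_list ms"
  shows "block_diag ms F $$ (p, q) =
    (if same_block ms p q
     then F (block_of ms p) $$ (p - block_start ms (block_of ms p), q - block_start ms (block_of ms p))
     else if p = q then 1 else 0)"
proof -
  let ?i = "block_of ms p" and ?j = "block_of ms q"
  note bp = block_of_bounds[OF pq(1)] and bq = block_of_bounds[OF pq(2)]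
  have "block_diag ms F $$
      (sum_list (take ?i ms) + (p - block_start ms ?i), sum_list (take ?j ms) + (q - block_start ms ?j)) =
      (if ?i = ?j then (map (\<lambda>i. if even i then 1\<^sub>m (ms ! i) else F i) [0..<length ms]) ! ?i $$
        (p - block_start ms ?i, q - block_start ms ?j) else 0)"
    unfolding block_diag_def
    by (rule diag_block_mat_index[OF block_list[OF F]]) (use bp bq block_start_Suc in auto)
  moreover have "sum_list (take ?i ms) + (p - block_start ms ?i) = p"
    "sum_list (take ?j ms) + (q - block_start ms ?j) = q"
    using bp bq by (auto simp: block_start_def)
  moreover have "p - block_start ms ?i < ms ! ?i" "q - block_start ms ?j < ms ! ?j"
    using bp bq block_start_Suc[OF bp(1)] block_start_Suc[OF bq(1)] by auto
  ultimately show ?thesis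
    using bp bq by (auto simp: same_block_def)
qed

text \<open>The right diagonal factor of the formula in terms of global indices, which suits
  comparisons of entries with transition matrices.\<close>

definition block_part :: "nat \<Rightarrow> nat list \<Rightarrow> complex mat \<Rightarrow> complex mat" where
  "block_part n ms M = Matrix.mat n n
     (\<lambda>(p, q). if same_block ms p q then M $$ (p, q) else if p = q then 1 else 0)"

lemma block_diag_block:
  assumes "sum_list ms = n"
  shows "block_diag ms (\<lambda>i. block ms M i i) = block_part n ms M"
proof (rule eq_matI)
  have c: "block ms M i i \<in> carrier_mat (ms ! i) (ms ! i)" for i by (simp add: block_def)
  note bc = block_diag_carrier[of ms "\<lambda>i. block ms M i i", OF c, unfolded assms]
  show "dim_row (block_diag ms (\<lambda>i. block ms M i i)) = dim_row (block_part n ms M)"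
    "dim_col (block_diag ms (\<lambda>i. block ms M i i)) = dim_col (block_part n ms M)"
    using bc by (auto simp: block_part_def)
  fix p q assume "p < dim_row (block_part n ms M)" "q < dim_col (block_part n ms M)"
  then have pq: "p < n" "q < n" by (auto simp: block_part_def)
  then have pq': "p < sum_list ms" "q < sum_list ms" using assms by auto
  note bp = block_of_bounds[OF pq'(1)] and bq = block_of_bounds[OF pq'(2)]
  show "block_diag ms (\<lambda>i. block ms M i i) $$ (p, q) = block_part n ms M $$ (p, q)"
    unfolding block_diag_index[of ms "\<lambda>i. block ms M i i", OF c pq']
    using pq bp bq block_start_Suc[OF bp(1)] block_start_Suc[OF bq(1)]
    by (auto simp: block_part_def block_def same_block_def block_start_def[symmetric])
qed

text \<open>This makes right multiplication by \<open>P_mat ms\<close> a rearrangement of columns,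
  to be matched with the permutation \<sigma> of the new starting ray.\<close>

lemma P_mat_index:
  assumes "p < sum_list ms" "q < sum_list ms"
  shows "P_mat ms $$ (p, q) = (if p = block_rev ms q then 1 else 0)"
proof -
  note bp = block_of_bounds[OF assms(1)] and bq = block_of_bounds[OF assms(2)]
  have c: "anti_id (ms ! i) \<in> carrier_mat (ms ! i) (ms ! i)" for i by (simp add: anti_id_def)
  show ?thesis
  proof (cases "same_block ms p q")
    case True
    then have eq: "block_of ms q = block_of ms p" and o: "odd (block_of ms p)" by (auto simp: same_block_def)
    have "P_mat ms $$ (p, q) = anti_id (ms ! block_of ms p) $$
        (p - block_start ms (block_of ms p), q - block_start ms (block_of ms p))"
      unfolding P_mat_def block_diag_index[of ms "\<lambda>i. anti_id (ms ! i)", OF c assms] using True by simp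
    then show ?thesis
      using bp bq eq o block_start_Suc[OF bp(1)] by (auto simp: anti_id_def block_rev_def Let_def)
  next
    case False
    have "P_mat ms $$ (p, q) = (if p = q then 1 else 0)"
      unfolding P_mat_def block_diag_index[of ms "\<lambda>i. anti_id (ms ! i)", OF c assms] using False by simp
    moreover have "p = block_rev ms q \<longleftrightarrow> p = q"
    proof (cases "odd (block_of ms q)")
      case True
      then have "p \<noteq> block_rev ms q" "p \<noteq> q"
        using False block_rev(1)[OF assms(2)] by (auto simp: same_block_def)
      then show ?thesis by simp
    qed (auto simp: block_rev_def Let_def)
    ultimately show ?thesis by simp
  qed
qed

lemma P_mat_carrier: "P_mat ms \<in> carrier_mat (sum_list ms) (sum_list ms)"
  unfolding P_mat_def by (rule block_diag_carrier) (simp add: anti_id_def)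

lemma P_mat_square: "P_mat ms * P_mat ms = 1\<^sub>m (sum_list ms)"
proof (rule eq_matI)
  fix p q assume "p < dim_row (1\<^sub>m (sum_list ms) :: complex mat)" "q < dim_col (1\<^sub>m (sum_list ms) :: complex mat)"
  then have pq: "p < sum_list ms" "q < sum_list ms" by auto
  have "(P_mat ms * P_mat ms) $$ (p, q) = (\<Sum>s<sum_list ms. P_mat ms $$ (p, s) * P_mat ms $$ (s, q))"
    by (rule mult_mat_index[OF P_mat_carrier P_mat_carrier pq])
  also have "\<dots> = (\<Sum>s<sum_list ms. if s = block_rev ms q then P_mat ms $$ (p, s) else 0)"
    by (intro sum.cong) (auto simp: P_mat_index pq)
  also have "\<dots> = P_mat ms $$ (p, block_rev ms q)"
    using block_rev(2)[OF pq(2)] by simp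
  also have "\<dots> = 1\<^sub>m (sum_list ms) $$ (p, q)"
    using pq by (simp add: P_mat_index block_rev)
  finally show "(P_mat ms * P_mat ms) $$ (p, q) = 1\<^sub>m (sum_list ms) $$ (p, q)" .
qed (use P_mat_carrier in auto)

lemma block_part_inverse:
  assumes n: "sum_list ms = n" and nz: "\<And>p. p < n \<Longrightarrow> M $$ (p, p) \<noteq> 0"
    and tri: "(\<forall>p<n. \<forall>q<n. p < q \<longrightarrow> M $$ (p, q) = 0) \<or> (\<forall>p<n. \<forall>q<n. q < p \<longrightarrow> M $$ (p, q) = 0)"
  shows "block_diag ms (\<lambda>i. the (mat_inverse (block ms M i i))) \<in> carrier_mat n n" (is ?c)
    "block_diag ms (\<lambda>i. the (mat_inverse (block ms M i i))) * block_part n ms M = 1\<^sub>m n" (is ?inv)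
proof -
  have c: "block ms M i i \<in> carrier_mat (ms ! i) (ms ! i)" for i by (simp add: block_def)
  have det: "Determinant.det (block ms M i i) \<noteq> 0" if i: "i < length ms" for i
  proof -
    have lt: "block_start ms i + a < n" if "a < ms ! i" for a
      using block_start_Suc[OF i] block_start_mono[of "Suc i" "length ms" ms] i n that
      by (simp add: block_start_def)
    have idx: "block ms M i i $$ (a, b) = M $$ (block_start ms i + a, block_start ms i + b)"
      if "a < ms ! i" "b < ms ! i" for a b
      using that by (simp add: block_def block_start_def)
    have "Determinant.det (block ms M i i) = prod_list (diag_mat (block ms M i i))"
      using tri
    proof
      assume "\<forall>p<n. \<forall>q<n. p < q \<longrightarrow> M $$ (p, q) = 0"
      then show ?thesis by (intro det_lower_triangular[OF _ c]) (auto simp: idx lt)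
    next
      assume "\<forall>p<n. \<forall>q<n. q < p \<longrightarrow> M $$ (p, q) = 0"
      then show ?thesis
        using carrier_matD[OF c[of i]]
        by (intro det_upper_triangular[OF _ c] upper_triangularI) (auto simp: idx lt)
    qed
    also have "\<dots> = (\<Prod>a = 0..<ms ! i. M $$ (block_start ms i + a, block_start ms i + a))"
      using carrier_matD[OF c[of i]] by (simp add: prod_list_diag_prod idx)
    also have "\<dots> \<noteq> 0" using lt nz by auto
    finally show ?thesis .
  qed
  note i = the_mat_inverse[OF c det]
  show ?c using block_diag_carrier[of ms "\<lambda>i. the (mat_inverse (block ms M i i))"] i(1) n by auto
  have "block_diag ms (\<lambda>i. the (mat_inverse (block ms M i i))) * block_diag ms (\<lambda>i. block ms M i i)
      = 1\<^sub>m (sum_list ms)"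
    unfolding block_diag_def
    by (rule diag_block_mat_inverse) (use i c in \<open>auto intro!: block_list simp: list_all2_conv_all_nth\<close>)
  then show ?inv unfolding block_diag_block[OF n] n .
qed

lemma block_part_carrier: "block_part n ms M \<in> carrier_mat n n"
  by (simp add: block_part_def)

section \<open>The order of the eigenvalues\<close>

text \<open>With eigenvalues numbered from 0, the offset \<open>t\<close> of the second index runs
  from 1 to the block size minus 1 exactly when both neighbours lie in the block.\<close>

lemma block_of_adjacent_iff:
  assumes op: "order_partition n m ms" and j: "j \<in> {1..<n}"
  shows "(\<exists>l\<in>{1..m}. \<exists>t\<in>{1..ms ! (2 * l - 1) - 1}. j = sum_list (take (2 * l - 1) ms) + t)
    \<longleftrightarrow> same_block ms (j - 1) j"
proof
  assume "\<exists>l\<in>{1..m}. \<exists>t\<in>{1..ms ! (2 * l - 1) - 1}. j = sum_list (take (2 * l - 1) ms) + t"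
  then obtain l t where l: "l \<in> {1..m}" and t: "t \<in> {1..ms ! (2 * l - 1) - 1}"
    and jt: "j = block_start ms (2 * l - 1) + t" by (auto simp: block_start_def)
  define i where "i = 2 * l - 1"
  have i: "i < length ms" "odd i" using l op by (auto simp: order_partition_def i_def)
  note t = t[folded i_def] and jt = jt[folded i_def]
  have "block_of ms (j - 1) = i" "block_of ms j = i"
    using t by (auto intro!: block_of_eqI simp: block_start_Suc[OF i(1)] jt)
  then show "same_block ms (j - 1) j" using i by (simp add: same_block_def)
next
  assume sb: "same_block ms (j - 1) j"
  define i where "i = block_of ms j"
  have n: "sum_list ms = n" "length ms = 2 * m + 1" using op by (auto simp: order_partition_def)
  have jn: "j < sum_list ms" "j - 1 < sum_list ms" using j n by auto
  note bj = block_of_bounds[OF jn(1), folded i_def] and bj' = block_of_bounds[OF jn(2)]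
  have i: "odd i" "block_of ms (j - 1) = i" using sb by (auto simp: same_block_def i_def)
  then obtain h where h: "i = 2 * h + 1" by (elim oddE)
  have "h < m" using bj(1) h n by simp
  then show "\<exists>l\<in>{1..m}. \<exists>t\<in>{1..ms ! (2 * l - 1) - 1}. j = sum_list (take (2 * l - 1) ms) + t"
    using bj bj' i h j block_start_Suc[OF bj(1)]
    by (intro bexI[of _ "Suc h"] bexI[of _ "j - block_start ms i"]) (auto simp: block_start_def[symmetric])
qed

lemma eigenvalue_order_antimono:
  assumes "eigenvalue_order n k lam \<phi> m ms" "p \<le> q" "q < n"
  shows "ray_pr k \<phi> (lam q) \<le> ray_pr k \<phi> (lam p)"
  using assms(2,3)
proof (induction q rule: dec_induct)
  case (step q)
  have "\<forall>j\<in>{1..<n}. ray_pr k \<phi> (lam (j - 1)) \<ge> ray_pr k \<phi> (lam j)"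
    using assms(1) unfolding eigenvalue_order_def by blast
  moreover have "Suc q \<in> {1..<n}" using step by simp
  ultimately have "ray_pr k \<phi> (lam (Suc q)) \<le> ray_pr k \<phi> (lam (Suc q - 1))" by blast
  then show ?case using step by simp
qed simp

text \<open>Projections and block numbers are both monotone in the index, so equality at the two
  ends is equivalent to equality at every intermediate step, where the definition applies.\<close>

lemma eigenvalue_order_eq_iff_less:
  assumes eo: "eigenvalue_order n k lam \<phi> m ms" and "p < q" "q < n"
  shows "ray_pr k \<phi> (lam p) = ray_pr k \<phi> (lam q) \<longleftrightarrow> same_block ms p q"
proof -
  have op: "order_partition n m ms" and n: "sum_list ms = n"
    using eo by (auto simp: eigenvalue_order_def order_partition_def)
  have adj: "ray_pr k \<phi> (lam (j - 1)) = ray_pr k \<phi> (lam j) \<longleftrightarrow> same_block ms (j - 1) j"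
    if "j \<in> {1..<n}" for j
    using eo that block_of_adjacent_iff[OF op that] unfolding eigenvalue_order_def by auto
  note anti = eigenvalue_order_antimono[OF eo]
  have "Suc p \<le> q" using assms(2) by simp
  then show ?thesis using assms(3)
  proof (induction q rule: dec_induct)
    case base
    then show ?case using adj[of "Suc p"] by simp
  next
    case (step q)
    have adjq: "ray_pr k \<phi> (lam q) = ray_pr k \<phi> (lam (Suc q)) \<longleftrightarrow> same_block ms q (Suc q)"
      using adj[of "Suc q"] step by simp
    have bl: "block_of ms p \<le> block_of ms q" "block_of ms q \<le> block_of ms (Suc q)"
      using block_of_less[of p q ms] block_of_less[of q "Suc q" ms] step n by auto
    have an: "ray_pr k \<phi> (lam q) \<le> ray_pr k \<phi> (lam p)" "ray_pr k \<phi> (lam (Suc q)) \<le> ray_pr k \<phi> (lam q)"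
      using anti[of p q] anti[of q "Suc q"] step by auto
    have IH: "ray_pr k \<phi> (lam p) = ray_pr k \<phi> (lam q) \<longleftrightarrow> same_block ms p q" using step by simp
    have "ray_pr k \<phi> (lam p) = ray_pr k \<phi> (lam (Suc q)) \<longleftrightarrow>
        ray_pr k \<phi> (lam p) = ray_pr k \<phi> (lam q) \<and> ray_pr k \<phi> (lam q) = ray_pr k \<phi> (lam (Suc q))"
      using an by auto
    also have "\<dots> \<longleftrightarrow> same_block ms p (Suc q)"
      unfolding IH adjq using bl by (auto simp: same_block_def)
    finally show ?case .
  qed
qed

lemma same_block_sym: "same_block ms p q \<longleftrightarrow> same_block ms q p"
  by (auto simp: same_block_def)

lemma eigenvalue_order_eq_iff:
  assumes "eigenvalue_order n k lam \<phi> m ms" "p \<noteq> q" "p < n" "q < n"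
  shows "ray_pr k \<phi> (lam p) = ray_pr k \<phi> (lam q) \<longleftrightarrow> same_block ms p q"
  using assms eigenvalue_order_eq_iff_less[OF assms(1), of p q] eigenvalue_order_eq_iff_less[OF assms(1), of q p]
    same_block_sym[of ms p q] by (cases "p < q") auto

text \<open>In a strictly decreasing arrangement the element at position \<open>l\<close> is
  exceeded by exactly \<open>l\<close> others. Its position is thus determined by the values
  alone.\<close>

lemma decreasing_arrangement_unique:
  fixes v :: "nat \<Rightarrow> real"
  assumes \<sigma>: "bij_betw \<sigma> {..<n} {..<n}" and \<rho>: "bij_betw \<rho> {..<n} {..<n}"
    and v\<sigma>: "\<And>p q. p < q \<Longrightarrow> q < n \<Longrightarrow> v (\<sigma> p) > v (\<sigma> q)"
    and v\<rho>: "\<And>p q. p < q \<Longrightarrow> q < n \<Longrightarrow> v (\<rho> p) > v (\<rho> q)"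
    and l: "l < n"
  shows "\<sigma> l = \<rho> l"
proof -
  define rank where "rank x = card {y \<in> {..<n}. v y > v x}" for x
  have rank: "rank (\<tau> l) = l"
    if \<tau>: "bij_betw \<tau> {..<n} {..<n}" and v: "\<And>p q. p < q \<Longrightarrow> q < n \<Longrightarrow> v (\<tau> p) > v (\<tau> q)" and l: "l < n" for \<tau> l
  proof -
    have "{y \<in> {..<n}. v y > v (\<tau> l)} = \<tau> ` {..<l}"
    proof (intro equalityI subsetI)
      fix y assume y: "y \<in> {y \<in> {..<n}. v y > v (\<tau> l)}"
      then obtain s where s: "s < n" "y = \<tau> s" using \<tau> unfolding bij_betw_def by auto
      have "s < l"
      proof (rule ccontr)
        assume "\<not> s < l"
        then show False using v[of l s] s y by (cases "s = l") auto
      qed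
      then show "y \<in> \<tau> ` {..<l}" using s by auto
    next
      fix y assume "y \<in> \<tau> ` {..<l}"
      then obtain s where s: "s < l" "y = \<tau> s" by auto
      moreover have "\<tau> s \<in> {..<n}" using \<tau> s l unfolding bij_betw_def by auto
      ultimately show "y \<in> {y \<in> {..<n}. v y > v (\<tau> l)}" using v[of s l] l by auto
    qed
    moreover have "inj_on \<tau> {..<l}" using \<tau> l unfolding bij_betw_def by (auto intro: inj_on_subset)
    ultimately show ?thesis by (simp add: rank_def card_image)
  qed
  have "\<rho> l \<in> {..<n}" using \<rho> l unfolding bij_betw_def by auto
  then obtain l' where l': "l' < n" "\<rho> l = \<sigma> l'" using \<sigma> unfolding bij_betw_def by (metis imageE lessThan_iff)
  have "l' = l" using rank[OF \<sigma> v\<sigma> l'(1)] rank[OF \<rho> v\<rho> l] l'(2) by simp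
  then show ?thesis using l'(2) by simp
qed

lemma bij_betw_block_rev: "sum_list ms = n \<Longrightarrow> bij_betw (block_rev ms) {..<n} {..<n}"
  by (rule bij_betwI[of _ _ _ "block_rev ms"]) (auto simp: block_rev)

section \<open>Factorization along the blocks\<close>

text \<open>Assumption \<open>thru\<close> confines the sum for an entry of \<open>G * T'\<close>
  inside a block to indices of that block, where \<open>T'\<close> is diagonal. Hence
  \<open>T\<close> agrees there with \<open>G\<close> up to a factor for each column; outside the
  blocks \<open>T\<close> is diagonal itself.\<close>

lemma block_factor:
  assumes c: "G \<in> carrier_mat n n" "T' \<in> carrier_mat n n" and T: "T = G * T'"
    and out: "\<And>p q. p < n \<Longrightarrow> q < n \<Longrightarrow> p \<noteq> q \<Longrightarrow> \<not> same_block ms p q \<Longrightarrow> T $$ (p, q) = 0"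
    and ins: "\<And>p q. p < n \<Longrightarrow> q < n \<Longrightarrow> p \<noteq> q \<Longrightarrow> same_block ms p q \<Longrightarrow> T' $$ (p, q) = 0"
    and thru: "\<And>p q s. p < n \<Longrightarrow> q < n \<Longrightarrow> s < n \<Longrightarrow> same_block ms p q \<Longrightarrow> \<not> same_block ms p s \<Longrightarrow>
      G $$ (p, s) * T' $$ (s, q) = 0"
    and nz: "\<And>p. p < n \<Longrightarrow> T $$ (p, p) \<noteq> 0" "\<And>p. p < n \<Longrightarrow> T' $$ (p, p) \<noteq> 0"
  shows "\<exists>\<delta>. (\<forall>p<n. \<delta> p \<noteq> 0) \<and> T * mat_diag n \<delta> = block_part n ms G"
proof (intro exI conjI allI impI)
  \<comment> \<open>Columns in the blocks are divided by the entry of \<open>T'\<close> to give the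
    entries of \<open>G\<close>, the others by the entry of \<open>T\<close> to give 1. The test
    \<open>same_block ms q q\<close> tells whether \<open>q\<close> lies in a block of size
    r.\<close>
  let ?\<delta> = "\<lambda>q. if same_block ms q q then 1 / T' $$ (q, q) else 1 / T $$ (q, q)"
  show "?\<delta> p \<noteq> 0" if "p < n" for p using nz[OF that] by simp
  have Tc: "T \<in> carrier_mat n n" unfolding T using c by (rule mult_carrier_mat)
  show "T * mat_diag n ?\<delta> = block_part n ms G"
  proof (rule eq_matI)
    fix p q assume "p < dim_row (block_part n ms G)" "q < dim_col (block_part n ms G)"
    then have pq: "p < n" "q < n" by (auto simp: block_part_def)
    have lhs: "(T * mat_diag n ?\<delta>) $$ (p, q) = T $$ (p, q) * ?\<delta> q"
      unfolding mat_diag_mult_right[OF Tc] using pq by simp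
    have "T $$ (p, q) * ?\<delta> q = block_part n ms G $$ (p, q)"
    proof (cases "same_block ms p q")
      case True
      then have qq: "same_block ms q q" by (auto simp: same_block_def)
      have "T $$ (p, q) = (\<Sum>s<n. G $$ (p, s) * T' $$ (s, q))"
        unfolding T by (rule mult_mat_index[OF c pq])
      also have "\<dots> = G $$ (p, q) * T' $$ (q, q) + (\<Sum>s\<in>{..<n} - {q}. G $$ (p, s) * T' $$ (s, q))"
        using pq by (intro sum.remove) auto
      also have "(\<Sum>s\<in>{..<n} - {q}. G $$ (p, s) * T' $$ (s, q)) = 0"
      proof (rule sum.neutral, rule ballI)
        fix s assume s: "s \<in> {..<n} - {q}"
        show "G $$ (p, s) * T' $$ (s, q) = 0"
        proof (cases "same_block ms p s")
          case ps: True
          then have "same_block ms s q" using True by (auto simp: same_block_def)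
          then show ?thesis using ins[of s q] s pq by auto
        qed (use thru pq s True in auto)
      qed
      finally show ?thesis using qq True pq nz(2) by (simp add: block_part_def)
    next
      case False
      then show ?thesis using pq nz(1) out[OF pq] by (auto simp: block_part_def)
    qed
    then show "(T * mat_diag n ?\<delta>) $$ (p, q) = block_part n ms G $$ (p, q)" unfolding lhs .
  qed (use Tc in \<open>auto simp: block_part_def mat_diag_def\<close>)
qed

section \<open>Cyclic numbering of the sectors\<close>

definition wrap :: "nat \<Rightarrow> nat \<Rightarrow> nat" where
  "wrap k j = (j - 1) mod (2 * k) + 1"

lemma wrap_mem: "k \<ge> 1 \<Longrightarrow> wrap k j \<in> {1..2 * k}"
  by (simp add: wrap_def Suc_le_eq)

lemma wrap_id: "j \<in> {1..2 * k} \<Longrightarrow> wrap k j = j"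
  by (auto simp: wrap_def)

lemma wrap_periodic:
  assumes "j \<ge> 1" shows "wrap k (j + 2 * k) = wrap k j"
proof -
  have "j + 2 * k - 1 = j - 1 + 2 * k" using assms by simp
  then show ?thesis by (simp only: wrap_def mod_add_self2)
qed

lemma cyc_suc_eq_wrap: "j \<in> {1..2 * k} \<Longrightarrow> cyc_suc k j = wrap k (j + 1)"
  by (auto simp: wrap_def cyc_suc_def)

lemma wrap_cyc_suc:
  assumes "j \<in> {1..2 * k}" shows "wrap k (cyc_suc k j + e) = wrap k (j + 1 + e)"
proof (cases "j = 2 * k")
  case True
  then show ?thesis using wrap_periodic[of "1 + e" k] by (simp add: cyc_suc_def add.commute)
qed (simp add: cyc_suc_def)

lemma wrap_induct:
  fixes j :: nat
  assumes "k \<ge> 1" "\<And>j. j \<in> {1..2 * k} \<Longrightarrow> P j" "\<And>j. j \<ge> 1 \<Longrightarrow> P j \<Longrightarrow> P (j + 2 * k)" "j \<ge> 1"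
  shows "P j"
  using assms(4)
proof (induction j rule: less_induct)
  case (less j)
  show ?case
  proof (cases "j \<le> 2 * k")
    case True
    then show ?thesis using assms(2) less.prems by simp
  next
    case False
    then have "P (j - 2 * k + 2 * k)" using assms(1) by (intro assms(3) less.IH) auto
    then show ?thesis using False by simp
  qed
qed

lemma sector_bounds_periodic:
  assumes "k \<ge> 1"
  shows "sector_left k \<eta> \<theta> (j + 2 * k) = sector_left k \<eta> \<theta> j + 2 * pi"
    "sector_right k \<eta> \<theta> (j + 2 * k) = sector_right k \<eta> \<theta> j + 2 * pi"
  using assms by (auto simp: sector_left_def sector_right_def field_simps)

lemma stokes_sector_periodic: "k \<ge> 1 \<Longrightarrow> stokes_sector k r \<eta> \<theta> (j + 2 * k) = stokes_sector k r \<eta> \<theta> j"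
  unfolding stokes_sector_def sector_bounds_periodic by (rule sector_periodic)

lemma sectorial_normalization_wrap:
  assumes k: "k \<ge> 1" and N: "sectorial_normalization n k A D Hhat r \<eta> \<theta> H" and j: "j \<ge> 1"
  shows "normalizing_on n k A D Hhat r (sector_left k \<eta> \<theta> j) (sector_right k \<eta> \<theta> j) (H (wrap k j))"
  using k _ _ j
proof (rule wrap_induct)
  fix j assume "j \<in> {1..2 * k}"
  then show "normalizing_on n k A D Hhat r (sector_left k \<eta> \<theta> j) (sector_right k \<eta> \<theta> j) (H (wrap k j))"
    using N unfolding sectorial_normalization_def by (simp only: wrap_id)
next
  fix j :: nat assume "j \<ge> 1"
    "normalizing_on n k A D Hhat r (sector_left k \<eta> \<theta> j) (sector_right k \<eta> \<theta> j) (H (wrap k j))"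
  then show "normalizing_on n k A D Hhat r (sector_left k \<eta> \<theta> (j + 2 * k)) (sector_right k \<eta> \<theta> (j + 2 * k))
      (H (wrap k (j + 2 * k)))"
    unfolding sector_bounds_periodic[OF k] by (simp only: wrap_periodic normalizing_on_periodic)
qed

lemma fundamental_on_wrap:
  assumes k: "k \<ge> 1" and W: "\<And>j. j \<in> {1..2 * k} \<Longrightarrow> fundamental_on n k D (stokes_sector k r \<eta> \<theta> j) (H j) (W j)"
    and j: "j \<ge> 1"
  shows "fundamental_on n k D (stokes_sector k r \<eta> \<theta> j) (H (wrap k j)) (W (wrap k j))"
  using k _ _ j
proof (rule wrap_induct)
  fix j assume "j \<in> {1..2 * k}"
  then show "fundamental_on n k D (stokes_sector k r \<eta> \<theta> j) (H (wrap k j)) (W (wrap k j))"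
    using W by (simp only: wrap_id)
next
  fix j :: nat assume "j \<ge> 1"
    "fundamental_on n k D (stokes_sector k r \<eta> \<theta> j) (H (wrap k j)) (W (wrap k j))"
  then show "fundamental_on n k D (stokes_sector k r \<eta> \<theta> (j + 2 * k)) (H (wrap k (j + 2 * k))) (W (wrap k (j + 2 * k)))"
    by (simp only: wrap_periodic stokes_sector_periodic[OF k])
qed

lemma overlap_periodic:
  assumes "k \<ge> 1"
  shows "sector r (a + real (j + 2 * k) * pi / real k + c) (b + real (j + 2 * k) * pi / real k + d) =
    sector r (a + real j * pi / real k + c) (b + real j * pi / real k + d)"
proof -
  have "a + real (j + 2 * k) * pi / real k + c = a + real j * pi / real k + c + 2 * pi" for a c
    using assms by (simp add: field_simps)
  then show ?thesis by (simp only: sector_periodic)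
qed

lemma stokes_matrices_wrap:
  assumes k: "k \<ge> 1" and C: "stokes_matrices n k r \<eta> 0 W C" and j: "j \<ge> 1"
    and x: "x \<in> sector r (real j * pi / real k - \<eta>) (real j * pi / real k + \<eta>)"
  shows "W (wrap k (j + 1)) x = W (wrap k j) x * C (wrap k j)"
proof -
  have "\<forall>x\<in>sector r (0 + real j * pi / real k + - \<eta>) (0 + real j * pi / real k + \<eta>).
      W (wrap k (j + 1)) x = W (wrap k j) x * C (wrap k j)"
    using k _ _ j
  proof (rule wrap_induct)
    fix j assume j: "j \<in> {1..2 * k}"
    then show "\<forall>x\<in>sector r (0 + real j * pi / real k + - \<eta>) (0 + real j * pi / real k + \<eta>).
        W (wrap k (j + 1)) x = W (wrap k j) x * C (wrap k j)"
      using C j unfolding stokes_matrices_def wrap_id[OF j] cyc_suc_eq_wrap[OF j, symmetric]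
      by (simp only: diff_conv_add_uminus) blast
  next
    fix j :: nat assume j: "j \<ge> 1" "\<forall>x\<in>sector r (0 + real j * pi / real k + - \<eta>) (0 + real j * pi / real k + \<eta>).
        W (wrap k (j + 1)) x = W (wrap k j) x * C (wrap k j)"
    have "wrap k (j + 2 * k + 1) = wrap k (j + 1)" using wrap_periodic[of "j + 1" k] by (simp add: add_ac)
    then show "\<forall>x\<in>sector r (0 + real (j + 2 * k) * pi / real k + - \<eta>) (0 + real (j + 2 * k) * pi / real k + \<eta>).
        W (wrap k (j + 2 * k + 1)) x = W (wrap k (j + 2 * k)) x * C (wrap k (j + 2 * k))"
      using j(2) unfolding overlap_periodic[OF k] by (simp only: wrap_periodic[OF j(1)])
  qed
  then show ?thesis using x by simp
qed

text \<open>Supplies branches on the rotated sectors from those given on the old ones: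
  \<open>x\<close> is turned back by \<theta> and the lost argument is added again.\<close>

lemma log_branch_rotate:
  assumes "log_branch L S"
  shows "log_branch (\<lambda>x. L (x / cis \<theta>) + \<i> * of_real \<theta>) ((\<lambda>x. cis \<theta> * x) ` S)"
  unfolding log_branch_def
proof
  have hol: "L holomorphic_on S" and ex: "\<And>x. x \<in> S \<Longrightarrow> exp (L x) = x"
    using assms by (auto simp: log_branch_def)
  have im: "(\<lambda>x. x / cis \<theta>) ` (\<lambda>x. cis \<theta> * x) ` S \<subseteq> S" by auto
  have "(L \<circ> (\<lambda>x. x / cis \<theta>)) holomorphic_on (\<lambda>x. cis \<theta> * x) ` S"
    by (rule holomorphic_on_compose_gen[OF _ hol]) (use im in \<open>auto intro!: holomorphic_intros\<close>)
  then show "(\<lambda>x. L (x / cis \<theta>) + \<i> * of_real \<theta>) holomorphic_on (\<lambda>x. cis \<theta> * x) ` S"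
    by (auto simp: o_def intro!: holomorphic_intros)
  show "\<forall>x\<in>(\<lambda>x. cis \<theta> * x) ` S. exp (L (x / cis \<theta>) + \<i> * of_real \<theta>) = x"
    using ex by (auto simp: exp_add cis_conv_exp)
qed

section \<open>Stokes matrices for the rotated starting ray\<close>

text \<open>The number \<open>e\<close> shifts the old sectors so that the old sectors
  \<open>j + e\<close> and \<open>j + e + 1\<close> both overlap the rotated sector
  \<open>j\<close>. \<open>Q j\<close> and \<open>X\<close> are the transitions from these two old
  solutions to the scaled new one. Where the rotated sectors \<open>j\<close> and
  \<open>j + 1\<close> meet, both new solutions are multiples of the old solution
  \<open>j + e + 1\<close>, by \<open>X\<close> and by \<open>Q (j + 1)\<close>.\<close>

lemma rotated_stokes_matrices:
  assumes k: "k \<ge> 1"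
    and \<theta>: "real e * pi / real k \<le> \<theta>" "\<theta> \<le> real (e + 1) * pi / real k"
    and Lt: "\<And>j. j \<in> {1..2 * k} \<Longrightarrow> log_branch (Lt j) (stokes_sector k r \<eta> \<theta> j)"
    and Ht: "\<And>j x. j \<in> {1..2 * k} \<Longrightarrow> x \<in> stokes_sector k r \<eta> \<theta> j \<Longrightarrow> Ht j x \<in> carrier_mat n n"
    and W: "\<And>j x. j \<ge> 1 \<Longrightarrow> x \<in> stokes_sector k r \<eta> 0 j \<Longrightarrow> W (wrap k j) x \<in> carrier_mat n n"
    and C: "\<And>j. j \<in> {1..2 * k} \<Longrightarrow> C j \<in> carrier_mat n n" "\<And>j. j \<in> {1..2 * k} \<Longrightarrow> invertible_mat (C j)"
    and \<sigma>: "\<sigma> permutes {..<n}"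
    and P: "P \<in> carrier_mat n n" "P * P = 1\<^sub>m n"
      "\<And>p l. p < n \<Longrightarrow> l < n \<Longrightarrow> P $$ (p, l) = (if p = \<sigma> l then 1 else 0)"
    and Q: "\<And>j. j \<in> {1..2 * k} \<Longrightarrow> Q j \<in> carrier_mat n n" "\<And>j. j \<in> {1..2 * k} \<Longrightarrow> Qi j \<in> carrier_mat n n"
      "\<And>j. j \<in> {1..2 * k} \<Longrightarrow> Qi j * Q j = 1\<^sub>m n"
    and step: "\<And>j. j \<in> {1..2 * k} \<Longrightarrow> \<exists>\<delta> X. (\<forall>p<n. \<delta> p \<noteq> 0) \<and> X \<in> carrier_mat n n \<and>
      C (wrap k (j + e)) * X = Q j \<and>
      (\<forall>x\<in>sector r (\<theta> + real j * pi / real k - pi / real k - \<eta>) (real (j + e) * pi / real k + \<eta>).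
        Ht j x * nf_sol n k D (Lt j) x * mat_diag n \<delta> = W (wrap k (j + e)) x * Q j) \<and>
      (\<forall>x\<in>sector r (real (j + e) * pi / real k - \<eta>) (\<theta> + real j * pi / real k + \<eta>).
        Ht j x * nf_sol n k D (Lt j) x * mat_diag n \<delta> = W (wrap k (j + e + 1)) x * X)"
  shows "\<exists>Wt. sectorial_solutions n k D r \<eta> \<theta> \<sigma> Ht Wt \<and>
    stokes_matrices n k r \<eta> \<theta> Wt (\<lambda>j. P * Qi j * C (wrap k (j + e)) * Q (cyc_suc k j) * P)"
proof -
  let ?R = "\<lambda>j \<delta> X. (\<forall>p<n. \<delta> p \<noteq> 0) \<and> X \<in> carrier_mat n n \<and> C (wrap k (j + e)) * X = Q j \<and>
      (\<forall>x\<in>sector r (\<theta> + real j * pi / real k - pi / real k - \<eta>) (real (j + e) * pi / real k + \<eta>).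
        Ht j x * nf_sol n k D (Lt j) x * mat_diag n \<delta> = W (wrap k (j + e)) x * Q j) \<and>
      (\<forall>x\<in>sector r (real (j + e) * pi / real k - \<eta>) (\<theta> + real j * pi / real k + \<eta>).
        Ht j x * nf_sol n k D (Lt j) x * mat_diag n \<delta> = W (wrap k (j + e + 1)) x * X)"
  \<comment> \<open>The scaling and the transition matrix are packed into one pair, so that a single
    choice yields both for all sectors.\<close>
  have "\<forall>j\<in>{1..2 * k}. \<exists>z. ?R j (fst z) (snd z)" using step by simp
  from bchoice[OF this] obtain f where f: "\<And>j. j \<in> {1..2 * k} \<Longrightarrow> ?R j (fst (f j)) (snd (f j))" by blast
  define \<delta> where "\<delta> j = fst (f j)" for j
  define X where "X j = snd (f j)" for j
  note f = f[folded \<delta>_def X_def]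
  have \<delta>: "\<And>j p. j \<in> {1..2 * k} \<Longrightarrow> p < n \<Longrightarrow> \<delta> j p \<noteq> 0"
    and X: "\<And>j. j \<in> {1..2 * k} \<Longrightarrow> X j \<in> carrier_mat n n"
      "\<And>j. j \<in> {1..2 * k} \<Longrightarrow> C (wrap k (j + e)) * X j = Q j"
    and s1: "\<And>j x. j \<in> {1..2 * k} \<Longrightarrow>
      x \<in> sector r (\<theta> + real j * pi / real k - pi / real k - \<eta>) (real (j + e) * pi / real k + \<eta>) \<Longrightarrow>
        Ht j x * nf_sol n k D (Lt j) x * mat_diag n (\<delta> j) = W (wrap k (j + e)) x * Q j"
    and s2: "\<And>j x. j \<in> {1..2 * k} \<Longrightarrow>
      x \<in> sector r (real (j + e) * pi / real k - \<eta>) (\<theta> + real j * pi / real k + \<eta>) \<Longrightarrow>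
        Ht j x * nf_sol n k D (Lt j) x * mat_diag n (\<delta> j) = W (wrap k (j + e + 1)) x * X j"
    using f by blast+
  define Y where "Y j x = Ht j x * nf_sol n k D (Lt j) x" for j x
  \<comment> \<open>The scaling is permuted along with the columns, so that the result is also the
    scaled solution multiplied by \<open>P\<close>.\<close>
  define Wt where "Wt j x = Matrix.mat n n (\<lambda>(i, l). Y j x $$ (i, \<sigma> l)) * mat_diag n (\<lambda>l. \<delta> j (\<sigma> l))" for j x
  have \<sigma>n: "\<sigma> l < n" if "l < n" for l using permutes_in_image[OF \<sigma>, of l] that by simp
  have Wt: "Wt j x = Y j x * mat_diag n (\<delta> j) * P" if Y: "Y j x \<in> carrier_mat n n" for j x
  proof (rule eq_matI)
    have YD: "Y j x * mat_diag n (\<delta> j) \<in> carrier_mat n n" using Y mat_diag_dim by (rule mult_carrier_mat)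
    fix i l assume "i < dim_row (Y j x * mat_diag n (\<delta> j) * P)" "l < dim_col (Y j x * mat_diag n (\<delta> j) * P)"
    then have il: "i < n" "l < n" using YD P(1) by auto
    have "(Y j x * mat_diag n (\<delta> j) * P) $$ (i, l)
        = (\<Sum>s<n. (Y j x * mat_diag n (\<delta> j)) $$ (i, s) * P $$ (s, l))"
      by (rule mult_mat_index[OF YD P(1) il])
    also have "\<dots> = (\<Sum>s<n. if s = \<sigma> l then (Y j x * mat_diag n (\<delta> j)) $$ (i, s) else 0)"
      by (intro sum.cong) (auto simp: P(3) il)
    also have "\<dots> = (Y j x * mat_diag n (\<delta> j)) $$ (i, \<sigma> l)" using \<sigma>n[OF il(2)] by simp
    also have "\<dots> = Y j x $$ (i, \<sigma> l) * \<delta> j (\<sigma> l)"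
      unfolding mat_diag_mult_right[OF Y] using il \<sigma>n by simp
    also have "\<dots> = Wt j x $$ (i, l)"
      unfolding Wt_def by (subst mat_diag_mult_right) (use il in auto)
    finally show "Wt j x $$ (i, l) = (Y j x * mat_diag n (\<delta> j) * P) $$ (i, l)" ..
  qed (use P(1) Y in \<open>auto simp: Wt_def mat_diag_def\<close>)
  have "sectorial_solutions n k D r \<eta> \<theta> \<sigma> Ht Wt"
    unfolding sectorial_solutions_def
  proof (intro ballI exI conjI)
    fix j assume j: "j \<in> {1..2 * k}"
    show "log_branch (Lt j) (stokes_sector k r \<eta> \<theta> j)" by (rule Lt[OF j])
    show "mat_diag n (\<lambda>l. \<delta> j (\<sigma> l)) \<in> carrier_mat n n" by simp
    show "diagonal_mat (mat_diag n (\<lambda>l. \<delta> j (\<sigma> l)))" by (rule diagonal_mat_diag)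
    show "invertible_mat (mat_diag n (\<lambda>l. \<delta> j (\<sigma> l)))" by (intro invertible_mat_diag \<delta> \<sigma>n j)
    fix x
    show "Wt j x = Matrix.mat n n (\<lambda>(i, l). (Ht j x * nf_sol n k D (Lt j) x) $$ (i, \<sigma> l)) *
        mat_diag n (\<lambda>l. \<delta> j (\<sigma> l))"
      by (simp only: Wt_def Y_def)
  qed
  moreover have "stokes_matrices n k r \<eta> \<theta> Wt (\<lambda>j. P * Qi j * C (wrap k (j + e)) * Q (cyc_suc k j) * P)"
    unfolding stokes_matrices_def
  proof (intro ballI conjI)
    fix j assume j: "j \<in> {1..2 * k}"
    define j' where "j' = cyc_suc k j"
    define G where "G = C (wrap k (j + e))"
    have j': "j' \<in> {1..2 * k}" using wrap_mem[OF k] cyc_suc_eq_wrap[OF j] by (simp add: j'_def)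
    have G: "G \<in> carrier_mat n n" "invertible_mat G" using C wrap_mem[OF k] by (auto simp: G_def)
    note car = P(1) Q(1)[OF j] Q(2)[OF j] Q(1)[OF j'] X(1)[OF j] G(1)
    note mc = mult_carrier_mat[of _ n n _ n]
    note as = assoc_mult_mat[of _ n n _ n _ n]
    have inv: "invertible_mat (Q j)" "invertible_mat (Qi j)" if "j \<in> {1..2 * k}" for j
      using invertible_matI[OF Q(1,2)[OF that]] invertible_matI[OF Q(2,1)[OF that]] Q(3)[OF that]
        mat_mult_left_right_inverse[OF Q(2,1)[OF that] Q(3)[OF that]] by auto
    have invP: "invertible_mat P" using invertible_matI[OF P(1,1,2,2)] .
    show "P * Qi j * C (wrap k (j + e)) * Q (cyc_suc k j) * P \<in> carrier_mat n n"
      unfolding G_def[symmetric] j'_def[symmetric] by (intro mc car)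
    show "invertible_mat (P * Qi j * C (wrap k (j + e)) * Q (cyc_suc k j) * P)"
      unfolding G_def[symmetric] j'_def[symmetric]
      by (intro invertible_mat_mult[of _ n] mc car invP inv j j' G)
    fix x assume x: "x \<in> sector r (\<theta> + real j * pi / real k - \<eta>) (\<theta> + real j * pi / real k + \<eta>)"
    define h where "h = pi / real k"
    have h: "h > 0" using k by (simp add: h_def)
    have \<theta>h: "real e * h \<le> \<theta>" "\<theta> \<le> (real e + 1) * h" using \<theta> by (auto simp: h_def add.commute[of 1])
    have frac: "real a * pi / real k = real a * h" for a by (simp add: h_def)
    have sl: "sector_left k \<eta> \<tau> i = \<tau> + real i * h - h - \<eta>" for \<tau> i
      by (simp add: sector_left_def h_def left_diff_distrib diff_divide_distrib)
    have sr: "sector_right k \<eta> \<tau> i = \<tau> + real i * h + \<eta>" for \<tau> i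
      by (simp add: sector_right_def h_def)
    have xj: "x \<in> stokes_sector k r \<eta> \<theta> j"
    proof -
      have "sector_left k \<eta> \<theta> j \<le> \<theta> + real j * pi / real k - \<eta>"
        using h by (simp add: sl frac)
      then show ?thesis
        using x sector_mono[OF _ order_refl] unfolding stokes_sector_def sector_right_def by blast
    qed
    \<comment> \<open>The bounds are kept affine in \<open>j + 1\<close>, so that at
      \<open>j = 2 * k\<close> a full turn can be split off and the sector number becomes 1.\<close>
    have "x \<in> sector r (\<theta> + real (j + 1) * pi / real k + (- h - \<eta>))
        (0 + real (j + 1) * pi / real k + (real e * h + \<eta>))"
      using x by (rule subsetD[OF sector_mono, rotated -1])
        (use \<theta>h h in \<open>unfold frac, auto simp: distrib_right\<close>)
    moreover have "sector r (\<theta> + real (j + 1) * pi / real k + (- h - \<eta>))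
        (0 + real (j + 1) * pi / real k + (real e * h + \<eta>)) =
      sector r (\<theta> + real j' * pi / real k + (- h - \<eta>))
        (0 + real j' * pi / real k + (real e * h + \<eta>))"
    proof (cases "j = 2 * k")
      case True
      then have "j + 1 = 1 + 2 * k" "j' = 1" by (auto simp: j'_def cyc_suc_def)
      then show ?thesis by (simp only: overlap_periodic[OF k])
    qed (simp add: j'_def cyc_suc_def)
    moreover have "\<theta> + real j' * pi / real k - pi / real k - \<eta> = \<theta> + real j' * pi / real k + (- h - \<eta>)"
      "real (j' + e) * pi / real k + \<eta> = 0 + real j' * pi / real k + (real e * h + \<eta>)"
      unfolding frac by (simp_all add: h_def distrib_right add_divide_distrib)
    ultimately have x1: "x \<in> sector r (\<theta> + real j' * pi / real k - pi / real k - \<eta>) (real (j' + e) * pi / real k + \<eta>)"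
      by (simp only:)
    have x2: "x \<in> sector r (real (j + e) * pi / real k - \<eta>) (\<theta> + real j * pi / real k + \<eta>)"
      using x by (rule subsetD[OF sector_mono, rotated -1])
        (use \<theta>h h in \<open>unfold frac, auto simp: distrib_right\<close>)
    have xj': "x \<in> stokes_sector k r \<eta> \<theta> j'"
    proof -
      have "x \<in> sector r (sector_left k \<eta> \<theta> (j + 1)) (sector_right k \<eta> \<theta> (j + 1))"
        using x by (rule subsetD[OF sector_mono, rotated -1])
          (use h in \<open>unfold frac sl sr, auto simp: distrib_right\<close>)
      then have "x \<in> stokes_sector k r \<eta> \<theta> (j + 1)" by (simp add: stokes_sector_def)
      moreover have "stokes_sector k r \<eta> \<theta> (j + 1) = stokes_sector k r \<eta> \<theta> j'"
      proof (cases "j = 2 * k")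
        case True
        then have "j + 1 = 1 + 2 * k" "j' = 1" by (auto simp: j'_def cyc_suc_def)
        then show ?thesis by (simp only: stokes_sector_periodic[OF k])
      qed (simp add: j'_def cyc_suc_def)
      ultimately show ?thesis by simp
    qed
    have Yc: "Y j x \<in> carrier_mat n n" "Y j' x \<in> carrier_mat n n"
      unfolding Y_def by (intro mc Ht nf_sol_carrier j j' xj xj')+
    define V where "V = W (wrap k (j + 1 + e)) x"
    have V: "V \<in> carrier_mat n n"
    proof -
      have "x \<in> stokes_sector k r \<eta> 0 (j + 1 + e)"
        unfolding stokes_sector_def
        using x by (rule subsetD[OF sector_mono, rotated -1])
          (use h \<theta>h in \<open>unfold frac sl sr, auto simp: distrib_right\<close>)
      then show ?thesis unfolding V_def by (intro W) auto
    qed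
    have wj': "wrap k (j' + e) = wrap k (j + 1 + e)" unfolding j'_def by (rule wrap_cyc_suc[OF j])
    have 1: "Wt j' x = V * Q j' * P"
      unfolding Wt[OF Yc(2)] unfolding Y_def s1[OF j' x1] wj' V_def ..
    have 2: "Wt j x = V * X j * P"
      unfolding Wt[OF Yc(1)] unfolding Y_def s2[OF j x2] V_def by (simp add: add_ac)
    \<comment> \<open>By \<open>G * X j = Q j\<close> this is a right inverse of \<open>G\<close>,
      hence a two-sided one. It is what turns the inverse of \<open>X j\<close> into
      \<open>Qi j * G\<close>.\<close>
    have GX: "G * (X j * Qi j) = 1\<^sub>m n"
    proof -
      have "G * (X j * Qi j) = G * X j * Qi j" by (rule as[symmetric]) (intro car)+
      also have "\<dots> = Q j * Qi j" using X(2)[OF j] by (simp add: G_def)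
      also have "\<dots> = 1\<^sub>m n" by (rule mat_mult_left_right_inverse[OF Q(2,1)[OF j] Q(3)[OF j]])
      finally show ?thesis .
    qed
    have XG: "X j * Qi j * G = 1\<^sub>m n"
      by (rule mat_mult_left_right_inverse[OF _ _ GX]) (intro mc car)+
    have "Wt j x * (P * Qi j * G * Q j' * P) = V * (X j * (P * (P * (Qi j * (G * (Q j' * P))))))"
      unfolding 2 by (simp add: as mc car V)
    also have "P * (P * (Qi j * (G * (Q j' * P)))) = P * P * (Qi j * (G * (Q j' * P)))"
      by (rule as[symmetric]) (intro mc car)+
    also have "\<dots> = Qi j * (G * (Q j' * P))"
      unfolding P(2) by (rule left_mult_one_mat[of _ n n]) (intro mc car)
    also have "X j * (Qi j * (G * (Q j' * P))) = X j * Qi j * G * (Q j' * P)"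
      by (simp add: as mc car)
    also have "\<dots> = Q j' * P" unfolding XG by (rule left_mult_one_mat[of _ n n]) (intro mc car)
    also have "V * (Q j' * P) = Wt j' x" unfolding 1 by (rule as[symmetric]) (intro V car)+
    finally show "Wt (cyc_suc k j) x = Wt j x * (P * Qi j * C (wrap k (j + e)) * Q (cyc_suc k j) * P)"
      by (simp only: G_def j'_def)
  qed
  ultimately show ?thesis by blast
qed

lemma stokes_matrices_cong:
  "stokes_matrices n k r \<eta> \<theta> W C \<Longrightarrow> (\<And>j. j \<in> {1..2 * k} \<Longrightarrow> C j = C' j) \<Longrightarrow> stokes_matrices n k r \<eta> \<theta> W C'"
  by (simp add: stokes_matrices_def)

text \<open>The normalizations \<open>Ht\<close> are given; the only freedom is the diagonal one
  inside \<open>sectorial_solutions\<close>. A single family \<open>Wt\<close> satisfying the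
  relation for every \<open>j\<close> expresses that the matrices can be chosen
  simultaneously.\<close>

theorem theorem2p7:
  fixes n k u m :: nat
    and A :: "complex \<Rightarrow> complex mat"
    and lam :: "nat \<Rightarrow> complex"
    and D :: "nat \<Rightarrow> complex mat"
    and Hhat :: "complex fps mat"
    and r \<eta> \<theta> :: real
    and \<phi> :: "nat \<Rightarrow> real"
    and \<sigma> :: "nat \<Rightarrow> nat"
    and ms :: "nat list"
    and H Ht W :: "nat \<Rightarrow> complex \<Rightarrow> complex mat"
    and C :: "nat \<Rightarrow> complex mat"
  assumes "k \<ge> 1" and "n \<ge> 2" and "r > 0" and "\<eta> > 0"
    and "\<forall>x\<in>ball 0 r. A x \<in> carrier_mat n n"
    and "\<forall>p<n. \<forall>q<n. (\<lambda>x. A x $$ (p, q)) holomorphic_on ball 0 r"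
    and "A 0 = mat_diag n lam"
    and "\<forall>p q. p < q \<and> q < n \<longrightarrow> Re (lam p) > Re (lam q)"
    and "formal_normal_form n k A D Hhat"
    and "good_sectors n k lam r \<eta> 0"
    and "sectorial_normalization n k A D Hhat r \<eta> 0 H"
    and "sectorial_solutions n k D r \<eta> 0 id H W"
    and "stokes_matrices n k r \<eta> 0 W C"
    and "strict_mono_on {1..2 * k * u} \<phi>"
    and "\<phi> ` {1..2 * k * u} = separating_args n k lam"
    and "\<phi> 1 < \<theta>" and "\<theta> < \<phi> 2"
    and "good_sectors n k lam r \<eta> \<theta>"
    and "\<sigma> permutes {..<n}"
    and "\<forall>p q. p < q \<and> q < n \<longrightarrow> ray_pr k \<theta> (lam (\<sigma> p)) > ray_pr k \<theta> (lam (\<sigma> q))"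
    and "sectorial_normalization n k A D Hhat r \<eta> \<theta> Ht"
    and "eigenvalue_order n k lam (\<phi> 1) m ms"
  shows "\<exists>Wt. sectorial_solutions n k D r \<eta> \<theta> \<sigma> Ht Wt \<and>
    stokes_matrices n k r \<eta> \<theta> Wt
      (\<lambda>j. P_mat ms * block_diag ms (\<lambda>i. the (mat_inverse (block ms (C j) i i))) * C j *
           block_diag ms (\<lambda>i. block ms (C (cyc_suc k j)) i i) * P_mat ms)"
proof -
  note k = assms(1) and n2 = assms(2) and r = assms(3) and \<eta> = assms(4) and A = assms(5)
    and A0 = assms(7) and lam = assms(8) and fnf = assms(9) and nH = assms(11) and sW = assms(12)
    and stC = assms(13) and \<theta> = assms(16,17) and \<sigma> = assms(19,20) and nHt = assms(21) and eo = assms(22)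
  have lam': "\<And>p q. p < q \<Longrightarrow> q < n \<Longrightarrow> Re (lam p) > Re (lam q)" using lam by blast
  note ang = first_separating_args[OF k n2 lam assms(14,15) \<theta>]
  have ms: "sum_list ms = n" using eo by (simp add: eigenvalue_order_def order_partition_def)
  have D0: "D 0 $$ (p, p) = lam p" if "p < n" for p
    using fnf A0 that unfolding formal_normal_form_def by (simp add: mat_diag_def)
  have A': "\<And>x. x \<in> ball 0 r \<Longrightarrow> A x \<in> carrier_mat n n" using A by blast
  have lam_ne: "lam p \<noteq> lam q" if "p < n" "q < n" "p \<noteq> q" for p q
    using lam'[of p q] lam'[of q p] that by (cases "p < q") auto
  have C: "\<And>j. j \<in> {1..2 * k} \<Longrightarrow> C j \<in> carrier_mat n n" "\<And>j. j \<in> {1..2 * k} \<Longrightarrow> invertible_mat (C j)"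
    using stC unfolding stokes_matrices_def by auto
  define h where "h = pi / real k"
  have h: "h > 0" using k by (simp add: h_def)
  have frac: "real a * pi / real k = real a * h" for a by (simp add: h_def)
  have sl: "sector_left k \<eta> \<tau> i = \<tau> + real i * h - h - \<eta>" for \<tau> i
    by (simp add: sector_left_def h_def left_diff_distrib diff_divide_distrib)
  have sr: "sector_right k \<eta> \<tau> i = \<tau> + real i * h + \<eta>" for \<tau> i
    by (simp add: sector_right_def h_def)
  have shift: "ray_pr k (\<psi> + real j * h) z = (- 1) ^ j * ray_pr k \<psi> z" for \<psi> j z
    using ray_pr_shift[OF k, of \<psi> j z] by (simp add: h_def)
  have ang': "0 < \<phi> 1" "\<phi> 1 < h" "\<theta> < \<phi> 1 + h" using ang(1-3) by (auto simp: h_def)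

  \<comment> \<open>Fundamental solutions on the old and the rotated sectors\<close>
  have "\<forall>j\<in>{1..2 * k}. \<exists>L. log_branch L (stokes_sector k r \<eta> 0 j)"
    using sW unfolding sectorial_solutions_def by blast
  from bchoice[OF this] obtain L where L: "\<forall>j\<in>{1..2 * k}. log_branch (L j) (stokes_sector k r \<eta> 0 j)" by blast
  define Lt where "Lt j x = L j (x / cis \<theta>) + \<i> * of_real \<theta>" for j x
  have Lt: "log_branch (Lt j) (stokes_sector k r \<eta> \<theta> j)" if "j \<in> {1..2 * k}" for j
    unfolding Lt_def[abs_def] stokes_sector_rotate[of k r \<eta> \<theta> j]
    by (rule log_branch_rotate) (use L that in blast)
  define Y where "Y j x = Ht j x * nf_sol n k D (Lt j) x" for j x
  have nHj: "normalizing_on n k A D Hhat r (sector_left k \<eta> 0 j) (sector_right k \<eta> 0 j) (H (wrap k j))"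
    if "j \<ge> 1" for j using sectorial_normalization_wrap[OF k nH that] .
  have fW: "fundamental_on n k D (stokes_sector k r \<eta> 0 j) (H (wrap k j)) (W (wrap k j))" if "j \<ge> 1" for j
  proof (rule fundamental_on_wrap[OF k _ that])
    fix j assume "j \<in> {1..2 * k}"
    then obtain L K where L: "log_branch L (stokes_sector k r \<eta> 0 j)"
      and K: "K \<in> carrier_mat n n" "diagonal_mat K" "invertible_mat K"
      and W: "\<forall>x\<in>stokes_sector k r \<eta> 0 j.
         W j x = Matrix.mat n n (\<lambda>(i, l). (H j x * nf_sol n k D L x) $$ (i, id l)) * K"
      using sW unfolding sectorial_solutions_def by blast
    have "W j x = H j x * nf_sol n k D L x * K" if x: "x \<in> stokes_sector k r \<eta> 0 j" for x
    proof -
      have "H j x \<in> carrier_mat n n"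
        using nHj[of j] \<open>j \<in> {1..2 * k}\<close> x unfolding normalizing_on_def stokes_sector_def
        by (simp add: wrap_id)
      then have "H j x * nf_sol n k D L x \<in> carrier_mat n n" using nf_sol_carrier by (rule mult_carrier_mat)
      then have "Matrix.mat n n (\<lambda>(i, l). (H j x * nf_sol n k D L x) $$ (i, id l)) = H j x * nf_sol n k D L x"
        unfolding id_def by (rule mat_of_entries)
      then show ?thesis using W x by simp
    qed
    then show "fundamental_on n k D (stokes_sector k r \<eta> 0 j) (H j) (W j)"
      unfolding fundamental_on_def using L K by blast
  qed
  have nHtj: "normalizing_on n k A D Hhat r (sector_left k \<eta> \<theta> j) (sector_right k \<eta> \<theta> j) (Ht j)"
    if "j \<in> {1..2 * k}" for j using nHt that unfolding sectorial_normalization_def by blast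
  have fY: "fundamental_on n k D (stokes_sector k r \<eta> \<theta> j) (Ht j) (Y j)" if j: "j \<in> {1..2 * k}" for j
    unfolding fundamental_on_def
  proof (intro exI conjI ballI)
    show "log_branch (Lt j) (stokes_sector k r \<eta> \<theta> j)" by (rule Lt[OF j])
    show "1\<^sub>m n \<in> carrier_mat n n" "diagonal_mat (1\<^sub>m n :: complex mat)" "invertible_mat (1\<^sub>m n :: complex mat)"
      by (auto simp: diagonal_mat_def intro: invertible_matI[of _ n "1\<^sub>m n"])
    fix x assume "x \<in> stokes_sector k r \<eta> \<theta> j"
    then have "Ht j x \<in> carrier_mat n n" using nHtj[OF j] unfolding normalizing_on_def stokes_sector_def by blast
    then have "Y j x \<in> carrier_mat n n" unfolding Y_def using nf_sol_carrier by (rule mult_carrier_mat)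
    then show "Y j x = Ht j x * nf_sol n k D (Lt j) x * 1\<^sub>m n"
      unfolding Y_def[symmetric] by (rule right_mult_one_mat[symmetric])
  qed

  \<comment> \<open>Triangularity of the given Stokes matrices\<close>
  have Cpat: "p < n \<Longrightarrow> C j $$ (p, p) \<noteq> 0"
    "p < n \<Longrightarrow> q < n \<Longrightarrow> ray_pr k (real j * h) (lam p) < ray_pr k (real j * h) (lam q) \<Longrightarrow> C j $$ (p, q) = 0"
    if j: "j \<in> {1..2 * k}" for j p q
  proof -
    have j1: "j \<ge> 1" using j by simp
    have sub: "sector r (real j * h - \<eta>) (real j * h + \<eta>) \<subseteq> stokes_sector k r \<eta> 0 i" if "i = j \<or> i = j + 1" for i
      unfolding stokes_sector_def using that h by (intro sector_mono) (auto simp: sl sr distrib_right)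
    have n1: "normalizing_on n k A D Hhat r (real j * h - \<eta>) (real j * h + \<eta>) (H (wrap k j))"
      by (rule normalizing_on_mono[OF nHj[OF j1]]) (use h in \<open>auto simp: sl sr\<close>)
    have n2: "normalizing_on n k A D Hhat r (real j * h - \<eta>) (real j * h + \<eta>) (H (wrap k (j + 1)))"
      by (rule normalizing_on_mono[OF nHj]) (use h in \<open>auto simp: sl sr distrib_right\<close>)
    have f1: "fundamental_on n k D (sector r (real j * h - \<eta>) (real j * h + \<eta>)) (H (wrap k j)) (W (wrap k j))"
      by (rule fundamental_on_mono[OF fW[OF j1] sub]) simp
    have f2: "fundamental_on n k D (sector r (real j * h - \<eta>) (real j * h + \<eta>)) (H (wrap k (j + 1))) (W (wrap k (j + 1)))"
      by (rule fundamental_on_mono[OF fW sub]) auto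
    have G: "C (wrap k j) \<in> carrier_mat n n" using C wrap_mem[OF k] by blast
    have rel: "\<And>x. x \<in> sector r (real j * h - \<eta>) (real j * h + \<eta>) \<Longrightarrow>
        W (wrap k (j + 1)) x = W (wrap k j) x * C (wrap k j)"
      using stokes_matrices_wrap[OF k stC j1] unfolding frac .
    have lt: "real j * h - \<eta> < real j * h + \<eta>" using \<eta> by simp
    note pat = stokes_multiplier_pattern[OF k r fnf n1 n2 A' f1 f2 lt G rel, unfolded wrap_id[OF j]]
    show "p < n \<Longrightarrow> C j $$ (p, p) \<noteq> 0" by (rule pat(1))
    show "p < n \<Longrightarrow> q < n \<Longrightarrow> ray_pr k (real j * h) (lam p) < ray_pr k (real j * h) (lam q) \<Longrightarrow> C j $$ (p, q) = 0"
      by (rule pat(2)[of _ _ "real j * h"]) (use \<eta> D0 in auto)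
  qed
  \<comment> \<open>This sign is the source of the alternation: the central ray of the overlap
    carries the original order for even \<open>j\<close> and the reversed one for odd
    \<open>j\<close>.\<close>
  have pr_jh: "ray_pr k (real j * h) z = (- 1) ^ j * Re z" for j z
    using shift[of 0 j z] by (simp add: ray_pr_zero)
  have Ctri: "(\<forall>p<n. \<forall>q<n. p < q \<longrightarrow> C j $$ (p, q) = 0) \<or> (\<forall>p<n. \<forall>q<n. q < p \<longrightarrow> C j $$ (p, q) = 0)"
    if j: "j \<in> {1..2 * k}" for j
  proof (cases "even j")
    case True
    then show ?thesis using Cpat(2)[OF j] lam' by (intro disjI2) (simp add: pr_jh)
  next
    case False
    then show ?thesis using Cpat(2)[OF j] lam' by (intro disjI1) (simp add: pr_jh)
  qed

  \<comment> \<open>Order of the eigenvalues on the new starting ray\<close>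
  have \<sigma>rev: "\<sigma> l = block_rev ms l" if "l < n" for l
  proof (rule decreasing_arrangement_unique[where v = "\<lambda>p. ray_pr k \<theta> (lam p)", OF _ bij_betw_block_rev[OF ms] _ _ that])
    show "bij_betw \<sigma> {..<n} {..<n}" using \<sigma>(1) by (rule permutes_imp_bij)
    show "ray_pr k \<theta> (lam (\<sigma> q)) < ray_pr k \<theta> (lam (\<sigma> p))" if "p < q" "q < n" for p q
      using \<sigma>(2) that by blast
    \<comment> \<open>Between the starting rays exactly the pairs within a block are interchanged,
      and \<open>block_rev\<close> inverts exactly these pairs.\<close>
    show "ray_pr k \<theta> (lam (block_rev ms q)) < ray_pr k \<theta> (lam (block_rev ms p))" if pq: "p < q" "q < n" for p q
    proof -
      have b: "p < sum_list ms" "q < sum_list ms" using pq ms by auto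
      note bp = block_rev[OF b(1)] and bq = block_rev[OF b(2)]
      have sb: "same_block ms (block_rev ms p) (block_rev ms q) \<longleftrightarrow> same_block ms p q"
        by (simp add: same_block_def bp bq)
      show ?thesis
      proof (cases "same_block ms p q")
        case True
        note lt = block_rev_less(1)[OF pq(1) b(2) True]
        have "ray_pr k (\<phi> 1) (lam (block_rev ms q)) = ray_pr k (\<phi> 1) (lam (block_rev ms p))"
          using eigenvalue_order_eq_iff_less[OF eo lt] bp(2) ms sb True
            same_block_sym[of ms "block_rev ms p" "block_rev ms q"] by simp
        then show ?thesis using ang(6)[OF lt] bp(2) ms by simp
      next
        case False
        note lt = block_rev_less(2)[OF pq(1) b(2) False]
        have "ray_pr k (\<phi> 1) (lam (block_rev ms p)) \<noteq> ray_pr k (\<phi> 1) (lam (block_rev ms q))"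
          using eigenvalue_order_eq_iff_less[OF eo lt] bq(2) ms sb False by simp
        then show ?thesis using ang(5)[OF lt] bq(2) ms by simp
      qed
    qed
  qed
  have P: "P_mat ms \<in> carrier_mat n n" "P_mat ms * P_mat ms = 1\<^sub>m n"
    "\<And>p l. p < n \<Longrightarrow> l < n \<Longrightarrow> P_mat ms $$ (p, l) = (if p = \<sigma> l then 1 else 0)"
    using P_mat_carrier[of ms] P_mat_square[of ms] P_mat_index[of _ ms] \<sigma>rev ms by auto
  have Htc: "Ht j x \<in> carrier_mat n n" if "j \<in> {1..2 * k}" "x \<in> stokes_sector k r \<eta> \<theta> j" for j x
    using nHtj[OF that(1)] that(2) unfolding normalizing_on_def stokes_sector_def by blast
  have Wc: "W (wrap k j) x \<in> carrier_mat n n" if "j \<ge> 1" "x \<in> stokes_sector k r \<eta> 0 j" for j x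
    using fundamental_on_invertible(1)[OF fW[OF that(1), unfolded stokes_sector_def] nHj[OF that(1)]] that(2)
    by (simp add: stokes_sector_def)

  \<comment> \<open>Transitions from two neighbouring old solutions to a rotated one\<close>
  have trans: "\<exists>T T'. T \<in> carrier_mat n n \<and> T' \<in> carrier_mat n n \<and> T = C (wrap k (j + e)) * T' \<and>
      (\<forall>\<delta>. C (wrap k (j + e)) * (T' * mat_diag n \<delta>) = T * mat_diag n \<delta> \<and>
        (\<forall>x\<in>sector r (\<theta> + real j * pi / real k - pi / real k - \<eta>) (real (j + e) * pi / real k + \<eta>).
          Ht j x * nf_sol n k D (Lt j) x * mat_diag n \<delta> = W (wrap k (j + e)) x * (T * mat_diag n \<delta>)) \<and>
        (\<forall>x\<in>sector r (real (j + e) * pi / real k - \<eta>) (\<theta> + real j * pi / real k + \<eta>).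
          Ht j x * nf_sol n k D (Lt j) x * mat_diag n \<delta> = W (wrap k (j + e + 1)) x * (T' * mat_diag n \<delta>))) \<and>
      (\<forall>p<n. T $$ (p, p) \<noteq> 0 \<and> T' $$ (p, p) \<noteq> 0) \<and>
      (\<forall>p<n. \<forall>q<n. \<forall>\<psi>. \<theta> + real j * h - h - \<eta> < \<psi> \<and> \<psi> < real (j + e) * h + \<eta> \<and>
         ray_pr k \<psi> (lam p) < ray_pr k \<psi> (lam q) \<longrightarrow> T $$ (p, q) = 0) \<and>
      (\<forall>p<n. \<forall>q<n. \<forall>\<psi>. real (j + e) * h - \<eta> < \<psi> \<and> \<psi> < \<theta> + real j * h + \<eta> \<and>
         ray_pr k \<psi> (lam p) < ray_pr k \<psi> (lam q) \<longrightarrow> T' $$ (p, q) = 0)"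
    if j: "j \<in> {1..2 * k}" and e: "real e * h \<le> \<theta>" "\<theta> \<le> real (e + 1) * h" for j e
  proof -
    define \<alpha> where "\<alpha> = real (j + e) * h"
    define \<beta> where "\<beta> = \<theta> + real j * h"
    have je: "j + e \<ge> 1" "j + e + 1 \<ge> 1" using j by auto
    \<comment> \<open>The bounds on \<theta> in terms of \<open>e\<close> say precisely that the
      rotated sector ends between the ends of the old sectors \<open>j + e\<close> and
      \<open>j + e + 1\<close>.\<close>
    have \<beta>: "\<alpha> \<le> \<beta>" "\<beta> \<le> \<alpha> + pi / real k"
      using e unfolding h_def[symmetric] by (auto simp: \<alpha>_def \<beta>_def distrib_right)
    have b: "sector_left k \<eta> 0 (j + e) = \<alpha> - pi / real k - \<eta>" "sector_right k \<eta> 0 (j + e) = \<alpha> + \<eta>"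
      "sector_left k \<eta> 0 (j + e + 1) = \<alpha> - \<eta>" "sector_right k \<eta> 0 (j + e + 1) = \<alpha> + pi / real k + \<eta>"
      "sector_left k \<eta> \<theta> j = \<beta> - pi / real k - \<eta>" "sector_right k \<eta> \<theta> j = \<beta> + \<eta>"
      unfolding sl sr h_def[symmetric] \<alpha>_def \<beta>_def by (auto simp: distrib_right)
    have G: "C (wrap k (j + e)) \<in> carrier_mat n n" using C wrap_mem[OF k] by blast
    have rel: "\<And>x. x \<in> sector r (\<alpha> - \<eta>) (\<alpha> + \<eta>) \<Longrightarrow>
        W (wrap k (j + e + 1)) x = W (wrap k (j + e)) x * C (wrap k (j + e))"
      using stokes_matrices_wrap[OF k stC je(1)] unfolding frac \<alpha>_def .
    obtain T T' where T: "T \<in> carrier_mat n n" "T' \<in> carrier_mat n n" "T = C (wrap k (j + e)) * T'"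
      "\<And>x. x \<in> sector r (\<beta> - pi / real k - \<eta>) (\<alpha> + \<eta>) \<Longrightarrow> Y j x = W (wrap k (j + e)) x * T"
      "\<And>x. x \<in> sector r (\<alpha> - \<eta>) (\<beta> + \<eta>) \<Longrightarrow> Y j x = W (wrap k (j + e + 1)) x * T'"
      "\<And>p. p < n \<Longrightarrow> T $$ (p, p) \<noteq> 0" "\<And>p. p < n \<Longrightarrow> T' $$ (p, p) \<noteq> 0"
      "\<And>p q \<psi>. p < n \<Longrightarrow> q < n \<Longrightarrow> \<beta> - pi / real k - \<eta> < \<psi> \<Longrightarrow> \<psi> < \<alpha> + \<eta> \<Longrightarrow>
         ray_pr k \<psi> (D 0 $$ (p, p)) < ray_pr k \<psi> (D 0 $$ (q, q)) \<Longrightarrow> T $$ (p, q) = 0"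
      "\<And>p q \<psi>. p < n \<Longrightarrow> q < n \<Longrightarrow> \<alpha> - \<eta> < \<psi> \<Longrightarrow> \<psi> < \<beta> + \<eta> \<Longrightarrow>
         ray_pr k \<psi> (D 0 $$ (p, p)) < ray_pr k \<psi> (D 0 $$ (q, q)) \<Longrightarrow> T' $$ (p, q) = 0"
      using rotated_transitions[OF k r \<eta> fnf A' \<beta>
          nHj[OF je(1), unfolded b] fW[OF je(1), unfolded stokes_sector_def b]
          nHj[OF je(2), unfolded b] fW[OF je(2), unfolded stokes_sector_def b]
          nHtj[OF j, unfolded b] fY[OF j, unfolded stokes_sector_def b] G rel] by blast
    have ang_eq: "real (j + e) * pi / real k = \<alpha>" "\<theta> + real j * pi / real k = \<beta>"
      "\<theta> + real j * h = \<beta>" "real (j + e) * h = \<alpha>"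
      by (simp_all add: \<alpha>_def \<beta>_def h_def)
    \<comment> \<open>The scaling stays arbitrary at this point; the two cases for \<theta> select
      it differently.\<close>
    have fac: "C (wrap k (j + e)) * (T' * mat_diag n \<delta>) = T * mat_diag n \<delta>" for \<delta>
      unfolding T(3) by (rule assoc_mult_mat[OF G T(2) mat_diag_dim, symmetric])
    have rel1: "Ht j x * nf_sol n k D (Lt j) x * mat_diag n \<delta> = W (wrap k (j + e)) x * (T * mat_diag n \<delta>)"
      if x: "x \<in> sector r (\<beta> - pi / real k - \<eta>) (\<alpha> + \<eta>)" for x \<delta>
    proof -
      have "x \<in> stokes_sector k r \<eta> 0 (j + e)"
        unfolding stokes_sector_def b using x by (rule subsetD[OF sector_mono, rotated -1]) (use \<beta> in auto)
      then have "W (wrap k (j + e)) x \<in> carrier_mat n n" by (rule Wc[OF je(1)])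
      then show ?thesis
        unfolding Y_def[symmetric] T(4)[OF x] by (rule assoc_mult_mat[OF _ T(1) mat_diag_dim])
    qed
    have rel2: "Ht j x * nf_sol n k D (Lt j) x * mat_diag n \<delta> = W (wrap k (j + e + 1)) x * (T' * mat_diag n \<delta>)"
      if x: "x \<in> sector r (\<alpha> - \<eta>) (\<beta> + \<eta>)" for x \<delta>
    proof -
      have "x \<in> stokes_sector k r \<eta> 0 (j + e + 1)"
        unfolding stokes_sector_def b using x by (rule subsetD[OF sector_mono, rotated -1]) (use \<beta> in auto)
      then have "W (wrap k (j + e + 1)) x \<in> carrier_mat n n" by (rule Wc[OF je(2)])
      then show ?thesis
        unfolding Y_def[symmetric] T(5)[OF x] by (rule assoc_mult_mat[OF _ T(2) mat_diag_dim])
    qed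
    have pat1: "\<forall>p<n. \<forall>q<n. \<forall>\<psi>. \<beta> - h - \<eta> < \<psi> \<and> \<psi> < \<alpha> + \<eta> \<and>
         ray_pr k \<psi> (lam p) < ray_pr k \<psi> (lam q) \<longrightarrow> T $$ (p, q) = 0"
      using T(8) D0 unfolding h_def by auto
    have pat2: "\<forall>p<n. \<forall>q<n. \<forall>\<psi>. \<alpha> - \<eta> < \<psi> \<and> \<psi> < \<beta> + \<eta> \<and>
         ray_pr k \<psi> (lam p) < ray_pr k \<psi> (lam q) \<longrightarrow> T' $$ (p, q) = 0"
      using T(9) D0 by auto
    show ?thesis
      unfolding ang_eq using T(1-3,6,7) fac rel1 rel2 pat1 pat2
      by (intro exI[of _ T] exI[of _ T'] conjI) blast+
  qed

  \<comment> \<open>Separating rays of a pair recur with period \<open>h\<close>, so a meeting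
    argument near the starting ray provides one in the sector with any number.\<close>
  have vanish: "\<exists>\<psi>'. a < \<psi>' \<and> \<psi>' < b \<and> ray_pr k \<psi>' (lam p) < ray_pr k \<psi>' (lam q)"
    if "p < n" "q < n" "p \<noteq> q" "ray_pr k \<psi> (lam p) = ray_pr k \<psi> (lam q)"
      "a < \<psi> + real i * h" "\<psi> + real i * h < b" for a b \<psi> p q i
    using ray_pr_eq_imp_less_near[OF k lam_ne[OF that(1-3)] _ that(5,6)] that(4) by (metis shift)
  have same: "same_block ms p q \<longleftrightarrow> ray_pr k (\<phi> 1) (lam p) = ray_pr k (\<phi> 1) (lam q)"
    if "p < n" "q < n" "p \<noteq> q" for p q
    using eigenvalue_order_eq_iff[OF eo that(3,1,2)] ..
  have cross: "\<exists>\<psi>. \<theta> < \<psi> \<and> \<psi> < h \<and> ray_pr k \<psi> (lam p) = ray_pr k \<psi> (lam q)"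
    if "p < n" "q < n" "p \<noteq> q" "\<not> same_block ms p q" for p q
    using ang(4)[of p q] ang(4)[of q p] same[OF that(1-3)] that unfolding h_def
    by (cases "p < q") (auto simp: eq_commute)

  \<comment> \<open>The formula in the two cases for \<theta>\<close>
  define Cinv where "Cinv j = block_diag ms (\<lambda>i. the (mat_inverse (block ms (C j) i i)))" for j
  have Cinv: "Cinv j \<in> carrier_mat n n" "Cinv j * block_part n ms (C j) = 1\<^sub>m n" if j: "j \<in> {1..2 * k}" for j
    unfolding Cinv_def using block_part_inverse[OF ms Cpat(1)[OF j] Ctri[OF j]] by blast+
  have goal: "\<exists>Wt. sectorial_solutions n k D r \<eta> \<theta> \<sigma> Ht Wt \<and>
      stokes_matrices n k r \<eta> \<theta> Wt
        (\<lambda>j. P_mat ms * Cinv j * C j * block_part n ms (C (cyc_suc k j)) * P_mat ms)"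
  proof (cases "\<theta> < h")
    case True
    have "\<exists>Wt. sectorial_solutions n k D r \<eta> \<theta> \<sigma> Ht Wt \<and> stokes_matrices n k r \<eta> \<theta> Wt
        (\<lambda>j. P_mat ms * Cinv j * C (wrap k (j + 0)) * block_part n ms (C (cyc_suc k j)) * P_mat ms)"
    proof (rule rotated_stokes_matrices[where e = 0 and Lt = Lt and W = W and Qi = Cinv
          and Q = "\<lambda>j. block_part n ms (C j)"])
      show "real 0 * pi / real k \<le> \<theta>" "\<theta> \<le> real (0 + 1) * pi / real k"
        using True \<theta>(1) ang'(1) by (auto simp: h_def)
      fix j assume j: "j \<in> {1..2 * k}"
      have e: "real 0 * h \<le> \<theta>" "\<theta> \<le> real (0 + 1) * h" using True \<theta>(1) ang'(1) by auto
      from trans[OF j e, unfolded add_0_right wrap_id[OF j]] obtain T T' where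
        T: "T \<in> carrier_mat n n" "T' \<in> carrier_mat n n" "T = C j * T'"
        and rel: "\<forall>\<delta>. C j * (T' * mat_diag n \<delta>) = T * mat_diag n \<delta> \<and>
        (\<forall>x\<in>sector r (\<theta> + real j * pi / real k - pi / real k - \<eta>) (real j * pi / real k + \<eta>).
          Ht j x * nf_sol n k D (Lt j) x * mat_diag n \<delta> = W j x * (T * mat_diag n \<delta>)) \<and>
        (\<forall>x\<in>sector r (real j * pi / real k - \<eta>) (\<theta> + real j * pi / real k + \<eta>).
          Ht j x * nf_sol n k D (Lt j) x * mat_diag n \<delta> = W (wrap k (j + 1)) x * (T' * mat_diag n \<delta>))"
        and nzs: "\<forall>p<n. T $$ (p, p) \<noteq> 0 \<and> T' $$ (p, p) \<noteq> 0"
        and z: "\<forall>p<n. \<forall>q<n. \<forall>\<psi>. \<theta> + real j * h - h - \<eta> < \<psi> \<and> \<psi> < real j * h + \<eta> \<and>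
          ray_pr k \<psi> (lam p) < ray_pr k \<psi> (lam q) \<longrightarrow> T $$ (p, q) = 0"
        and z': "\<forall>p<n. \<forall>q<n. \<forall>\<psi>. real j * h - \<eta> < \<psi> \<and> \<psi> < \<theta> + real j * h + \<eta> \<and>
          ray_pr k \<psi> (lam p) < ray_pr k \<psi> (lam q) \<longrightarrow> T' $$ (p, q) = 0"
        by (elim exE conjE) (rule that)
      have nz: "\<And>p. p < n \<Longrightarrow> T $$ (p, p) \<noteq> 0" "\<And>p. p < n \<Longrightarrow> T' $$ (p, p) \<noteq> 0"
        using nzs by auto
      have "\<exists>\<delta>. (\<forall>p<n. \<delta> p \<noteq> 0) \<and> T * mat_diag n \<delta> = block_part n ms (C j)"
      proof (rule block_factor[where ms = ms, OF C(1)[OF j] T(2,3)])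
        fix p q assume pq: "p < n" "q < n" "p \<noteq> q"
        show "T $$ (p, q) = 0" if ns: "\<not> same_block ms p q"
        proof -
          obtain \<psi> where \<psi>: "\<theta> < \<psi>" "\<psi> < h" "ray_pr k \<psi> (lam p) = ray_pr k \<psi> (lam q)"
            using cross[OF pq ns] by blast
          \<comment> \<open>The meeting argument lies in \<open>(\<theta>, h)\<close>; shifted by
            \<open>(j - 1) * h\<close> it falls between the start of the rotated sector
            \<open>j\<close> and the end of the old sector \<open>j\<close>.\<close>
          obtain i where i: "j = Suc i" using j by (cases j) auto
          have "\<theta> + real j * h - h - \<eta> < \<psi> + real i * h" "\<psi> + real i * h < real j * h + \<eta>"
            using \<psi> \<eta> by (auto simp: i distrib_right)
          from vanish[OF pq \<psi>(3) this] show ?thesis using z pq(1,2) by blast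
        qed
        show "T' $$ (p, q) = 0" if sb: "same_block ms p q"
        proof -
          \<comment> \<open>Pairs within a block meet at \<phi> 1, and
            \<open>0 < \<phi> 1 < \<theta>\<close> places the shifted ray in the overlap with the
            old sector \<open>j + 1\<close>.\<close>
          have "real j * h - \<eta> < \<phi> 1 + real j * h" "\<phi> 1 + real j * h < \<theta> + real j * h + \<eta>"
            using ang' \<theta> \<eta> by auto
          from vanish[OF pq same[OF pq, THEN iffD1, OF sb] this] show ?thesis using z' pq(1,2) by blast
        qed
      next
        fix p q s assume pqs: "p < n" "q < n" "s < n" and sb: "same_block ms p q" "\<not> same_block ms p s"
        show "C j $$ (p, s) * T' $$ (s, q) = 0"
        proof (rule ccontr)
          assume "C j $$ (p, s) * T' $$ (s, q) \<noteq> 0"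
          \<comment> \<open>The ray of argument \<open>j * h\<close> lies in both overlaps, so
            \<open>C j\<close> and \<open>T'\<close> are triangular with respect to the same order.
            Two nonzero factors would place \<open>s\<close> between \<open>p\<close> and
            \<open>q\<close>, hence in their block.\<close>
          then have "\<not> ray_pr k (real j * h) (lam p) < ray_pr k (real j * h) (lam s)"
            "\<not> ray_pr k (real j * h) (lam s) < ray_pr k (real j * h) (lam q)"
            using Cpat(2)[OF j pqs(1,3)] z'[rule_format, OF pqs(3,2), of "real j * h"] \<eta> \<theta>(1) ang'(1) by auto
          then have "(- 1) ^ j * Re (lam s) \<le> (- 1) ^ j * Re (lam p)" "(- 1) ^ j * Re (lam q) \<le> (- 1) ^ j * Re (lam s)"
            by (auto simp: pr_jh)
          then have "Re (lam q) \<le> Re (lam s) \<and> Re (lam s) \<le> Re (lam p) \<or>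
              Re (lam p) \<le> Re (lam s) \<and> Re (lam s) \<le> Re (lam q)"
            by (cases "even j") auto
          then have "p \<le> s \<and> s \<le> q \<or> q \<le> s \<and> s \<le> p"
            using lam'[of s p] lam'[of q s] lam'[of p s] lam'[of s q] pqs by (meson not_le)
          moreover have mono: "block_of ms a \<le> block_of ms b" if "a \<le> b" "b < n" for a b
            using block_of_less[of a b ms] that ms by (cases "a = b") auto
          ultimately have "block_of ms s = block_of ms p"
            using sb(1) pqs by (metis same_block_def le_antisym)
          then show False using sb by (auto simp: same_block_def)
        qed
      qed (fact nz)+
      then obtain \<delta> where \<delta>: "\<forall>p<n. \<delta> p \<noteq> 0" "T * mat_diag n \<delta> = block_part n ms (C j)" by blast
      show "\<exists>\<delta> X. (\<forall>p<n. \<delta> p \<noteq> 0) \<and> X \<in> carrier_mat n n \<and>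
          C (wrap k (j + 0)) * X = block_part n ms (C j) \<and>
          (\<forall>x\<in>sector r (\<theta> + real j * pi / real k - pi / real k - \<eta>) (real (j + 0) * pi / real k + \<eta>).
            Ht j x * nf_sol n k D (Lt j) x * mat_diag n \<delta> = W (wrap k (j + 0)) x * block_part n ms (C j)) \<and>
          (\<forall>x\<in>sector r (real (j + 0) * pi / real k - \<eta>) (\<theta> + real j * pi / real k + \<eta>).
            Ht j x * nf_sol n k D (Lt j) x * mat_diag n \<delta> = W (wrap k (j + 0 + 1)) x * X)"
        unfolding add_0_right wrap_id[OF j]
        using rel[THEN spec, of \<delta>, unfolded \<delta>(2)] \<delta>(1) mult_carrier_mat[OF T(2) mat_diag_dim, of \<delta>]
        by (intro exI[of _ \<delta>] exI[of _ "T' * mat_diag n \<delta>"]) blast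
    qed (fact k \<sigma>(1) P Lt Htc Wc C | simp add: block_part_carrier Cinv)+
    then obtain Wt where "sectorial_solutions n k D r \<eta> \<theta> \<sigma> Ht Wt" "stokes_matrices n k r \<eta> \<theta> Wt
        (\<lambda>j. P_mat ms * Cinv j * C (wrap k (j + 0)) * block_part n ms (C (cyc_suc k j)) * P_mat ms)" by blast
    moreover from this(2) have "stokes_matrices n k r \<eta> \<theta> Wt
        (\<lambda>j. P_mat ms * Cinv j * C j * block_part n ms (C (cyc_suc k j)) * P_mat ms)"
      by (rule stokes_matrices_cong) (simp add: wrap_id)
    ultimately show ?thesis by blast
  next
    case False
    \<comment> \<open>A pair in different blocks would meet in \<open>(\<theta>, h)\<close>, which
      is empty now. Since \<open>n\<close> is at least 2, each index has a partner and thus lies in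
      the block itself.\<close>
    then have all: "same_block ms p q" if "p < n" "q < n" for p q
    proof -
      have ne: "same_block ms p q" if "p < n" "q < n" "p \<noteq> q" for p q
        using cross[OF that] \<open>\<not> \<theta> < h\<close> by force
      obtain q' where "q' < n" "q' \<noteq> p" using n2 by (metis One_nat_def Suc_1 Suc_le_lessD less_le_trans zero_less_Suc zero_neq_one)
      then have "same_block ms p q'" using ne[of p q'] that(1) by simp
      then have "same_block ms p p" by (auto simp: same_block_def)
      then show ?thesis using ne that by (cases "p = q") auto
    qed
    have bp: "block_part n ms M = M" if "M \<in> carrier_mat n n" for M
      using that all by (intro eq_matI) (auto simp: block_part_def)
    have "\<exists>Wt. sectorial_solutions n k D r \<eta> \<theta> \<sigma> Ht Wt \<and> stokes_matrices n k r \<eta> \<theta> Wt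
        (\<lambda>j. P_mat ms * 1\<^sub>m n * C (wrap k (j + 1)) * 1\<^sub>m n * P_mat ms)"
    proof (rule rotated_stokes_matrices[where e = 1 and Q = "\<lambda>_. 1\<^sub>m n" and Qi = "\<lambda>_. 1\<^sub>m n"
          and Lt = Lt and W = W])
      show "real 1 * pi / real k \<le> \<theta>" "\<theta> \<le> real (1 + 1) * pi / real k"
        using False ang' by (auto simp: h_def)
      fix j assume j: "j \<in> {1..2 * k}"
      have e: "real 1 * h \<le> \<theta>" "\<theta> \<le> real (1 + 1) * h" using False ang' by auto
      from trans[OF j e] obtain T T' where
        T: "T \<in> carrier_mat n n" "T' \<in> carrier_mat n n" "T = C (wrap k (j + 1)) * T'"
        and rel: "\<forall>\<delta>. C (wrap k (j + 1)) * (T' * mat_diag n \<delta>) = T * mat_diag n \<delta> \<and>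
        (\<forall>x\<in>sector r (\<theta> + real j * pi / real k - pi / real k - \<eta>) (real (j + 1) * pi / real k + \<eta>).
          Ht j x * nf_sol n k D (Lt j) x * mat_diag n \<delta> = W (wrap k (j + 1)) x * (T * mat_diag n \<delta>)) \<and>
        (\<forall>x\<in>sector r (real (j + 1) * pi / real k - \<eta>) (\<theta> + real j * pi / real k + \<eta>).
          Ht j x * nf_sol n k D (Lt j) x * mat_diag n \<delta> = W (wrap k (j + 1 + 1)) x * (T' * mat_diag n \<delta>))"
        and nz: "\<forall>p<n. T $$ (p, p) \<noteq> 0 \<and> T' $$ (p, p) \<noteq> 0"
        and z: "\<forall>p<n. \<forall>q<n. \<forall>\<psi>. \<theta> + real j * h - h - \<eta> < \<psi> \<and> \<psi> < real (j + 1) * h + \<eta> \<and>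
          ray_pr k \<psi> (lam p) < ray_pr k \<psi> (lam q) \<longrightarrow> T $$ (p, q) = 0"
        by (elim exE conjE) (rule that)
      \<comment> \<open>By \<open>\<theta> < \<phi> 1 + h\<close> the shifted first separating ray
        lies in the overlap with the old sector \<open>j + 1\<close>. All pairs meet on it, so this
        transition is diagonal and scaling makes it the identity.\<close>
      have off: "T $$ (p, q) = 0" if pq: "p < n" "q < n" "p \<noteq> q" for p q
      proof -
        have "\<theta> + real j * h - h - \<eta> < \<phi> 1 + real j * h" "\<phi> 1 + real j * h < real (j + 1) * h + \<eta>"
          using ang' \<eta> by (auto simp: distrib_right)
        from vanish[OF pq same[OF pq, THEN iffD1, OF all[OF pq(1,2)]] this]
        show ?thesis using z pq(1,2) by blast
      qed
      define \<delta> where "\<delta> q = 1 / T $$ (q, q)" for q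
      have \<delta>: "\<forall>p<n. \<delta> p \<noteq> 0" using nz by (simp add: \<delta>_def)
      have T\<delta>: "T * mat_diag n \<delta> = 1\<^sub>m n"
        unfolding mat_diag_mult_right[OF T(1)] using nz off by (intro eq_matI) (auto simp: \<delta>_def)
      show "\<exists>\<delta> X. (\<forall>p<n. \<delta> p \<noteq> 0) \<and> X \<in> carrier_mat n n \<and>
          C (wrap k (j + 1)) * X = 1\<^sub>m n \<and>
          (\<forall>x\<in>sector r (\<theta> + real j * pi / real k - pi / real k - \<eta>) (real (j + 1) * pi / real k + \<eta>).
            Ht j x * nf_sol n k D (Lt j) x * mat_diag n \<delta> = W (wrap k (j + 1)) x * 1\<^sub>m n) \<and>
          (\<forall>x\<in>sector r (real (j + 1) * pi / real k - \<eta>) (\<theta> + real j * pi / real k + \<eta>).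
            Ht j x * nf_sol n k D (Lt j) x * mat_diag n \<delta> = W (wrap k (j + 1 + 1)) x * X)"
        using rel[THEN spec, of \<delta>, unfolded T\<delta>] \<delta> mult_carrier_mat[OF T(2) mat_diag_dim, of \<delta>]
        by (intro exI[of _ \<delta>] exI[of _ "T' * mat_diag n \<delta>"]) blast
    qed (fact k \<sigma>(1) P Lt Htc Wc C | simp)+
    then obtain Wt where Wt: "sectorial_solutions n k D r \<eta> \<theta> \<sigma> Ht Wt" "stokes_matrices n k r \<eta> \<theta> Wt
        (\<lambda>j. P_mat ms * 1\<^sub>m n * C (wrap k (j + 1)) * 1\<^sub>m n * P_mat ms)" by blast
    have "stokes_matrices n k r \<eta> \<theta> Wt
        (\<lambda>j. P_mat ms * Cinv j * C j * block_part n ms (C (cyc_suc k j)) * P_mat ms)"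
    \<comment> \<open>With one block the block diagonal part is the whole matrix:
      \<open>Cinv j\<close> cancels \<open>C j\<close>, and the right factor supplies the Stokes
      matrix of the next index.\<close>
    proof (rule stokes_matrices_cong[OF Wt(2)])
      fix j assume j: "j \<in> {1..2 * k}"
      have C': "C (wrap k (j + 1)) \<in> carrier_mat n n" using C(1) wrap_mem[OF k] by blast
      have "P_mat ms * Cinv j * C j = P_mat ms * (Cinv j * C j)"
        by (rule assoc_mult_mat[OF P(1) Cinv(1)[OF j] C(1)[OF j]])
      also have "\<dots> = P_mat ms * 1\<^sub>m n" using Cinv(2)[OF j] bp[OF C(1)[OF j]] by simp
      finally have "P_mat ms * Cinv j * C j = P_mat ms * 1\<^sub>m n" .
      moreover have "P_mat ms * 1\<^sub>m n * C (wrap k (j + 1)) * 1\<^sub>m n = P_mat ms * 1\<^sub>m n * C (wrap k (j + 1))"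
        by (rule right_mult_one_mat[of _ n n]) (intro mult_carrier_mat[of _ n n _ n] P(1) C' one_carrier_mat)
      ultimately show "P_mat ms * 1\<^sub>m n * C (wrap k (j + 1)) * 1\<^sub>m n * P_mat ms =
          P_mat ms * Cinv j * C j * block_part n ms (C (cyc_suc k j)) * P_mat ms"
        unfolding cyc_suc_eq_wrap[OF j] bp[OF C'] by simp
    qed
    then show ?thesis using Wt(1) by blast
  qed
  then show ?thesis unfolding Cinv_def block_diag_block[OF ms] .
qed

end
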